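(* Let $n \ge 2$ and let $\Omega \subset \mathbb{R}^n$ be a bounded open domain with $C^{1,\gamma}$ boundary for some $\gamma \in (0,1)$. Put $\beta_n = (n-1)\left(\frac{\omega_{n-1}}{2}\right)^{\frac{1}{n-1}}$. Then for every real $\alpha < \beta_n$ there exists a constant $C = C(n,\alpha,\Omega)$ such that for every $u \in C^1(\overline{\Omega}) \cap C(\partial\Omega)$ with $\int_{\Omega} u \, dx = 0$ and $\|\nabla u\|_{L^n(\Omega)} \le 1$, $$\int_{\partial\Omega} e^{\alpha |u|^{\frac{n}{n-1}}} \, d\mathcal{H}_{n-1} \le C.$$
   Context: Functions are real-valued. A domain is a connected open set. $\omega_{n-1}$ denotes the $(n-1)$-dimensional Hausdorff (surface) measure of the unit sphere $\mathbb{S}^{n-1} \subset \mathbb{R}^n$, and $\mathcal{H}_{n-1}$ denotes $(n-1)$-dimensional Hausdorff measure (surface measure on $\partial\Omega$). $\|\nabla u\|_{L^n(\Omega)} = \left(\int_\Omega |\nabla u|^n dx\right)^{1/n}$. *)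

theory Defs
  imports "HOL-Analysis.Analysis"
begin

text \<open>
  The \<open>k\<close>-dimensional Hausdorff measure on a metric space, for integer \<open>k\<close>, normalised by the factor
  \<open>unit_ball_vol k / 2 ^ k\<close>, for which it is the usual surface measure on \<open>k\<close>-dimensional
  submanifolds of Euclidean space. The empty set is treated separately because \<open>0 ^ 0 = 1\<close>.
\<close>

definition hausdorff_gauge :: "nat \<Rightarrow> 'a::metric_space set \<Rightarrow> ennreal" where
  "hausdorff_gauge k S =
     (if S = {} then 0 else ennreal (unit_ball_vol (real k) * (diameter S / 2) ^ k))"

text \<open>
  The condition \<open>bounded (C i)\<close> is needed since \<^const>\<open>diameter\<close> is unspecified on unbounded sets.
\<close>

definition hausdorff_covers :: "real \<Rightarrow> 'a::metric_space set \<Rightarrow> (nat \<Rightarrow> 'a set) set" where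
  "hausdorff_covers \<delta> A =
     {C. A \<subseteq> (\<Union>i. C i) \<and> (\<forall>i. bounded (C i) \<and> diameter (C i) \<le> \<delta>)}"

definition hausdorff_premeasure :: "nat \<Rightarrow> real \<Rightarrow> 'a::metric_space set \<Rightarrow> ennreal" where
  "hausdorff_premeasure k \<delta> A = (INF C\<in>hausdorff_covers \<delta> A. \<Sum>i. hausdorff_gauge k (C i))"

definition hausdorff_outer_measure :: "nat \<Rightarrow> 'a::metric_space set \<Rightarrow> ennreal" where
  "hausdorff_outer_measure k A = (SUP \<delta>\<in>{0<..}. hausdorff_premeasure k \<delta> A)"

definition hausdorff_measure :: "nat \<Rightarrow> 'a::metric_space measure" where
  "hausdorff_measure k = measure_of UNIV (sets borel) (hausdorff_outer_measure k)"

text \<open>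
  The Caratheodory criterion: every Borel set is measurable for the outer measure, which therefore
  is the measure of every Borel set.
\<close>

lemma hausdorff_gauge_empty [simp]: "hausdorff_gauge k {} = 0"
  by (simp add: hausdorff_gauge_def)

lemma hausdorff_premeasure_le:
  assumes "C \<in> hausdorff_covers \<delta> A"
  shows "hausdorff_premeasure k \<delta> A \<le> (\<Sum>i. hausdorff_gauge k (C i))"
  unfolding hausdorff_premeasure_def using assms by (rule INF_lower)

lemma hausdorff_premeasure_mono:
  assumes "A \<subseteq> B" "\<epsilon> \<le> \<delta>"
  shows "hausdorff_premeasure k \<delta> A \<le> hausdorff_premeasure k \<epsilon> B"
  unfolding hausdorff_premeasure_def
proof (rule INF_superset_mono)
  show "hausdorff_covers \<epsilon> B \<subseteq> hausdorff_covers \<delta> A"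
    using assms unfolding hausdorff_covers_def by (blast intro: order_trans)
qed simp

lemma hausdorff_premeasure_empty:
  assumes "0 < \<delta>"
  shows "hausdorff_premeasure k \<delta> {} = 0"
  using hausdorff_premeasure_le[of "\<lambda>_. {}" \<delta> "{}" k] assms
  by (simp add: hausdorff_covers_def)

lemma hausdorff_premeasure_UN:
  "hausdorff_premeasure k \<delta> (\<Union>n. A n) \<le> (\<Sum>n. hausdorff_premeasure k \<delta> (A n))"
proof (rule ennreal_le_epsilon)
  fix e :: real
  assume "0 < e" and fin: "(\<Sum>n. hausdorff_premeasure k \<delta> (A n)) < top"
  then have *: "hausdorff_premeasure k \<delta> (A n) < hausdorff_premeasure k \<delta> (A n) + e * (1/2) ^ Suc n" for n
    by (auto simp add: less_top dest!: ennreal_suminf_lessD)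
  have "\<exists>C\<in>hausdorff_covers \<delta> (A n). (\<Sum>i. hausdorff_gauge k (C i))
          < hausdorff_premeasure k \<delta> (A n) + e * (1/2) ^ Suc n" for n
    using *[of n] unfolding hausdorff_premeasure_def by (subst (asm) (1) INF_less_iff)
  then obtain B where B: "\<And>n. B n \<in> hausdorff_covers \<delta> (A n)"
    and Ble: "\<And>n. (\<Sum>i. hausdorff_gauge k (B n i)) \<le> hausdorff_premeasure k \<delta> (A n) + e * (1/2) ^ Suc n"
    by (metis less_imp_le)
  define C where "C = case_prod B o prod_decode"
  have "(\<Union>n. A n) \<subseteq> (\<Union>i. C i)"
  proof safe
    fix x n assume "x \<in> A n"
    then obtain i where "x \<in> B n i" using B[of n] by (auto simp: hausdorff_covers_def)
    then have "x \<in> C (prod_encode (n, i))" by (simp add: C_def)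
    then show "x \<in> (\<Union>i. C i)" by blast
  qed
  with B have "C \<in> hausdorff_covers \<delta> (\<Union>n. A n)"
    by (auto simp: hausdorff_covers_def C_def split_def)
  then have "hausdorff_premeasure k \<delta> (\<Union>n. A n) \<le> (\<Sum>i. hausdorff_gauge k (C i))"
    by (rule hausdorff_premeasure_le)
  also have "\<dots> = (\<Sum>n. \<Sum>i. hausdorff_gauge k (B n i))"
    unfolding C_def comp_def by (intro suminf_ennreal_2dimen) auto
  also have "\<dots> \<le> (\<Sum>n. hausdorff_premeasure k \<delta> (A n) + e * (1/2) ^ Suc n)"
    by (intro suminf_le allI Ble) auto
  also have "\<dots> = (\<Sum>n. hausdorff_premeasure k \<delta> (A n)) + (\<Sum>n. ennreal e * ennreal ((1/2) ^ Suc n))"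
    using \<open>0 < e\<close> by (subst suminf_add[symmetric])
                     (auto simp del: ennreal_suminf_cmult simp add: ennreal_mult[symmetric])
  also have "\<dots> = (\<Sum>n. hausdorff_premeasure k \<delta> (A n)) + e"
    unfolding ennreal_suminf_cmult
    by (subst suminf_ennreal_eq[OF zero_le_power power_half_series]) auto
  finally show "hausdorff_premeasure k \<delta> (\<Union>n. A n) \<le> (\<Sum>n. hausdorff_premeasure k \<delta> (A n)) + e" .
qed

lemma hausdorff_premeasure_le_outer:
  "0 < \<delta> \<Longrightarrow> hausdorff_premeasure k \<delta> A \<le> hausdorff_outer_measure k A"
  unfolding hausdorff_outer_measure_def by (rule SUP_upper) simp

lemma hausdorff_outer_measure_empty [simp]: "hausdorff_outer_measure k {} = 0"
  unfolding hausdorff_outer_measure_def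
  by (rule antisym) (auto intro!: SUP_least simp: hausdorff_premeasure_empty)

lemma hausdorff_outer_measure_mono:
  "A \<subseteq> B \<Longrightarrow> hausdorff_outer_measure k A \<le> hausdorff_outer_measure k B"
  unfolding hausdorff_outer_measure_def by (rule SUP_mono') (simp add: hausdorff_premeasure_mono)

lemma hausdorff_outer_measure_UN:
  "hausdorff_outer_measure k (\<Union>n. A n) \<le> (\<Sum>n. hausdorff_outer_measure k (A n))"
proof -
  have "hausdorff_premeasure k \<delta> (\<Union>n. A n) \<le> (\<Sum>n. hausdorff_outer_measure k (A n))"
    if "0 < \<delta>" for \<delta>
    using that
    by (intro order_trans[OF hausdorff_premeasure_UN] suminf_le hausdorff_premeasure_le_outer) auto
  then show ?thesis
    by (subst (1) hausdorff_outer_measure_def) (auto intro: SUP_least)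
qed

lemma outer_measure_space_hausdorff:
  "outer_measure_space (Pow UNIV) (hausdorff_outer_measure k)"
  by (auto simp: outer_measure_space_def positive_def increasing_def countably_subadditive_def
      hausdorff_outer_measure_mono hausdorff_outer_measure_UN)

lemma hausdorff_outer_measure_Un:
  "hausdorff_outer_measure k (A \<union> B) \<le> hausdorff_outer_measure k A + hausdorff_outer_measure k B"
proof -
  interpret ring_of_sets UNIV "Pow UNIV :: 'a set set"
    by (rule ring_of_sets_Pow)
  have "subadditive (Pow UNIV) (hausdorff_outer_measure k :: 'a set \<Rightarrow> _)"
    using outer_measure_space_hausdorff[of k]
    by (intro countably_subadditive_subadditive) (auto simp: outer_measure_space_def)
  from subadditiveD[OF this, of A "B - A"]
  have "hausdorff_outer_measure k (A \<union> B)
      \<le> hausdorff_outer_measure k A + hausdorff_outer_measure k (B - A)"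
    by simp
  also have "\<dots> \<le> hausdorff_outer_measure k A + hausdorff_outer_measure k B"
    by (intro add_left_mono hausdorff_outer_measure_mono) auto
  finally show ?thesis .
qed

lemma hausdorff_premeasure_separated:
  assumes sep: "\<And>x y. x \<in> A \<Longrightarrow> y \<in> B \<Longrightarrow> d \<le> dist x y" and "\<delta> < d"
  shows "hausdorff_premeasure k \<delta> A + hausdorff_premeasure k \<delta> B \<le> hausdorff_premeasure k \<delta> (A \<union> B)"
  unfolding hausdorff_premeasure_def[of k \<delta> "A \<union> B"]
proof (rule INF_greatest)
  fix C assume C: "C \<in> hausdorff_covers \<delta> (A \<union> B)"
  define CA where "CA i = (if C i \<inter> A = {} then {} else C i)" for i
  define CB where "CB i = (if C i \<inter> B = {} then {} else C i)" for i
  have bC: "bounded (C i)" and dC: "diameter (C i) \<le> \<delta>" for i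
    using C by (auto simp: hausdorff_covers_def)
  have "0 \<le> \<delta>"
    using diameter_ge_0[OF bC[of 0]] dC[of 0] by linarith
  then have "CA \<in> hausdorff_covers \<delta> A" "CB \<in> hausdorff_covers \<delta> B"
    using C by (fastforce simp: hausdorff_covers_def CA_def CB_def)+
  then have "hausdorff_premeasure k \<delta> A + hausdorff_premeasure k \<delta> B
      \<le> (\<Sum>i. hausdorff_gauge k (CA i)) + (\<Sum>i. hausdorff_gauge k (CB i))"
    by (intro add_mono hausdorff_premeasure_le)
  also have "\<dots> = (\<Sum>i. hausdorff_gauge k (CA i) + hausdorff_gauge k (CB i))"
    by (rule suminf_add) auto
  also have "\<dots> \<le> (\<Sum>i. hausdorff_gauge k (C i))"
  proof (rule suminf_le)
    fix i
    have "C i \<inter> A = {} \<or> C i \<inter> B = {}"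
    proof (rule ccontr)
      assume "\<not> ?thesis"
      then obtain x y where "x \<in> C i" "x \<in> A" "y \<in> C i" "y \<in> B" by blast
      with sep[of x y] diameter_bounded_bound[OF bC[of i], of x y] dC[of i] \<open>\<delta> < d\<close>
      show False by auto
    qed
    then show "hausdorff_gauge k (CA i) + hausdorff_gauge k (CB i) \<le> hausdorff_gauge k (C i)"
      by (auto simp: CA_def CB_def)
  qed auto
  finally show "hausdorff_premeasure k \<delta> A + hausdorff_premeasure k \<delta> B \<le> (\<Sum>i. hausdorff_gauge k (C i))" .
qed

lemma hausdorff_outer_measure_separated:
  assumes sep: "\<And>x y. x \<in> A \<Longrightarrow> y \<in> B \<Longrightarrow> d \<le> dist x y" and "0 < d"
  shows "hausdorff_outer_measure k A + hausdorff_outer_measure k B \<le> hausdorff_outer_measure k (A \<union> B)"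
proof -
  have "hausdorff_outer_measure k A + hausdorff_outer_measure k B =
      (SUP \<delta>\<in>{0<..}. hausdorff_premeasure k \<delta> A + hausdorff_premeasure k \<delta> B)"
    unfolding hausdorff_outer_measure_def
  proof (rule SUP_add_directed_ennreal[symmetric])
    fix \<delta> \<epsilon> :: real assume "\<delta> \<in> {0<..}" "\<epsilon> \<in> {0<..}"
    then show "\<exists>m\<in>{0<..}. hausdorff_premeasure k \<delta> A + hausdorff_premeasure k \<epsilon> B
        \<le> hausdorff_premeasure k m A + hausdorff_premeasure k m B"
      by (intro bexI[of _ "min \<delta> \<epsilon>"] add_mono hausdorff_premeasure_mono) auto
  qed
  also have "\<dots> \<le> hausdorff_outer_measure k (A \<union> B)"
  proof (rule SUP_least)
    fix \<delta> :: real assume "\<delta> \<in> {0<..}"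
    define m where "m = min \<delta> (d / 2)"
    have m: "0 < m" "m < d" "m \<le> \<delta>"
      using \<open>\<delta> \<in> {0<..}\<close> \<open>0 < d\<close> by (auto simp: m_def)
    have "hausdorff_premeasure k \<delta> A + hausdorff_premeasure k \<delta> B
        \<le> hausdorff_premeasure k m A + hausdorff_premeasure k m B"
      using m by (intro add_mono hausdorff_premeasure_mono) auto
    also have "\<dots> \<le> hausdorff_premeasure k m (A \<union> B)"
      using sep m(2) by (rule hausdorff_premeasure_separated)
    also have "\<dots> \<le> hausdorff_outer_measure k (A \<union> B)"
      using m(1) by (rule hausdorff_premeasure_le_outer)
    finally show "hausdorff_premeasure k \<delta> A + hausdorff_premeasure k \<delta> B
        \<le> hausdorff_outer_measure k (A \<union> B)" .
  qed
  finally show ?thesis .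
qed

lemma hausdorff_outer_measure_shells:
  fixes F T :: "'a::metric_space set"
  defines "R \<equiv> \<lambda>j::nat. {x \<in> T. 1 / (real j + 2) \<le> infdist x F \<and> infdist x F < 1 / (real j + 1)}"
  shows "(\<Sum>i. hausdorff_outer_measure k (R (2 * i + s))) \<le> hausdorff_outer_measure k T"
proof (rule suminf_le_const)
  fix N
  have "(\<Sum>i<N. hausdorff_outer_measure k (R (2 * i + s)))
      \<le> hausdorff_outer_measure k (\<Union>i<N. R (2 * i + s))"
  proof (induction N)
    case (Suc N)
    define d where "d = 1 / (2 * real N + real s) - 1 / (2 * real N + real s + 1)"
    show ?case
    proof (cases "N = 0")
      case True
      then show ?thesis by (simp add: lessThan_Suc)
    next
      case False
      then have "0 < d" by (simp add: d_def frac_less2)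
      have "d \<le> dist x y" if x: "x \<in> (\<Union>i<N. R (2 * i + s))" and y: "y \<in> R (2 * N + s)" for x y
      proof -
        from x obtain i where "i < N" "1 / (2 * real i + real s + 2) \<le> infdist x F"
          by (auto simp: R_def)
        moreover from \<open>i < N\<close> have "1 / (2 * real N + real s) \<le> 1 / (2 * real i + real s + 2)"
          by (intro divide_left_mono mult_pos_pos) auto
        moreover have "infdist y F < 1 / (2 * real N + real s + 1)"
          using y by (auto simp: R_def)
        moreover have "infdist x F \<le> infdist y F + dist x y"
          by (rule infdist_triangle)
        ultimately show ?thesis by (simp add: d_def)
      qed
      from hausdorff_outer_measure_separated[where k = k, OF this \<open>0 < d\<close>] Suc.IH
      have "(\<Sum>i<N. hausdorff_outer_measure k (R (2 * i + s))) + hausdorff_outer_measure k (R (2 * N + s))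
          \<le> hausdorff_outer_measure k ((\<Union>i<N. R (2 * i + s)) \<union> R (2 * N + s))"
        by (meson add_right_mono order_trans)
      then show ?thesis by (simp add: lessThan_Suc Un_commute add.commute)
    qed
  qed simp
  also have "\<dots> \<le> hausdorff_outer_measure k T"
    by (rule hausdorff_outer_measure_mono) (auto simp: R_def)
  finally show "(\<Sum>i<N. hausdorff_outer_measure k (R (2 * i + s))) \<le> hausdorff_outer_measure k T" .
qed auto

lemma hausdorff_outer_measure_closed:
  fixes F T :: "'a::metric_space set"
  assumes "closed F" "F \<noteq> {}"
  shows "hausdorff_outer_measure k (T \<inter> F) + hausdorff_outer_measure k (T - F) \<le> hausdorff_outer_measure k T"
proof (rule ennreal_le_epsilon)
  fix e :: real
  assume fin: "hausdorff_outer_measure k T < top" and "0 < e"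
  define R where "R j = {x \<in> T. 1 / (real j + 2) \<le> infdist x F \<and> infdist x F < 1 / (real j + 1)}"
    for j :: nat
  define r where "r j = hausdorff_outer_measure k (R j)" for j
  have shells: "(\<Sum>i. r (2 * i + s)) \<le> hausdorff_outer_measure k T" for s
    unfolding r_def R_def by (rule hausdorff_outer_measure_shells)
  have "(\<Sum>j<2 * N. r j) = (\<Sum>i<N. r (2 * i)) + (\<Sum>i<N. r (2 * i + 1))" for N
    by (induction N) (simp_all add: algebra_simps)
  moreover have "(\<Sum>i<N. r (2 * i)) \<le> (\<Sum>i. r (2 * i + 0))" for N
    using sum_le_suminf[of "\<lambda>i. r (2 * i + 0)" "{..<N}"] by simp
  moreover have "(\<Sum>i<N. r (2 * i + 1)) \<le> (\<Sum>i. r (2 * i + 1))" for N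
    using sum_le_suminf[of "\<lambda>i. r (2 * i + 1)" "{..<N}"] by simp
  ultimately have even_bound: "(\<Sum>j<2 * N. r j) \<le> hausdorff_outer_measure k T + hausdorff_outer_measure k T" for N
    using order_trans[OF _ shells[of 0]] order_trans[OF _ shells[of 1]] by (simp add: add_mono)
  have "(\<Sum>j. r j) \<le> hausdorff_outer_measure k T + hausdorff_outer_measure k T"
  proof (rule suminf_le_const)
    fix N
    have "(\<Sum>j<N. r j) \<le> (\<Sum>j<2 * N. r j)"
      by (rule sum_mono2) auto
    with even_bound[of N]
    show "(\<Sum>j<N. r j) \<le> hausdorff_outer_measure k T + hausdorff_outer_measure k T"
      by (rule order_trans[rotated])
  qed auto
  with fin have sum_fin: "(\<Sum>j. r j) \<noteq> top"
    by (auto simp: top_unique)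
  define q where "q j = enn2real (r j)" for j
  have q_nonneg: "0 \<le> q j" for j
    by (simp add: q_def)
  have "r j \<noteq> top" for j
    using sum_fin ennreal_suminf_lessD[of r top j] by (simp add: less_top)
  then have rq: "r j = ennreal (q j)" for j
    by (simp add: q_def less_top)
  have "summable q"
    using sum_fin q_nonneg by (intro summable_suminf_not_top) (simp_all flip: rq)
  then obtain n where n: "norm (\<Sum>j. q (j + n)) < e"
    using suminf_exist_split[OF \<open>0 < e\<close>] by blast
  have "(\<Sum>j. r (j + n)) = ennreal (\<Sum>j. q (j + n))"
    unfolding rq using \<open>summable q\<close>
    by (intro suminf_ennreal2) (simp_all add: q_nonneg)
  with n have tail: "(\<Sum>j. r (j + n)) \<le> ennreal e"
    by (auto intro: ennreal_leI)
  define Tn where "Tn = {x \<in> T. 1 / (real n + 1) \<le> infdist x F}"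
  have "T - F \<subseteq> Tn \<union> (\<Union>j. R (j + n))"
  proof
    fix x assume x: "x \<in> T - F"
    define t where "t = infdist x F"
    have "0 < t"
      using x assms infdist_nonneg[of x F] in_closed_iff_infdist_zero[of F x] by (force simp: t_def)
    show "x \<in> Tn \<union> (\<Union>j. R (j + n))"
    proof (cases "1 / (real n + 1) \<le> t")
      case True
      with x show ?thesis by (simp add: Tn_def t_def)
    next
      case False
      obtain m0 :: nat where m0: "1 / t < real m0"
        using reals_Archimedean2 by blast
      define P where "P m \<longleftrightarrow> 1 / (real m + 2) \<le> t" for m :: nat
      have "1 / (real m0 + 2) \<le> t"
        using m0 \<open>0 < t\<close> by (simp add: field_simps)
      then have "P m0" by (simp add: P_def)
      define m where "m = (LEAST m. P m)"
      have "P m" unfolding m_def using \<open>P m0\<close> by (rule LeastI)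
      have "n \<le> m"
      proof (rule ccontr)
        assume "\<not> n \<le> m"
        then have "1 / (real n + 1) \<le> 1 / (real m + 2)"
          by (intro divide_left_mono mult_pos_pos) auto
        with \<open>P m\<close> False show False by (simp add: P_def)
      qed
      have "t < 1 / (real m + 1)"
      proof (cases "m = 0")
        case True
        with \<open>n \<le> m\<close> False show ?thesis by simp
      next
        case m: False
        then have "\<not> P (m - 1)"
          unfolding m_def by (intro not_less_Least) simp
        with m show ?thesis by (simp add: P_def of_nat_diff add.commute)
      qed
      with \<open>P m\<close> x have "x \<in> R m" by (simp add: R_def P_def t_def)
      with \<open>n \<le> m\<close> have "x \<in> R ((m - n) + n)" by simp
      then show ?thesis by blast
    qed
  qed
  then have "hausdorff_outer_measure k (T - F) \<le> hausdorff_outer_measure k (Tn \<union> (\<Union>j. R (j + n)))"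
    by (rule hausdorff_outer_measure_mono)
  also have "\<dots> \<le> hausdorff_outer_measure k Tn + hausdorff_outer_measure k (\<Union>j. R (j + n))"
    by (rule hausdorff_outer_measure_Un)
  also have "\<dots> \<le> hausdorff_outer_measure k Tn + (\<Sum>j. r (j + n))"
    unfolding r_def by (intro add_left_mono hausdorff_outer_measure_UN)
  also have "\<dots> \<le> hausdorff_outer_measure k Tn + e"
    using tail by (rule add_left_mono)
  finally have *: "hausdorff_outer_measure k (T - F) \<le> hausdorff_outer_measure k Tn + e" .
  have "1 / (real n + 1) \<le> dist x y" if "x \<in> T \<inter> F" "y \<in> Tn" for x y
    using that infdist_le[of x F y] by (auto simp: Tn_def dist_commute)
  then have "hausdorff_outer_measure k (T \<inter> F) + hausdorff_outer_measure k Tn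
      \<le> hausdorff_outer_measure k (T \<inter> F \<union> Tn)"
    by (rule hausdorff_outer_measure_separated) auto
  also have "\<dots> \<le> hausdorff_outer_measure k T"
    by (rule hausdorff_outer_measure_mono) (auto simp: Tn_def)
  finally have "hausdorff_outer_measure k (T \<inter> F) + hausdorff_outer_measure k Tn + e
      \<le> hausdorff_outer_measure k T + e"
    by (rule add_right_mono)
  then show "hausdorff_outer_measure k (T \<inter> F) + hausdorff_outer_measure k (T - F)
      \<le> hausdorff_outer_measure k T + e"
    using add_left_mono[OF *, of "hausdorff_outer_measure k (T \<inter> F)"]
    by (auto simp only: add.assoc intro: order_trans)
qed

lemma measure_space_hausdorff:
  "measure_space UNIV (sets borel) (hausdorff_outer_measure k :: 'a::metric_space set \<Rightarrow> ennreal)"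
proof -
  interpret sigma_algebra UNIV "Pow UNIV :: 'a set set"
    by (rule sigma_algebra_Pow)
  define L where "L = lambda_system UNIV (Pow UNIV) (hausdorff_outer_measure k :: 'a set \<Rightarrow> ennreal)"
  have L: "measure_space UNIV L (hausdorff_outer_measure k)"
    unfolding L_def by (rule caratheodory_lemma[OF outer_measure_space_hausdorff])
  then interpret L: sigma_algebra UNIV L
    by (simp add: measure_space_def)
  have "F \<in> L" if "closed F" for F
  proof (cases "F = {}")
    case False
    have "hausdorff_outer_measure k (T \<inter> F) + hausdorff_outer_measure k (T - F)
        = hausdorff_outer_measure k T" for T
      using hausdorff_outer_measure_closed[OF that False, of k T]
        hausdorff_outer_measure_Un[of k "T \<inter> F" "T - F"]
      by (simp add: Int_Diff_Un antisym)
    then show ?thesis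
      unfolding L_def lambda_system_eq by simp
  qed simp
  then have "sigma_sets UNIV (Collect closed) \<subseteq> L"
    by (intro L.sigma_sets_subset) blast
  then have "sets borel \<subseteq> L"
    by (simp add: borel_eq_closed)
  moreover have "sigma_algebra UNIV (sets borel :: 'a set set)"
    using sets.sigma_algebra_axioms[of "borel :: 'a measure"] by simp
  ultimately show ?thesis
    by (intro measure_down[OF L])
qed

lemma sets_hausdorff_measure [simp, measurable_cong]: "sets (hausdorff_measure k) = sets borel"
  unfolding hausdorff_measure_def using sets.sigma_sets_eq[of borel]
  by (simp add: sets_measure_of)

lemma space_hausdorff_measure [simp]: "space (hausdorff_measure k) = UNIV"
  by (simp add: hausdorff_measure_def space_measure_of)

lemma emeasure_hausdorff_measure:
  assumes "A \<in> sets borel"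
  shows "emeasure (hausdorff_measure k) A = hausdorff_outer_measure k A"
  using measure_space_hausdorff[of k] assms sets.sigma_sets_eq[of "borel :: 'a measure"]
  by (intro emeasure_measure_of[OF hausdorff_measure_def]) (auto simp: measure_space_def)

text \<open>
  \<open>f\<close> is of class \<open>C\<^sup>1\<^sup>,\<^sup>\<gamma>\<close> on \<open>S\<close>. The derivative is taken within \<open>S\<close>, so that \<open>S\<close> may be a relatively
  open subset of a hyperplane.
\<close>

definition C1_holder_on :: "real \<Rightarrow> 'a::euclidean_space set \<Rightarrow> ('a \<Rightarrow> real) \<Rightarrow> bool" where
  "C1_holder_on \<gamma> S f \<longleftrightarrow>
     (\<exists>g L. (\<forall>x\<in>S. (f has_derivative (\<lambda>h. h \<bullet> g x)) (at x within S)) \<and>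
            (\<forall>x\<in>S. \<forall>y\<in>S. norm (g x - g y) \<le> L * dist x y powr \<gamma>))"

text \<open>
  Near each boundary point \<open>p\<close>, in suitable Cartesian coordinates, \<open>\<Omega>\<close> is the region strictly above
  the graph of a \<open>C\<^sup>1\<^sup>,\<^sup>\<gamma>\<close> function of \<open>n - 1\<close> variables. The unit vector \<open>\<nu>\<close> gives the last coordinate
  axis, the other \<open>n - 1\<close> variables range over the hyperplane \<open>\<nu>\<^sup>\<bottom>\<close>, and \<open>x - (x \<bullet> \<nu>) \<nu>\<close> is the
  orthogonal projection of \<open>x\<close> to it.
\<close>

definition C1_holder_boundary :: "real \<Rightarrow> 'a::euclidean_space set \<Rightarrow> bool" where
  "C1_holder_boundary \<gamma> \<Omega> \<longleftrightarrow>
     (\<forall>p\<in>frontier \<Omega>. \<exists>r>0. \<exists>\<nu> f. norm \<nu> = 1 \<and>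
        C1_holder_on \<gamma> {y \<in> ball (p - (p \<bullet> \<nu>) *\<^sub>R \<nu>) r. y \<bullet> \<nu> = 0} f \<and>
        \<Omega> \<inter> ball p r = {x \<in> ball p r. f (x - (x \<bullet> \<nu>) *\<^sub>R \<nu>) < x \<bullet> \<nu>})"

definition grad :: "('a::euclidean_space \<Rightarrow> real) \<Rightarrow> 'a \<Rightarrow> 'a" where
  "grad u x = (THE D. GDERIV u x :> D)"

lemma grad_eq:
  assumes "GDERIV u x :> D"
  shows "grad u x = D"
proof -
  have "E = D" if "GDERIV u x :> E" for E
  proof -
    have "(\<lambda>h. h \<bullet> E) = (\<lambda>h. h \<bullet> D)"
      using that assms unfolding gderiv_def by (rule has_derivative_unique)
    then show ?thesis using vector_eq_ldot[of E D] by (simp add: fun_eq_iff)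
  qed
  with assms show ?thesis unfolding grad_def by (rule the_equality)
qed

text \<open>
  The space \<open>C\<^sup>1\<close> of the closure of an open set \<open>\<Omega>\<close>: \<open>u\<close> is continuous on the closure and
  differentiable in \<open>\<Omega>\<close>, and its gradient extends continuously to the closure.
\<close>

definition C1_closure :: "'a::euclidean_space set \<Rightarrow> ('a \<Rightarrow> real) \<Rightarrow> bool" where
  "C1_closure \<Omega> u \<longleftrightarrow>
     continuous_on (closure \<Omega>) u \<and>
     (\<exists>G. continuous_on (closure \<Omega>) G \<and> (\<forall>x\<in>\<Omega>. GDERIV u x :> G x))"

end

theory Submission
  imports Defs
begin

text \<open>
  The trace of \<open>u\<close> at a boundary point is dominated by a potential of \<open>\<bar>\<nabla>u\<bar>\<close>, and the constant \<open>\<beta>\<close> is the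
  one that Hoelder's inequality produces for this potential.

  Seen from a boundary point \<open>x\<close>, a \<open>C\<^sup>1\<close> domain is almost a half-space: for every \<open>e > 0\<close> there is a radius
  \<open>R\<close>, the same for all \<open>x\<close>, such that the cone \<open>{z. e * \<bar>z\<bar> < z \<bullet> N}\<close> truncated at \<open>R\<close> and attached to \<open>x\<close>
  lies in \<open>\<Omega>\<close> for some unit vector \<open>N\<close> (\<open>uniform_interior_cone\<close>). Integrate \<open>\<nabla>u\<close> along the segments from \<open>x\<close> to
  \<open>x + R z\<close> and average over the \<open>z\<close> in the cone and the unit ball. In polar coordinates this gives
  (\<open>cone_average_estimate\<close>)
  \<open>\<bar>u x\<bar> \<le> (1 / S) * (\<integral>y\<in>cone. \<bar>\<nabla>u (x + y)\<bar> / \<bar>y\<bar> ^ (n - 1)) + c * \<parallel>u\<parallel>\<close>,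
  where \<open>S\<close> is the area of the set of directions of the cone, and \<open>\<parallel>u\<parallel>\<close>, the norm in \<open>L\<^sup>1(\<Omega>)\<close>, is bounded by the Poincare
  inequality (\<open>poincare_L1\<close>), as \<open>u\<close> has mean zero.

  Cut the potential at \<open>\<bar>y\<bar> = r\<close>. By Hoelder's inequality, the far part divided by \<open>S\<close> is at most
  \<open>(ln (R / r) / S powr (1 / (n - 1))) powr ((n - 1) / n)\<close> (\<open>far_potential_le\<close>). Choose \<open>r\<close> such that this is a
  fixed fraction, close to 1, of a level \<open>t\<close>. Wherever \<open>\<bar>u\<bar> \<ge> t\<close>, the near part then exceeds a fixed
  positive constant. Since the surface measure of \<open>\<partial>\<Omega>\<close> in a ball of radius \<open>\<rho>\<close> is \<open>O(\<rho> ^ (n - 1))\<close>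
  (\<open>frontier_upper_regular\<close>), the near part is that large only on a set of measure \<open>O(r ^ (n - 1))\<close>. So the
  measure of \<open>{\<bar>u\<bar> \<ge> t}\<close> decays like \<open>exp (- b * t powr (n / (n - 1)))\<close> (\<open>trace_tail_estimate\<close>) for every
  \<open>b\<close> below \<open>(n - 1) * S powr (1 / (n - 1))\<close>, and the exponential integral with any \<open>\<alpha> < b\<close> is bounded
  (\<open>exp_integral_le_of_tail\<close>).

  As \<open>e\<close> tends to 0, \<open>S\<close> tends to half the area \<open>n * \<bar>B\<bar>\<close> of the unit sphere, \<open>B\<close> being the unit ball
  (\<open>wide_cone_almost_half\<close>). In the theorem that area is a Hausdorff measure \<open>\<omega>\<close>, for which
  \<open>\<omega> \<le> n * \<bar>B\<bar>\<close> (\<open>hausdorff_outer_measure_sphere_le\<close>) suffices.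
\<close>

section \<open>Lebesgue measure under affine and orthogonal maps\<close>

lemma nn_integral_lborel_affine:
  fixes t :: "'a::euclidean_space"
  assumes [measurable]: "f \<in> borel_measurable borel" and c: "c \<noteq> 0"
  shows "(\<integral>\<^sup>+x. f x \<partial>lborel) = ennreal (\<bar>c\<bar> ^ DIM('a)) * (\<integral>\<^sup>+x. f (t + c *\<^sub>R x) \<partial>lborel)"
  by (subst lborel_affine[OF c, of t])
     (simp add: nn_integral_density nn_integral_distr nn_integral_cmult)

lemma nn_integral_lborel_translate:
  fixes t :: "'a::euclidean_space"
  assumes "f \<in> borel_measurable borel"
  shows "(\<integral>\<^sup>+x. f (t + x) \<partial>lborel) = (\<integral>\<^sup>+x. f x \<partial>lborel)"
  using nn_integral_lborel_affine[OF assms, of 1 t] by simp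

lemma nn_integral_lborel_reflect:
  fixes t :: "'a::euclidean_space"
  assumes "f \<in> borel_measurable borel"
  shows "(\<integral>\<^sup>+x. f (t - x) \<partial>lborel) = (\<integral>\<^sup>+x. f x \<partial>lborel)"
  using nn_integral_lborel_affine[OF assms, of "-1" t] by simp

text \<open>
  The pushforward of Lebesgue measure under an orthogonal map is translation invariant and agrees with
  Lebesgue measure on the unit ball \<open>B\<close>. Two translation invariant measures are proportional, which is
  seen by evaluating \<open>\<integral>\<integral> f (T x) * indicator B (T x - y) dy dx\<close> in both orders.
\<close>

lemma nn_integral_lborel_orthogonal:
  fixes T :: "'a::euclidean_space \<Rightarrow> 'a"
  assumes T: "orthogonal_transformation T" and f[measurable]: "f \<in> borel_measurable borel"
  shows "(\<integral>\<^sup>+x. f (T x) \<partial>lborel) = (\<integral>\<^sup>+x. f x \<partial>lborel)"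
proof -
  define B where "B = ball (0::'a) 1"
  have [measurable]: "B \<in> sets borel" by (simp add: B_def)
  have lin: "linear T" using T by (rule orthogonal_transformation_linear)
  then have [measurable]: "T \<in> borel_measurable borel"
    by (intro borel_measurable_continuous_onI linear_continuous_on linear_conv_bounded_linear[THEN iffD1])
  have TB: "T x \<in> B \<longleftrightarrow> x \<in> B" for x
    using T by (simp add: B_def orthogonal_transformation_norm)
  let ?V = "emeasure lborel B"
  have V: "(\<integral>\<^sup>+y. indicator B (T x - y) \<partial>lborel) = ?V" for x
    by (subst nn_integral_lborel_reflect) auto
  have "(\<integral>\<^sup>+x. f (T x) \<partial>lborel) * ?V = (\<integral>\<^sup>+x. f (T x) * ?V \<partial>lborel)"
    by (simp add: nn_integral_multc)
  also have "\<dots> = (\<integral>\<^sup>+x. \<integral>\<^sup>+y. f (T x) * indicator B (T x - y) \<partial>lborel \<partial>lborel)"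
    by (simp add: nn_integral_cmult V)
  also have "\<dots> = (\<integral>\<^sup>+y. \<integral>\<^sup>+x. f (T x) * indicator B (T x - y) \<partial>lborel \<partial>lborel)"
    by (rule lborel_pair.Fubini'[symmetric]) measurable
  also have "\<dots> = (\<integral>\<^sup>+y. \<integral>\<^sup>+x. f (T x + y) * indicator B x \<partial>lborel \<partial>lborel)"
  proof (rule nn_integral_cong)
    fix y
    obtain y' where y': "y = T y'"
      using orthogonal_transformation_surj[OF T] by (metis surjD)
    have "(\<integral>\<^sup>+x. f (T x) * indicator B (T x - y) \<partial>lborel)
        = (\<integral>\<^sup>+x. f (T (y' + x)) * indicator B (T (y' + x) - y) \<partial>lborel)"
      by (rule nn_integral_lborel_translate[symmetric]) measurable
    also have "\<dots> = (\<integral>\<^sup>+x. f (T x + y) * indicator B x \<partial>lborel)"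
      by (simp add: linear_add[OF lin] y' TB indicator_def add.commute)
    finally show "(\<integral>\<^sup>+x. f (T x) * indicator B (T x - y) \<partial>lborel)
        = (\<integral>\<^sup>+x. f (T x + y) * indicator B x \<partial>lborel)" .
  qed
  also have "\<dots> = (\<integral>\<^sup>+x. \<integral>\<^sup>+y. f (T x + y) * indicator B x \<partial>lborel \<partial>lborel)"
    by (rule lborel_pair.Fubini') measurable
  also have "\<dots> = (\<integral>\<^sup>+x. f x \<partial>lborel) * ?V"
    by (simp add: nn_integral_multc nn_integral_lborel_translate nn_integral_cmult)
  finally have "(\<integral>\<^sup>+x. f (T x) \<partial>lborel) * ?V = (\<integral>\<^sup>+x. f x \<partial>lborel) * ?V" .
  moreover have "?V \<noteq> 0" "?V < top"
    using emeasure_lborel_ball_finite[of "0::'a" 1] emeasure_ball[of 1 "0::'a"] unit_ball_vol_pos[of "DIM('a)"]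
    by (auto simp: B_def simp del: unit_ball_vol_pos)
  ultimately show ?thesis
    by (metis mult.commute ennreal_mult_cancel_left less_top)
qed

lemma emeasure_lborel_orthogonal_vimage:
  fixes T :: "'a::euclidean_space \<Rightarrow> 'a"
  assumes T: "orthogonal_transformation T" and A[measurable]: "A \<in> sets borel"
  shows "emeasure lborel (T -` A) = emeasure lborel A"
proof -
  have "linear T" using T by (rule orthogonal_transformation_linear)
  then have [measurable]: "T \<in> borel_measurable borel"
    by (intro borel_measurable_continuous_onI linear_continuous_on linear_conv_bounded_linear[THEN iffD1])
  have "T -` A \<in> sets borel" using measurable_sets[of T borel borel A] by simp
  moreover have "(\<integral>\<^sup>+x. indicator A (T x) \<partial>lborel) = (\<integral>\<^sup>+x. indicator A x \<partial>lborel)"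
    by (rule nn_integral_lborel_orthogonal[OF T]) measurable
  moreover have "(\<lambda>x. indicator A (T x) :: ennreal) = indicator (T -` A)"
    by (auto simp: indicator_def)
  ultimately show ?thesis by simp
qed

text \<open>
  The reflection in the hyperplane orthogonal to \<open>p - q\<close> exchanges \<open>p\<close> and \<open>q\<close>.
\<close>

lemma orthogonal_reflection:
  fixes p q :: "'a::euclidean_space"
  assumes "norm p = norm q"
  obtains T where "orthogonal_transformation T" "T p = q" "\<And>x. T (T x) = x"
proof (cases "p = q")
  case True
  then show ?thesis using that[of id] by (simp add: orthogonal_transformation_def id_def)
next
  case False
  define w where "w = p - q"
  define T where "T x = x - (2 * (x \<bullet> w) / (w \<bullet> w)) *\<^sub>R w" for x
  have w: "w \<bullet> w \<noteq> 0" using False by (simp add: w_def)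
  have pq: "p \<bullet> p = q \<bullet> q" using assms by (simp add: dot_square_norm)
  then have *: "w \<bullet> w = 2 * (p \<bullet> w)" by (simp add: w_def inner_simps inner_commute)
  have "linear T"
    unfolding T_def by (rule linearI) (simp_all add: inner_simps algebra_simps add_divide_distrib)
  moreover have "T x \<bullet> T y = x \<bullet> y" for x y
    using w by (simp add: T_def inner_simps inner_commute field_simps)
  ultimately have "orthogonal_transformation T"
    by (simp add: orthogonal_transformation_def)
  moreover have "T p = q" using w unfolding T_def * by (simp add: w_def)
  moreover have "T (T x) = x" for x
  proof -
    have "T x \<bullet> w = - (x \<bullet> w)" using w by (simp add: T_def inner_simps)
    then show ?thesis by (simp add: T_def[of "T x"]) (simp add: T_def)
  qed
  ultimately show ?thesis by (rule that)
qed

section \<open>Polar coordinates in a cone\<close>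

lemma nn_integral_inverse_power_tail:
  assumes a: "0 < a" and n: "0 < n"
  shows "(\<integral>\<^sup>+s. indicator {a<..} s * ennreal (1 / s ^ Suc n) \<partial>lborel) = ennreal (1 / (real n * a ^ n))"
proof -
  have "(\<integral>\<^sup>+s. indicator {a<..} s * ennreal (1 / s ^ Suc n) \<partial>lborel)
      = (\<integral>\<^sup>+s. ennreal (1 / s ^ Suc n) * indicator {a..} s \<partial>lborel)"
    using AE_lborel_singleton[of a]
    by (intro nn_integral_cong_AE) (auto simp: indicator_def elim!: eventually_mono)
  also have "\<dots> = ennreal (0 - (- 1 / (real n * a ^ n)))"
  proof (rule nn_integral_FTC_atLeast)
    fix s assume "a \<le> s"
    with a have "0 < s" by simp
    have eq: "real n * (real n * s ^ (n - Suc 0)) / (real n * s ^ n * (real n * s ^ n)) = 1 / s ^ Suc n"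
    proof -
      have "s ^ n = s * s ^ (n - Suc 0)" using n by (cases n) auto
      then show ?thesis using n \<open>0 < s\<close> by (simp add: field_simps)
    qed
    show "((\<lambda>s. - 1 / (real n * s ^ n)) has_real_derivative 1 / s ^ Suc n) (at s)"
      using \<open>0 < s\<close> n eq by (auto intro!: derivative_eq_intros simp: mult_ac)
    show "0 \<le> 1 / s ^ Suc n" using \<open>0 < s\<close> by simp
  next
    have "filterlim (\<lambda>s::real. real n * s ^ n) at_top at_top"
      using n by (intro filterlim_tendsto_pos_mult_at_top[OF tendsto_const] filterlim_pow_at_top filterlim_ident) auto
    then show "((\<lambda>s. - 1 / (real n * s ^ n)) \<longlongrightarrow> 0) at_top"
      by (intro tendsto_divide_0[OF tendsto_const] filterlim_at_top_imp_at_infinity)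
  qed auto
  finally show ?thesis by simp
qed

text \<open>
  Polar coordinates without a measure on the sphere: the directions are represented by the points \<open>z\<close> of
  the solid sector \<open>K \<inter> ball 0 1\<close>. The substitution \<open>y = s z\<close> for fixed \<open>s\<close> turns the left-hand side into
  an integral over \<open>\<bar>y\<bar> < s\<close>, and integrating \<open>s\<close> from \<open>\<bar>y\<bar>\<close> to infinity leaves the weight \<open>\<bar>y\<bar>\<close> to the
  power \<open>1 - n\<close>.
\<close>

lemma polar_cone:
  fixes w :: "'a::euclidean_space \<Rightarrow> ennreal"
  assumes [measurable]: "w \<in> borel_measurable borel" "K \<in> sets borel"
    and K: "\<And>z s. z \<in> K \<Longrightarrow> 0 < s \<Longrightarrow> s *\<^sub>R z \<in> K" and "0 \<notin> K"
  shows "(\<integral>\<^sup>+z. indicator (K \<inter> ball 0 1) z *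
             (\<integral>\<^sup>+s. indicator {0<..} s * (w (s *\<^sub>R z) * ennreal (norm z)) \<partial>lborel) \<partial>lborel)
       = ennreal (1 / DIM('a)) * (\<integral>\<^sup>+y. indicator K y * (w y * ennreal (1 / norm y ^ (DIM('a) - 1))) \<partial>lborel)"
proof -
  let ?n = "DIM('a)"
  have [measurable]: "ball 0 1 \<in> sets (borel :: 'a measure)" by simp
  have Kiff: "s *\<^sub>R z \<in> K \<longleftrightarrow> z \<in> K" if "0 < s" for s z
    using K[of z s] K[of "s *\<^sub>R z" "1 / s"] that by auto
  have "(\<integral>\<^sup>+z. indicator (K \<inter> ball 0 1) z *
             (\<integral>\<^sup>+s. indicator {0<..} s * (w (s *\<^sub>R z) * ennreal (norm z)) \<partial>lborel) \<partial>lborel)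
     = (\<integral>\<^sup>+z. \<integral>\<^sup>+s. indicator (K \<inter> ball 0 1) z *
             (indicator {0<..} s * (w (s *\<^sub>R z) * ennreal (norm z))) \<partial>lborel \<partial>lborel)"
    by (intro nn_integral_cong nn_integral_cmult[symmetric]) measurable
  also have "\<dots> = (\<integral>\<^sup>+s. \<integral>\<^sup>+z. indicator (K \<inter> ball 0 1) z *
             (indicator {0<..} s * (w (s *\<^sub>R z) * ennreal (norm z))) \<partial>lborel \<partial>lborel)"
    by (rule lborel_pair.Fubini'[symmetric]) measurable
  also have "\<dots> = (\<integral>\<^sup>+s. \<integral>\<^sup>+y. indicator K y * w y * ennreal (norm y) *
                   (indicator {norm y<..} s * ennreal (1 / s ^ Suc ?n)) \<partial>lborel \<partial>lborel)"
  proof (rule nn_integral_cong)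
    fix s :: real
    show "(\<integral>\<^sup>+z. indicator (K \<inter> ball 0 1) z *
             (indicator {0<..} s * (w (s *\<^sub>R z) * ennreal (norm z))) \<partial>lborel)
        = (\<integral>\<^sup>+y. indicator K y * w y * ennreal (norm y) *
                   (indicator {norm y<..} s * ennreal (1 / s ^ Suc ?n)) \<partial>lborel)"
    proof (cases "0 < s")
      case False
      then have "\<not> norm y < s" for y :: 'a using norm_ge_zero[of y] by linarith
      with False show ?thesis by simp
    next
      case True
      have "(\<integral>\<^sup>+y. indicator K y * w y * ennreal (norm y) *
                   (indicator {norm y<..} s * ennreal (1 / s ^ Suc ?n)) \<partial>lborel)
          = ennreal (s ^ ?n) * (\<integral>\<^sup>+z. indicator K (s *\<^sub>R z) * w (s *\<^sub>R z) * ennreal (norm (s *\<^sub>R z)) *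
                   (indicator {norm (s *\<^sub>R z)<..} s * ennreal (1 / s ^ Suc ?n)) \<partial>lborel)"
        by (subst nn_integral_lborel_affine[of _ s 0]) (measurable, use True in simp_all)
      also have "\<dots> = (\<integral>\<^sup>+z. ennreal (s ^ ?n) * (indicator K (s *\<^sub>R z) * w (s *\<^sub>R z) * ennreal (norm (s *\<^sub>R z)) *
                   (indicator {norm (s *\<^sub>R z)<..} s * ennreal (1 / s ^ Suc ?n))) \<partial>lborel)"
        by (rule nn_integral_cmult[symmetric]) (unfold indicator_def greaterThan_iff, measurable)
      also have "\<dots> = (\<integral>\<^sup>+z. indicator (K \<inter> ball 0 1) z *
             (indicator {0<..} s * (w (s *\<^sub>R z) * ennreal (norm z))) \<partial>lborel)"
      proof (rule nn_integral_cong)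
        fix z :: 'a
        have "ennreal (s ^ ?n) * (w (s *\<^sub>R z) * ennreal (s * norm z) * ennreal (1 / s ^ Suc ?n))
            = w (s *\<^sub>R z) * (ennreal (s ^ ?n) * ennreal (s * norm z) * ennreal (1 / s ^ Suc ?n))"
          by (simp add: mult_ac)
        also have "ennreal (s ^ ?n) * ennreal (s * norm z) * ennreal (1 / s ^ Suc ?n) = ennreal (norm z)"
          using True by (simp add: ennreal_mult[symmetric] del: power_Suc) (simp add: field_simps)
        finally show "ennreal (s ^ ?n) * (indicator K (s *\<^sub>R z) * w (s *\<^sub>R z) * ennreal (norm (s *\<^sub>R z)) *
                   (indicator {norm (s *\<^sub>R z)<..} s * ennreal (1 / s ^ Suc ?n)))
            = indicator (K \<inter> ball 0 1) z *
             (indicator {0<..} s * (w (s *\<^sub>R z) * ennreal (norm z)))"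
          using True by (auto simp: indicator_def Kiff)
      qed
      finally show ?thesis by simp
    qed
  qed
  also have "\<dots> = (\<integral>\<^sup>+y. \<integral>\<^sup>+s. indicator K y * w y * ennreal (norm y) *
                   (indicator {norm y<..} s * ennreal (1 / s ^ Suc ?n)) \<partial>lborel \<partial>lborel)"
    by (rule lborel_pair.Fubini') (unfold indicator_def greaterThan_iff, measurable)
  also have "\<dots> = (\<integral>\<^sup>+y. indicator K y * w y * ennreal (norm y) * 
                   (\<integral>\<^sup>+s. indicator {norm y<..} s * ennreal (1 / s ^ Suc ?n) \<partial>lborel) \<partial>lborel)"
    by (intro nn_integral_cong nn_integral_cmult) (unfold indicator_def greaterThan_iff, measurable)
  also have "\<dots> = (\<integral>\<^sup>+y. ennreal (1 / ?n) * (indicator K y * (w y * ennreal (1 / norm y ^ (?n - 1)))) \<partial>lborel)"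
  proof (rule nn_integral_cong)
    fix y :: 'a
    show "indicator K y * w y * ennreal (norm y) * 
                   (\<integral>\<^sup>+s. indicator {norm y<..} s * ennreal (1 / s ^ Suc ?n) \<partial>lborel)
       = ennreal (1 / ?n) * (indicator K y * (w y * ennreal (1 / norm y ^ (?n - 1))))"
    proof (cases "y \<in> K")
      case True
      then have y: "0 < norm y" using \<open>0 \<notin> K\<close> by auto
      have "norm y * (1 / (real ?n * norm y ^ ?n)) = 1 / ?n * (1 / norm y ^ (?n - 1))"
      proof -
        have "norm y ^ ?n = norm y * norm y ^ (?n - 1)"
          by (metis DIM_positive Suc_diff_1 power_Suc)
        then show ?thesis using y by (simp add: field_simps)
      qed
      then have "ennreal (norm y) * ennreal (1 / (real ?n * norm y ^ ?n))
          = ennreal (1 / ?n) * ennreal (1 / norm y ^ (?n - 1))"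
        by (simp add: ennreal_mult[symmetric])
      then show ?thesis
        using True y by (subst nn_integral_inverse_power_tail) (auto simp: mult_ac)
    qed simp
  qed
  also have "\<dots> = ennreal (1 / ?n) * (\<integral>\<^sup>+y. indicator K y * (w y * ennreal (1 / norm y ^ (?n - 1))) \<partial>lborel)"
    by (rule nn_integral_cmult) measurable
  finally show ?thesis .
qed

section \<open>Cones that are almost half-spaces\<close>

text \<open>
  For small positive \<open>e\<close> this open cone is nearly the half-space of the vectors \<open>z\<close> with \<open>z \<bullet> N > 0\<close>; the
  angle between \<open>N\<close> and the generators of its boundary is \<open>arccos e\<close> if \<open>N\<close> is a unit vector.
\<close>

definition wide_cone :: "'a::euclidean_space \<Rightarrow> real \<Rightarrow> 'a set" where
  "wide_cone N e = {z. e * norm z < z \<bullet> N}"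

lemma open_wide_cone: "open (wide_cone N e)"
  unfolding wide_cone_def by (intro open_Collect_less continuous_intros)

lemma borel_wide_cone [measurable, simp]: "wide_cone N e \<in> sets borel"
  by (simp add: open_wide_cone)

lemma zero_notin_wide_cone [simp]: "0 \<notin> wide_cone N e"
  by (simp add: wide_cone_def)

lemma scaleR_wide_cone: "z \<in> wide_cone N e \<Longrightarrow> 0 < s \<Longrightarrow> s *\<^sub>R z \<in> wide_cone N e"
  by (simp add: wide_cone_def mult.left_commute)

text \<open>
  A reflection that exchanges \<open>M\<close> and \<open>N\<close> exchanges the two cones.
\<close>

lemma emeasure_wide_cone_cong:
  fixes M N :: "'a::euclidean_space"
  assumes "norm M = norm N"
  shows "emeasure lborel (wide_cone M e \<inter> ball 0 1) = emeasure lborel (wide_cone N e \<inter> ball 0 1)"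
proof -
  obtain T where T: "orthogonal_transformation T" "T M = N" "\<And>x. T (T x) = x"
    using orthogonal_reflection[OF assms] by blast
  have "T x \<bullet> N = x \<bullet> M" for x
    using T unfolding orthogonal_transformation_def by metis
  then have "T -` (wide_cone N e \<inter> ball 0 1) = wide_cone M e \<inter> ball 0 1"
    using T(1) by (auto simp: wide_cone_def orthogonal_transformation_norm)
  moreover have "emeasure lborel (T -` (wide_cone N e \<inter> ball 0 1)) = emeasure lborel (wide_cone N e \<inter> ball 0 1)"
    using T(1) by (intro emeasure_lborel_orthogonal_vimage) auto
  ultimately show ?thesis by simp
qed

lemma emeasure_half_ball:
  fixes b :: "'a::euclidean_space"
  assumes b: "b \<in> Basis"
  shows "2 * emeasure lborel ({z. 0 < z \<bullet> b} \<inter> ball 0 1) = emeasure lborel (ball (0::'a) 1)"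
proof -
  define H where "H = {z. 0 < z \<bullet> b} \<inter> ball 0 1"
  define H' where "H' = {z. z \<bullet> b < 0} \<inter> ball 0 1"
  have [measurable]: "H \<in> sets borel" "H' \<in> sets borel"
    by (auto simp: H_def H'_def intro!: borel_open open_Int open_Collect_less continuous_intros)
  have "uminus -` H = H'" by (auto simp: H_def H'_def)
  moreover have "emeasure lborel (uminus -` H) = emeasure lborel H"
    by (rule emeasure_lborel_orthogonal_vimage)
       (auto simp: orthogonal_transformation_def linear_iff)
  ultimately have H': "emeasure lborel H' = emeasure lborel H" by simp
  have "emeasure lborel (ball (0::'a) 1) = emeasure lborel (H \<union> H')"
  proof (rule emeasure_eq_AE)
    show "AE x in lborel. (x \<in> ball 0 1) = (x \<in> H \<union> H')"
      using AE_lborel_inner_neq[OF b, of 0]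
      by eventually_elim (auto simp: H_def H'_def)
  qed auto
  also have "\<dots> = emeasure lborel H + emeasure lborel H'"
    by (rule plus_emeasure[symmetric]) (auto simp: H_def H'_def)
  finally show ?thesis by (simp add: H' H_def[symmetric] mult_2)
qed

text \<open>
  The cones increase to the open half-space as \<open>e\<close> decreases to 0. By rotation invariance, the choice of
  \<open>e\<close> for one axis serves all axes.
\<close>

lemma wide_cone_almost_half:
  fixes \<kappa> :: real
  assumes \<kappa>: "2 * \<kappa> < unit_ball_vol (DIM('a))"
  shows "\<exists>e>0. \<forall>N :: 'a::euclidean_space. norm N = 1 \<longrightarrow>
     \<kappa> < measure lborel (wide_cone N e \<inter> ball 0 1)"
proof -
  obtain b :: 'a where b: "b \<in> Basis" using nonempty_Basis by blast
  define A where "A j = wide_cone b (1 / (real j + 2)) \<inter> ball 0 1" for j :: nat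
  have fin: "emeasure lborel X < \<infinity>" if "X \<subseteq> ball (0::'a) 1" "X \<in> sets borel" for X
    using emeasure_mono[OF that(1), of lborel] emeasure_lborel_ball_finite[of "0::'a" 1] by simp
  have A_sets: "A j \<in> sets borel" for j by (simp add: A_def)
  have "incseq A"
  proof (rule incseq_SucI)
    fix j
    have "1 / (real (Suc j) + 2) * norm z \<le> 1 / (real j + 2) * norm z" for z :: 'a
      by (intro mult_right_mono divide_left_mono mult_pos_pos) auto
    then show "A j \<subseteq> A (Suc j)"
      unfolding A_def wide_cone_def by (fastforce intro: le_less_trans)
  qed
  then have "(\<lambda>j. emeasure lborel (A j)) \<longlonglongrightarrow> emeasure lborel (\<Union>j. A j)"
    by (intro Lim_emeasure_incseq) (auto simp: A_sets)
  also have "(\<Union>j. A j) = {z. 0 < z \<bullet> b} \<inter> ball 0 1"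
  proof (intro equalityI subsetI)
    fix z assume "z \<in> (\<Union>j. A j)"
    then obtain j where "1 / (real j + 2) * norm z < z \<bullet> b" "z \<in> ball 0 1"
      by (auto simp: A_def wide_cone_def)
    moreover have "0 \<le> 1 / (real j + 2) * norm z" by simp
    ultimately show "z \<in> {z. 0 < z \<bullet> b} \<inter> ball 0 1" using le_less_trans by blast
  next
    fix z assume z: "z \<in> {z. 0 < z \<bullet> b} \<inter> ball 0 1"
    obtain j :: nat where "norm z / (z \<bullet> b) < real j" using reals_Archimedean2 by blast
    then have "norm z / (z \<bullet> b) < real j + 2" by simp
    then have "z \<in> A j" using z by (simp add: A_def wide_cone_def field_simps)
    then show "z \<in> (\<Union>j. A j)" by blast
  qed
  finally have lim: "(\<lambda>j. emeasure lborel (A j)) \<longlonglongrightarrow> emeasure lborel ({z. 0 < z \<bullet> b} \<inter> ball 0 1)" .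
  have "ennreal \<kappa> < emeasure lborel ({z. 0 < z \<bullet> b} \<inter> ball 0 1)"
  proof (rule ccontr)
    let ?H = "{z. 0 < z \<bullet> b} \<inter> ball (0::'a) 1"
    assume "\<not> ?thesis"
    then have "2 * emeasure lborel ?H \<le> 2 * ennreal \<kappa>"
      by (intro mult_left_mono) auto
    then have "ennreal (unit_ball_vol (DIM('a))) \<le> 2 * ennreal \<kappa>"
      unfolding emeasure_half_ball[OF b] by (simp add: emeasure_ball)
    also have "\<dots> = ennreal (2 * \<kappa>)" by (simp add: ennreal_mult')
    finally show False using \<kappa> unit_ball_vol_pos[of "DIM('a)"]
      by (subst (asm) ennreal_le_iff2) (auto simp del: unit_ball_vol_pos)
  qed
  with lim have "\<forall>\<^sub>F j in sequentially. ennreal \<kappa> < emeasure lborel (A j)"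
    by (rule order_tendstoD)
  then obtain j where j: "ennreal \<kappa> < emeasure lborel (A j)"
    by (auto simp: eventually_sequentially)
  show ?thesis
  proof (intro exI[of _ "1 / (real j + 2)"] conjI allI impI)
    fix N :: 'a assume "norm N = 1"
    then have "emeasure lborel (wide_cone N (1 / (real j + 2)) \<inter> ball 0 1) = emeasure lborel (A j)"
      unfolding A_def using b by (intro emeasure_wide_cone_cong) simp
    moreover have "emeasure lborel (wide_cone N (1 / (real j + 2)) \<inter> ball 0 1)
        = ennreal (measure lborel (wide_cone N (1 / (real j + 2)) \<inter> ball 0 1))"
      using fin[of "wide_cone N (1 / (real j + 2)) \<inter> ball 0 1"]
      by (intro emeasure_eq_ennreal_measure) auto
    ultimately have "ennreal \<kappa> < ennreal (measure lborel (wide_cone N (1 / (real j + 2)) \<inter> ball 0 1))"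
      using j by simp
    then show "\<kappa> < measure lborel (wide_cone N (1 / (real j + 2)) \<inter> ball 0 1)"
      by (meson ennreal_leI leD leI)
  qed simp
qed

lemma emeasure_wide_cone_ball:
  "emeasure lborel (wide_cone N e \<inter> ball 0 1) = ennreal (measure lborel (wide_cone N e \<inter> ball 0 1))"
proof (rule emeasure_eq_ennreal_measure)
  have "emeasure lborel (wide_cone N e \<inter> ball 0 1) \<le> emeasure lborel (ball (0::'a) 1)"
    by (intro emeasure_mono) auto
  then show "emeasure lborel (wide_cone N e \<inter> ball 0 1) \<noteq> top"
    using emeasure_lborel_ball_finite[of "0::'a" 1] by (auto simp: top_unique)
qed

section \<open>Singular kernels and upper regular measures\<close>

text \<open>
  On the shell \<open>r / 2 ^ (j + 1) \<le> dist x y < r / 2 ^ j\<close> the kernel is about \<open>(r / 2 ^ j) powr - a\<close> and the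
  measure of the shell is at most \<open>C * (r / 2 ^ j) powr d\<close>, so that the sum over the shells is geometric.
  The bound is used for Lebesgue measure and for the surface measure of the boundary. As
  \<open>0 powr - a = 0\<close>, the pole itself does not contribute.
\<close>

lemma nn_integral_singular_kernel_le:
  fixes \<mu> :: "'a::metric_space measure"
  assumes sets [measurable_cong]: "sets \<mu> = sets borel"
    and ball: "\<And>\<rho>. 0 < \<rho> \<Longrightarrow> emeasure \<mu> (ball y \<rho>) \<le> ennreal (C * \<rho> powr d)"
    and "0 \<le> C" "0 \<le> a" "a < d" "0 < r"
  shows "(\<integral>\<^sup>+x. indicator (ball y r) x * ennreal (dist x y powr - a) \<partial>\<mu>)
           \<le> ennreal (C * 2 powr a / (1 - 2 powr (a - d)) * r powr (d - a))"
proof -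
  define t :: "nat \<Rightarrow> 'a \<Rightarrow> ennreal" where "t j x = indicator (ball y (r / 2 ^ j)) x * ennreal ((r / 2 ^ Suc j) powr - a)" for j :: nat and x
  have le: "indicator (ball y r) x * ennreal (dist x y powr - a) \<le> (\<Sum>j. t j x)" for x
  proof (cases "x \<in> ball y r \<and> x \<noteq> y")
    case False
    then show ?thesis by auto
  next
    case True
    define D where "D = dist x y"
    have D: "0 < D" "D < r" using True by (auto simp: D_def dist_commute)
    obtain k :: nat where "r / D < 2 ^ k"
      using real_arch_pow[of 2 "r / D"] by auto
    then have ex: "r / 2 ^ k \<le> D" using D by (simp add: field_simps)
    define m where "m = (LEAST k. r / 2 ^ k \<le> D)"
    have m: "r / 2 ^ m \<le> D" unfolding m_def using ex by (rule LeastI)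
    with D obtain j where j: "m = Suc j" by (cases m) auto
    have "\<not> r / 2 ^ j \<le> D" using j unfolding m_def by (intro not_less_Least) simp
    then have "x \<in> ball y (r / 2 ^ j)" by (simp add: D_def dist_commute)
    moreover have "D powr - a \<le> (r / 2 ^ Suc j) powr - a"
      using m j D \<open>0 \<le> a\<close> \<open>0 < r\<close> by (intro powr_mono2') auto
    ultimately have "indicator (ball y r) x * ennreal (dist x y powr - a) \<le> t j x"
      using True by (simp add: t_def D_def ennreal_leI)
    also have "\<dots> \<le> (\<Sum>j. t j x)"
      using sum_le_suminf[of "\<lambda>j. t j x" "{j}"] by simp
    finally show ?thesis .
  qed
  define q where "q = (2::real) powr (a - d)"
  have q: "0 < q" "q < 1" using \<open>a < d\<close> by (auto simp: q_def powr_less_one)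
  have [measurable]: "ball y s \<in> sets \<mu>" for s by (simp add: sets)
  have "(\<integral>\<^sup>+x. indicator (ball y r) x * ennreal (dist x y powr - a) \<partial>\<mu>) \<le> (\<integral>\<^sup>+x. (\<Sum>j. t j x) \<partial>\<mu>)"
    by (intro nn_integral_mono le)
  also have "\<dots> = (\<Sum>j. \<integral>\<^sup>+x. t j x \<partial>\<mu>)"
    unfolding t_def by (rule nn_integral_suminf) measurable
  also have "\<dots> \<le> (\<Sum>j. ennreal (C * 2 powr a * r powr (d - a) * q ^ j))"
  proof (rule suminf_le)
    fix j
    have "(\<integral>\<^sup>+x. t j x \<partial>\<mu>) = emeasure \<mu> (ball y (r / 2 ^ j)) * ennreal ((r / 2 ^ Suc j) powr - a)"
      unfolding t_def by (subst nn_integral_multc) auto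
    also have "\<dots> \<le> ennreal (C * (r / 2 ^ j) powr d) * ennreal ((r / 2 ^ Suc j) powr - a)"
      using \<open>0 < r\<close> by (intro mult_right_mono ball) auto
    also have "\<dots> = ennreal (C * ((r / 2 ^ j) powr d * (r / 2 ^ Suc j) powr - a))"
      using \<open>0 \<le> C\<close> by (simp add: ennreal_mult[symmetric] mult_ac)
    also have "(r / 2 ^ j) powr d * (r / 2 ^ Suc j) powr - a = 2 powr a * r powr (d - a) * q ^ j"
    proof -
      have 1: "r / 2 ^ j = r * 2 powr (- real j)" for j :: nat
        by (simp add: powr_minus_divide powr_realpow)
      have "(r / 2 ^ j) powr d * (r / 2 ^ Suc j) powr - a
          = (r powr d * r powr - a) * (2 powr (- real j * d) * 2 powr (- real (Suc j) * - a))"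
        unfolding 1 using \<open>0 < r\<close> by (simp add: powr_mult powr_powr del: of_nat_Suc)
      also have "r powr d * r powr - a = r powr (d - a)" by (simp add: powr_add[symmetric])
      also have "2 powr (- real j * d) * 2 powr (- real (Suc j) * - a) = (2::real) powr (a + (a - d) * real j)"
        by (simp add: powr_add[symmetric] algebra_simps)
      also have "\<dots> = 2 powr a * q ^ j"
        by (simp add: q_def powr_add powr_powr[symmetric] powr_realpow)
      finally show ?thesis by simp
    qed
    finally show "(\<integral>\<^sup>+x. t j x \<partial>\<mu>) \<le> ennreal (C * 2 powr a * r powr (d - a) * q ^ j)"
      by (simp add: mult_ac)
  qed auto
  also have "\<dots> = ennreal (C * 2 powr a * r powr (d - a) * (1 / (1 - q)))"
    using q \<open>0 \<le> C\<close> by (intro suminf_ennreal_eq sums_mult geometric_sums) auto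
  finally show ?thesis by (simp add: q_def)
qed

section \<open>An upper bound for the Hausdorff measure of the sphere\<close>

text \<open>
  Vitali's covering lemma for balls centred in \<open>S\<close>, in the form with a tail. A point of \<open>S\<close> outside the
  first \<open>N\<close> selected balls has a small ball around it which misses them all; a selected ball meeting that
  small ball therefore comes later, and its fivefold enlargement contains the point.
\<close>

lemma vitali_sequence:
  fixes S :: "'a::euclidean_space set"
  assumes "0 < \<delta>"
  shows "\<exists>(I :: nat set) p r. (\<forall>i\<in>I. p i \<in> S \<and> 0 < r i \<and> r i \<le> \<delta>) \<and>
    disjoint_family_on (\<lambda>i. cball (p i) (r i)) I \<and>
    (\<forall>N. S \<subseteq> (\<Union>i\<in>I \<inter> {..<N}. cball (p i) (r i)) \<union> (\<Union>i\<in>I \<inter> {N..}. ball (p i) (5 * r i)))"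
proof -
  define K where "K = S \<times> {0<..\<delta>}"
  have K: "0 < snd i \<and> snd i \<le> \<delta>" if "i \<in> K" for i
    using that by (auto simp: K_def)
  obtain C where C: "countable C" "C \<subseteq> K"
     "pairwise (\<lambda>i j. disjnt (cball (fst i) (snd i)) (cball (fst j) (snd j))) C"
     "\<And>i. i \<in> K \<Longrightarrow> \<exists>j. j \<in> C \<and> \<not> disjnt (cball (fst i) (snd i)) (cball (fst j) (snd j)) \<and>
                        cball (fst i) (snd i) \<subseteq> ball (fst j) (5 * snd j)"
    by (rule Vitali_covering_lemma_cballs_balls[OF K, where a = fst]) (blast intro: that)+
  define I where "I = to_nat_on C ` C"
  define p where "p i = fst (from_nat_into C i)" for i
  define r where "r i = snd (from_nat_into C i)" for i
  have from_to: "from_nat_into C (to_nat_on C c) = c" if "c \<in> C" for c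
    using C(1) that by simp
  show ?thesis
  proof (intro exI[of _ I] exI[of _ p] exI[of _ r] conjI ballI allI)
    show r: "0 < r i" "r i \<le> \<delta>" "p i \<in> S" if "i \<in> I" for i
      using that C(2) from_to by (auto simp: I_def p_def r_def K_def)
    show "disjoint_family_on (\<lambda>i. cball (p i) (r i)) I"
      using C(3) from_to by (fastforce simp: disjoint_family_on_def I_def p_def r_def pairwise_def disjnt_def)
    show "S \<subseteq> (\<Union>i\<in>I \<inter> {..<N}. cball (p i) (r i)) \<union> (\<Union>i\<in>I \<inter> {N..}. ball (p i) (5 * r i))" for N
    proof
      fix x assume "x \<in> S"
      define U where "U = (\<Union>i\<in>I \<inter> {..<N}. cball (p i) (r i))"
      show "x \<in> U \<union> (\<Union>i\<in>I \<inter> {N..}. ball (p i) (5 * r i))"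
      proof (cases "x \<in> U")
        case False
        have "closed U" unfolding U_def by (intro closed_UN) auto
        with False have "open (- U)" "x \<in> - U" by auto
        then obtain e where e: "0 < e" "cball x e \<subseteq> - U" using open_contains_cball by blast
        define s where "s = min e \<delta>"
        have "(x, s) \<in> K" using \<open>x \<in> S\<close> e assms by (simp add: K_def s_def)
        then obtain j where j: "j \<in> C" "\<not> disjnt (cball x s) (cball (fst j) (snd j))"
          "cball x s \<subseteq> ball (fst j) (5 * snd j)"
          using C(4)[of "(x, s)"] by auto
        define i where "i = to_nat_on C j"
        have i: "i \<in> I" "p i = fst j" "r i = snd j"
          using j(1) from_to by (auto simp: I_def i_def p_def r_def)
        have "cball x s \<subseteq> - U" using e by (auto simp: s_def)
        have "\<not> i < N"
        proof
          assume "i < N"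
          with i(1) have "cball (p i) (r i) \<subseteq> U" by (auto simp: U_def)
          with \<open>cball x s \<subseteq> - U\<close> have "disjnt (cball x s) (cball (fst j) (snd j))"
            unfolding i disjnt_def by blast
          with j(2) show False ..
        qed
        moreover have "x \<in> cball x s" using e assms by (simp add: s_def)
        then have "x \<in> ball (p i) (5 * r i)"
          using j(3) unfolding i by (rule rev_subsetD)
        ultimately show ?thesis using i(1) by auto
      qed simp
    qed
  qed
qed

text \<open>
  A bound for packings by disjoint balls is a bound for coverings, with the same constant: in the covering
  of \<open>vitali_sequence\<close> only the balls of the tail are enlarged, and the sum of their gauges tends to 0.
  The largest diameter that occurs is that of an enlarged ball, at most \<open>10 * \<delta>\<close>.
\<close>

lemma hausdorff_premeasure_le_packing:
  fixes S :: "'a::euclidean_space set"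
  assumes \<delta>: "0 < \<delta>"
    and pack: "\<And>(F :: nat set) p r. finite F \<Longrightarrow> (\<And>i. i \<in> F \<Longrightarrow> p i \<in> S \<and> 0 < r i \<and> r i \<le> \<delta>) \<Longrightarrow>
        disjoint_family_on (\<lambda>i. cball (p i) (r i)) F \<Longrightarrow> (\<Sum>i\<in>F. unit_ball_vol (real k) * r i ^ k) \<le> V"
  shows "hausdorff_premeasure k (10 * \<delta>) S \<le> ennreal V"
proof -
  obtain I :: "nat set" and p r where *: "(\<forall>i\<in>I. p i \<in> S \<and> 0 < r i \<and> r i \<le> \<delta>) \<and>
    disjoint_family_on (\<lambda>i. cball (p i) (r i)) I \<and>
    (\<forall>N. S \<subseteq> (\<Union>i\<in>I \<inter> {..<N}. cball (p i) (r i)) \<union> (\<Union>i\<in>I \<inter> {N..}. ball (p i) (5 * r i)))"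
    using vitali_sequence[OF \<delta>, of S] by (elim exE)
  then have I: "p i \<in> S \<and> 0 < r i \<and> r i \<le> \<delta>" if "i \<in> I" for i
    using that by simp
  from * have disj: "disjoint_family_on (\<lambda>i. cball (p i) (r i)) I" by simp
  from * have cov: "S \<subseteq> (\<Union>i\<in>I \<inter> {..<N}. cball (p i) (r i)) \<union> (\<Union>i\<in>I \<inter> {N..}. ball (p i) (5 * r i))" for N
    by simp
  define g where "g i = (if i \<in> I then unit_ball_vol (real k) * r i ^ k else 0)" for i
  have g0: "0 \<le> g i" for i
    using I[of i] by (cases "i \<in> I") (simp_all add: g_def)
  have part: "sum g {..<m} \<le> V" for m
  proof -
    have "sum g {..<m} = (\<Sum>i\<in>I \<inter> {..<m}. unit_ball_vol (real k) * r i ^ k)"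
      unfolding g_def by (subst sum.inter_restrict[symmetric]) (simp_all add: Int_commute)
    also have "\<dots> \<le> V"
      by (rule pack[where p = p]) (use I disj in \<open>auto simp: disjoint_family_on_def\<close>)
    finally show ?thesis .
  qed
  have V0: "0 \<le> V" using part[of 0] by simp
  have sg: "summable g"
    by (rule summableI_nonneg_bounded[OF g0 part])
  have gV: "suminf g \<le> V"
    using sg part by (rule suminf_le_const)
  show ?thesis
  proof (rule ennreal_le_epsilon)
    fix e :: real assume "0 < e"
    then obtain N where N: "norm (\<Sum>i. g (i + N)) < e / 5 ^ k"
      using suminf_exist_split[OF _ sg, of "e / 5 ^ k"] by auto
    \<comment> \<open>\<open>h\<close> is the cost of enlarging the balls from index \<open>N\<close> on; the balls before \<open>N\<close> cost \<open>g\<close>.\<close>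
    define h where "h i = (if i < N then 0 else 5 ^ k * g i)" for i
    have "(\<lambda>i. h (i + N)) sums (5 ^ k * (\<Sum>i. g (i + N)))"
      using sg by (simp add: h_def sums_mult summable_sums summable_iff_shift)
    moreover have "sum h {..<N} = 0" by (simp add: h_def)
    ultimately have hs: "h sums (5 ^ k * (\<Sum>i. g (i + N)))"
      by (subst (asm) sums_iff_shift) simp
    have he: "5 ^ k * (\<Sum>i. g (i + N)) \<le> e"
    proof -
      have "(\<Sum>i. g (i + N)) < e / 5 ^ k" using N by simp
      then show ?thesis by (simp add: field_simps)
    qed
    define B where "B i = (if i \<in> I then (if i < N then cball (p i) (r i) else ball (p i) (5 * r i)) else {})" for i
    have "B \<in> hausdorff_covers (10 * \<delta>) S"
    proof -
      have "S \<subseteq> (\<Union>i. B i)"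
      proof
        fix x assume "x \<in> S"
        with cov[of N] consider i where "i \<in> I" "i < N" "x \<in> cball (p i) (r i)"
          | i where "i \<in> I" "\<not> i < N" "x \<in> ball (p i) (5 * r i)"
          by fastforce
        then have "\<exists>i. x \<in> B i"
        proof cases
          case 1
          then have "x \<in> B i" by (simp add: B_def)
          then show ?thesis ..
        next
          case 2
          then have "x \<in> B i" by (simp add: B_def)
          then show ?thesis ..
        qed
        then show "x \<in> (\<Union>i. B i)" by blast
      qed
      moreover have "diameter (B i) \<le> 10 * \<delta>" for i
        using I[of i] \<delta> by (auto simp: B_def)
      ultimately show ?thesis by (auto simp: hausdorff_covers_def B_def)
    qed
    then have "hausdorff_premeasure k (10 * \<delta>) S \<le> (\<Sum>i. hausdorff_gauge k (B i))"
      by (rule hausdorff_premeasure_le)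
    also have "\<dots> \<le> (\<Sum>i. ennreal (g i + h i))"
    proof (rule suminf_le)
      show "hausdorff_gauge k (B i) \<le> ennreal (g i + h i)" for i
      proof (cases "i \<in> I")
        case True
        then show ?thesis using I[OF True]
          by (auto simp: hausdorff_gauge_def B_def g_def h_def power_mult_distrib mult_ac
                intro!: ennreal_leI)
      qed (simp add: B_def)
    qed auto
    also have "\<dots> = ennreal (suminf g + 5 ^ k * (\<Sum>i. g (i + N)))"
      by (intro suminf_ennreal_eq sums_add summable_sums[OF sg] hs) (simp add: g0 h_def)
    also have "\<dots> \<le> ennreal (V + e)"
      using gV he by (intro ennreal_leI add_mono)
    also have "\<dots> = ennreal V + ennreal e"
      using V0 \<open>0 < e\<close> by simp
    finally show "hausdorff_premeasure k (10 * \<delta>) S \<le> ennreal V + ennreal e" .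
  qed
qed

definition solid_cone :: "'a::euclidean_space \<Rightarrow> real \<Rightarrow> real \<Rightarrow> 'a set" where
  "solid_cone p \<rho> h = {y. 0 < y \<bullet> p \<and> y \<bullet> p < h \<and> norm (y - (y \<bullet> p) *\<^sub>R p) \<le> \<rho> * (y \<bullet> p)}"

lemma borel_solid_cone [measurable, simp]: "solid_cone p \<rho> h \<in> sets borel"
  unfolding solid_cone_def by measurable

lemma nn_integral_power_Ioo:
  fixes h :: real
  assumes "0 < h"
  shows "(\<integral>\<^sup>+t. indicator {0<..<h} t * ennreal (t ^ m) \<partial>lborel) = ennreal (h ^ Suc m / Suc m)"
proof -
  have "(\<integral>\<^sup>+t. indicator {0<..<h} t * ennreal (t ^ m) \<partial>lborel) = (\<integral>\<^sup>+t. ennreal (t ^ m) * indicator {0..h} t \<partial>lborel)"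
  proof (rule nn_integral_cong_AE)
    show "AE t in lborel. indicator {0<..<h} t * ennreal (t ^ m) = ennreal (t ^ m) * indicator {0..h} t"
      using AE_lborel_singleton[of 0] AE_lborel_singleton[of h]
      by eventually_elim (auto simp: indicator_def)
  qed
  also have "\<dots> = ennreal (h ^ Suc m / Suc m - 0 ^ Suc m / Suc m)"
    using assms by (intro nn_integral_FTC_Icc) (auto intro!: derivative_eq_intros simp del: power_Suc)
  finally show ?thesis by simp
qed

text \<open>
  By Fubini's theorem: the slice of the cone at height \<open>y\<close> is a ball of radius \<open>\<rho> * y\<close> in one dimension less.
\<close>

lemma emeasure_solid_cone_Basis:
  fixes b :: "'a::euclidean_space"
  assumes b: "b \<in> Basis" and "0 < \<rho>" "0 < h"
  shows "emeasure lborel (solid_cone b \<rho> h)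
       = ennreal (unit_ball_vol (DIM('a) - 1) * \<rho> ^ (DIM('a) - 1) * h ^ DIM('a) / DIM('a))"
proof -
  define A where "A = Basis - {b}"
  have A: "finite A" "b \<notin> A" "Basis = insert b A" "card A = DIM('a) - 1"
    using b by (auto simp: A_def)
  interpret product_sigma_finite "\<lambda>_::'a. lborel :: real measure" by standard
  let ?e = "\<lambda>f. (\<Sum>j\<in>Basis. f j *\<^sub>R j) :: 'a"
  have e_b: "?e f \<bullet> b = f b" for f
    using b by (simp add: inner_sum_left inner_Basis if_distrib sum.delta' cong: if_cong)
  have e_norm: "norm (?e f - (?e f \<bullet> b) *\<^sub>R b) = sqrt (\<Sum>i\<in>A. (f i)\<^sup>2)" for f
  proof -
    have "?e f - (?e f \<bullet> b) *\<^sub>R b = (\<Sum>j\<in>A. f j *\<^sub>R j)"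
      unfolding e_b by (subst A(3)) (simp add: A(1,2))
    moreover have "norm (\<Sum>j\<in>A. f j *\<^sub>R j) ^ 2 = (\<Sum>i\<in>A. (f i)\<^sup>2)"
    proof -
      have "(\<Sum>j\<in>A. f j *\<^sub>R j) \<bullet> (\<Sum>j\<in>A. f j *\<^sub>R j) = (\<Sum>i\<in>A. \<Sum>j\<in>A. f i * f j * (j \<bullet> i))"
        by (simp add: inner_sum_left inner_sum_right sum_distrib_left mult.assoc)
      also have "\<dots> = (\<Sum>i\<in>A. \<Sum>j\<in>A. if i = j then f i * f j else 0)"
        by (intro sum.cong) (auto simp: A_def inner_Basis)
      also have "\<dots> = (\<Sum>i\<in>A. (f i)\<^sup>2)"
        using A(1) by (simp add: power2_eq_square)
      finally show ?thesis by (simp add: power2_norm_eq_inner)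
    qed
    ultimately show ?thesis by (metis norm_ge_zero real_sqrt_unique)
  qed
  have "emeasure lborel (solid_cone b \<rho> h) = (\<integral>\<^sup>+x. indicator (solid_cone b \<rho> h) x \<partial>lborel)"
    by simp
  also have "\<dots> = (\<integral>\<^sup>+f. indicator (solid_cone b \<rho> h) (?e f) \<partial>(\<Pi>\<^sub>M b\<in>Basis. lborel))"
    by (subst lborel_eq, rule nn_integral_distr) measurable
  also have "\<dots> = (\<integral>\<^sup>+y. \<integral>\<^sup>+f. indicator (solid_cone b \<rho> h) (?e (f(b := y))) \<partial>(\<Pi>\<^sub>M b\<in>A. lborel) \<partial>lborel)"
    unfolding A(3) by (rule product_nn_integral_insert_rev) (use A in \<open>simp_all add: A(3)[symmetric]\<close>)
  also have "\<dots> = (\<integral>\<^sup>+y. ennreal (unit_ball_vol (DIM('a) - 1) * \<rho> ^ (DIM('a) - 1)) *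
                    (indicator {0<..<h} y * ennreal (y ^ (DIM('a) - 1))) \<partial>lborel)"
  proof (rule nn_integral_cong)
    fix y :: real
    show "(\<integral>\<^sup>+f. indicator (solid_cone b \<rho> h) (?e (f(b := y))) \<partial>(\<Pi>\<^sub>M b\<in>A. lborel))
        = ennreal (unit_ball_vol (DIM('a) - 1) * \<rho> ^ (DIM('a) - 1)) *
           (indicator {0<..<h} y * ennreal (y ^ (DIM('a) - 1)))"
    proof (cases "0 < y \<and> y < h")
      case False
      then show ?thesis by (auto simp: solid_cone_def e_b indicator_def)
    next
      case True
      have "(\<Sum>i\<in>A. ((f(b := y)) i)\<^sup>2) = (\<Sum>i\<in>A. (f i)\<^sup>2)" for f
        using A(2) by (intro sum.cong) auto
      then have "?e (f(b := y)) \<in> solid_cone b \<rho> h \<longleftrightarrow> sqrt (\<Sum>i\<in>A. (f i)\<^sup>2) \<le> \<rho> * y" for f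
        using True by (simp only: solid_cone_def mem_Collect_eq e_norm) (simp add: e_b)
      then have "(\<integral>\<^sup>+f. indicator (solid_cone b \<rho> h) (?e (f(b := y))) \<partial>(\<Pi>\<^sub>M b\<in>A. lborel))
          = (\<integral>\<^sup>+f. indicator ({f. sqrt (\<Sum>i\<in>A. (f i)\<^sup>2) \<le> \<rho> * y} \<inter> space (\<Pi>\<^sub>M b\<in>A. lborel)) f \<partial>(\<Pi>\<^sub>M b\<in>A. lborel))"
        by (intro nn_integral_cong) (auto simp: indicator_def)
      also have "\<dots> = emeasure (\<Pi>\<^sub>M b\<in>A. lborel) ({f. sqrt (\<Sum>i\<in>A. (f i)\<^sup>2) \<le> \<rho> * y} \<inter> space (\<Pi>\<^sub>M b\<in>A. lborel))"
        by (rule nn_integral_indicator) measurable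
      also have "\<dots> = ennreal (unit_ball_vol (DIM('a) - 1) * (\<rho> * y) ^ (DIM('a) - 1))"
        using True \<open>0 < \<rho>\<close> A by (subst emeasure_cball_aux) auto
      finally show ?thesis using True \<open>0 < \<rho>\<close>
        by (simp add: ennreal_mult[symmetric] power_mult_distrib mult_ac)
    qed
  qed
  also have "\<dots> = ennreal (unit_ball_vol (DIM('a) - 1) * \<rho> ^ (DIM('a) - 1)) * 
      (\<integral>\<^sup>+y. (indicator {0<..<h} y * ennreal (y ^ (DIM('a) - 1))) \<partial>lborel)"
    by (rule nn_integral_cmult) measurable
  also have "\<dots> = ennreal (unit_ball_vol (DIM('a) - 1) * \<rho> ^ (DIM('a) - 1) * (h ^ DIM('a) / DIM('a)))"
    using \<open>0 < \<rho>\<close> \<open>0 < h\<close> by (subst nn_integral_power_Ioo) (simp_all add: ennreal_mult[symmetric])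
  finally show ?thesis by simp
qed

lemma emeasure_solid_cone:
  fixes p :: "'a::euclidean_space"
  assumes p: "norm p = 1" and "0 < \<rho>" "0 < h"
  shows "emeasure lborel (solid_cone p \<rho> h)
       = ennreal (unit_ball_vol (DIM('a) - 1) * \<rho> ^ (DIM('a) - 1) * h ^ DIM('a) / DIM('a))"
proof -
  obtain b :: 'a where b: "b \<in> Basis" using nonempty_Basis by blast
  then obtain T where T: "orthogonal_transformation T" "T p = b" "\<And>x. T (T x) = x"
    using orthogonal_reflection[of p b] p by auto
  have lin: "linear T" using T(1) by (rule orthogonal_transformation_linear)
  have in_p: "T x \<bullet> b = x \<bullet> p" for x
    using T unfolding orthogonal_transformation_def by metis
  have "norm (T x - (x \<bullet> p) *\<^sub>R b) = norm (x - (x \<bullet> p) *\<^sub>R p)" for x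
    using orthogonal_transformation_norm[OF T(1), of "x - (x \<bullet> p) *\<^sub>R p"]
    by (simp add: linear_diff[OF lin] linear_scale[OF lin] T(2))
  then have "T -` solid_cone b \<rho> h = solid_cone p \<rho> h"
    by (auto simp: solid_cone_def in_p)
  then show ?thesis
    using emeasure_lborel_orthogonal_vimage[OF T(1), of "solid_cone b \<rho> h"]
      emeasure_solid_cone_Basis[OF b assms(2,3)] by simp
qed

text \<open>
  The height \<open>1 / sqrt (1 + \<rho>\<^sup>2)\<close> is the largest one for which the cone over a disc of slope \<open>\<rho>\<close> stays in the
  unit ball. Its radial projection lies in the cap of radius \<open>\<rho>\<close> around \<open>p\<close>, since the chord of an angle is
  shorter than its tangent.
\<close>

lemma solid_cone_subset:
  fixes p :: "'a::euclidean_space"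
  assumes p: "norm p = 1" and "0 < \<rho>" and y: "y \<in> solid_cone p \<rho> (1 / sqrt (1 + \<rho>\<^sup>2))"
  shows "y \<in> ball 0 1" "y \<noteq> 0" "(1 / norm y) *\<^sub>R y \<in> cball p \<rho>"
proof -
  define t where "t = y \<bullet> p"
  define c where "c = sqrt (1 + \<rho>\<^sup>2)"
  have c: "1 < c" "0 < c" "c\<^sup>2 = 1 + \<rho>\<^sup>2" using \<open>0 < \<rho>\<close> by (auto simp: c_def add_pos_nonneg)
  have t: "0 < t" "t < 1 / c" "norm (y - t *\<^sub>R p) \<le> \<rho> * t"
    using y by (auto simp: solid_cone_def t_def c_def)
  have pp: "p \<bullet> p = 1" using p by (simp add: dot_square_norm)
  have "(norm (y - t *\<^sub>R p))\<^sup>2 = (norm y)\<^sup>2 - t\<^sup>2"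
    by (simp add: power2_norm_eq_inner inner_simps inner_commute t_def pp) (simp add: power2_eq_square)
  moreover have "(norm (y - t *\<^sub>R p))\<^sup>2 \<le> (\<rho> * t)\<^sup>2"
    using t by (intro power_mono) auto
  ultimately have "(norm y)\<^sup>2 \<le> (c * t)\<^sup>2"
    by (simp add: power_mult_distrib c(3) algebra_simps)
  then have ny: "norm y \<le> c * t" using c t by (simp add: power2_le_iff_abs_le)
  also have "c * t < 1" using t c by (simp add: field_simps)
  finally show "y \<in> ball 0 1" by simp
  show "y \<noteq> 0" using t by (auto simp: t_def)
  then have y0: "0 < norm y" by simp
  have "(norm ((1 / norm y) *\<^sub>R y - p))\<^sup>2 = 2 - 2 * (t / norm y)"
  proof -
    have "(norm ((1 / norm y) *\<^sub>R y - p))\<^sup>2 = (norm y)\<^sup>2 / (norm y)\<^sup>2 - 2 * (t / norm y) + 1"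
      by (simp add: power2_norm_eq_inner inner_simps inner_commute t_def pp) (simp add: dot_square_norm power2_eq_square)
    then show ?thesis using y0 by simp
  qed
  also have "\<dots> \<le> 2 - 2 * (1 / c)"
    using ny y0 c by (simp add: field_simps)
  also have "\<dots> \<le> \<rho>\<^sup>2"
  proof -
    have "2 * 1 \<le> (c + 1) * c" using c by (intro mult_mono) auto
    then have "(c - 1) * 2 \<le> (c - 1) * ((c + 1) * c)" using c by (intro mult_left_mono) auto
    then have "2 * (c - 1) \<le> (c - 1) * (c + 1) * c" by (simp add: mult_ac)
    also have "(c - 1) * (c + 1) = \<rho>\<^sup>2" using c(3) by (simp add: algebra_simps power2_eq_square)
    finally show ?thesis using c by (simp add: field_simps)
  qed
  finally have "norm ((1 / norm y) *\<^sub>R y - p) \<le> \<rho>"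
    using \<open>0 < \<rho>\<close> by (simp add: power2_le_iff_abs_le)
  then show "(1 / norm y) *\<^sub>R y \<in> cball p \<rho>" by (simp add: dist_norm norm_minus_commute)
qed

text \<open>
  Disjoint caps of the sphere carry disjoint cones in the unit ball. For a cap of radius \<open>\<rho>\<close> the cone has
  volume at least \<open>(1 + \<rho>\<^sup>2) powr (- n / 2) / n\<close> times the gauge of the cap, so the gauges of a packing by caps
  of radius at most \<open>\<delta>\<close> add up to at most \<open>n * \<bar>B\<bar> * (1 + \<delta>\<^sup>2) powr (n / 2)\<close>, \<open>B\<close> being the unit ball.
\<close>

lemma hausdorff_outer_measure_sphere_le:
  "hausdorff_outer_measure (DIM('a) - 1) (sphere (0::'a::euclidean_space) 1)
     \<le> ennreal (DIM('a) * unit_ball_vol (DIM('a)))"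
proof -
  let ?n = "DIM('a)" and ?S = "sphere (0::'a) 1"
  define V where "V \<delta> = ?n * unit_ball_vol ?n * sqrt (1 + \<delta>\<^sup>2) ^ ?n" for \<delta>
  have pre: "hausdorff_premeasure (?n - 1) (10 * \<delta>) ?S \<le> ennreal (V \<delta>)" if \<delta>: "0 < \<delta>" for \<delta>
  proof (rule hausdorff_premeasure_le_packing[OF \<delta>])
    fix F :: "nat set" and p :: "nat \<Rightarrow> 'a" and r
    assume F: "finite F" "\<And>i. i \<in> F \<Longrightarrow> p i \<in> ?S \<and> 0 < r i \<and> r i \<le> \<delta>"
      and disj: "disjoint_family_on (\<lambda>i. cball (p i) (r i)) F"
    define D where "D i = solid_cone (p i) (r i) (1 / sqrt (1 + (r i)\<^sup>2))" for i
    define m where "m i = unit_ball_vol (?n - 1) * r i ^ (?n - 1) * (1 / sqrt (1 + (r i)\<^sup>2)) ^ ?n / ?n" for i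
    have sub: "y \<in> ball 0 1" "y \<noteq> 0" "(1 / norm y) *\<^sub>R y \<in> cball (p i) (r i)" if "i \<in> F" "y \<in> D i" for y i
      using solid_cone_subset[of "p i" "r i" y] F(2)[of i] that by (auto simp: D_def)
    have Dm: "emeasure lborel (D i) = ennreal (m i)" if "i \<in> F" for i
      unfolding D_def m_def using F(2)[OF that] by (intro emeasure_solid_cone) (auto simp: add_pos_nonneg)
    have m0: "0 \<le> m i" if "i \<in> F" for i using F(2)[OF that] by (simp add: m_def)
    have Dsets: "D i \<in> sets borel" for i by (simp add: D_def)
    have "disjoint_family_on D F"
      unfolding disjoint_family_on_def
    proof (intro ballI impI)
      fix i j assume ij: "i \<in> F" "j \<in> F" "i \<noteq> j"
      then have "cball (p i) (r i) \<inter> cball (p j) (r j) = {}"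
        using disj by (auto simp: disjoint_family_on_def)
      with sub(3)[OF ij(1)] sub(3)[OF ij(2)] show "D i \<inter> D j = {}" by blast
    qed
    then have "(\<Sum>i\<in>F. emeasure lborel (D i)) = emeasure lborel (\<Union>i\<in>F. D i)"
      using F(1) Dsets by (intro sum_emeasure) auto
    also have "\<dots> \<le> emeasure lborel (ball (0::'a) 1)"
      using sub(1) Dsets F(1) by (intro emeasure_mono) auto
    also have "\<dots> = ennreal (unit_ball_vol ?n)" by (simp add: emeasure_ball)
    also have "(\<Sum>i\<in>F. emeasure lborel (D i)) = ennreal (\<Sum>i\<in>F. m i)"
      using m0 by (simp add: Dm)
    finally have le: "(\<Sum>i\<in>F. m i) \<le> unit_ball_vol ?n" by simp
    have "(\<Sum>i\<in>F. unit_ball_vol (real (?n - 1)) * r i ^ (?n - 1)) \<le> (\<Sum>i\<in>F. ?n * sqrt (1 + \<delta>\<^sup>2) ^ ?n * m i)"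
    proof (rule sum_mono)
      fix i assume i: "i \<in> F"
      define c where "c = sqrt (1 + (r i)\<^sup>2)"
      have c: "0 < c" "c \<le> sqrt (1 + \<delta>\<^sup>2)" using F(2)[OF i] by (auto simp: c_def add_pos_nonneg power_mono)
      have "unit_ball_vol (real (?n - 1)) * r i ^ (?n - 1) = ?n * c ^ ?n * m i"
        using c(1) by (simp add: m_def c_def[symmetric] power_divide)
      also have "\<dots> \<le> ?n * sqrt (1 + \<delta>\<^sup>2) ^ ?n * m i"
        using c m0[OF i] by (intro mult_right_mono mult_left_mono power_mono) auto
      finally show "unit_ball_vol (real (?n - 1)) * r i ^ (?n - 1) \<le> ?n * sqrt (1 + \<delta>\<^sup>2) ^ ?n * m i" .
    qed
    also have "\<dots> = ?n * sqrt (1 + \<delta>\<^sup>2) ^ ?n * (\<Sum>i\<in>F. m i)" by (simp add: sum_distrib_left)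
    also have "\<dots> \<le> ?n * sqrt (1 + \<delta>\<^sup>2) ^ ?n * unit_ball_vol ?n"
      using le by (intro mult_left_mono) auto
    finally show "(\<Sum>i\<in>F. unit_ball_vol (real (?n - 1)) * r i ^ (?n - 1)) \<le> V \<delta>"
      by (simp add: V_def mult_ac)
  qed
  show ?thesis
    unfolding hausdorff_outer_measure_def
  proof (rule SUP_least)
    fix \<delta>' :: real assume "\<delta>' \<in> {0<..}"
    have "(V \<longlongrightarrow> V 0) (at_right 0)"
      unfolding V_def by (intro tendsto_intros)
    then have "((\<lambda>\<delta>. ennreal (V \<delta>)) \<longlongrightarrow> ennreal (V 0)) (at_right 0)"
      by (rule tendsto_ennrealI)
    moreover have "\<forall>\<^sub>F \<delta> in at_right 0. hausdorff_premeasure (?n - 1) \<delta>' ?S \<le> ennreal (V \<delta>)"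
      unfolding eventually_at_right_field
    proof (intro exI[of _ "\<delta>' / 10"] conjI allI impI)
      fix \<delta> :: real assume "0 < \<delta>" "\<delta> < \<delta>' / 10"
      then have "hausdorff_premeasure (?n - 1) \<delta>' ?S \<le> hausdorff_premeasure (?n - 1) (10 * \<delta>) ?S"
        by (intro hausdorff_premeasure_mono) auto
      with pre[OF \<open>0 < \<delta>\<close>] show "hausdorff_premeasure (?n - 1) \<delta>' ?S \<le> ennreal (V \<delta>)"
        by (rule order_trans[rotated])
    qed (use \<open>\<delta>' \<in> {0<..}\<close> in auto)
    ultimately have "hausdorff_premeasure (?n - 1) \<delta>' ?S \<le> ennreal (V 0)"
      by (intro tendsto_lowerbound) auto
    then show "hausdorff_premeasure (?n - 1) \<delta>' ?S \<le> ennreal (?n * unit_ball_vol ?n)"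
      by (simp add: V_def)
  qed
qed

section \<open>Interior cones of domains with smooth boundary\<close>

text \<open>
  Let the domain be the region above the graph of \<open>f\<close> near \<open>p\<close>. Near \<open>p\<close> the function \<open>f\<close> differs from its
  linearisation at the foot of \<open>p\<close> by an \<open>e\<close>-Lipschitz function, because the gradient is continuous. Hence
  moving up by \<open>z\<close> in the cone around the normal \<open>N\<close> of the tangent plane at \<open>p\<close> stays above the graph.
  One direction \<open>N\<close> serves all points of the closure near \<open>p\<close>.
\<close>

lemma C1_boundary_local_cone:
  fixes \<Omega> :: "'a::euclidean_space set"
  assumes bd: "C1_holder_boundary \<gamma> \<Omega>" and "0 < \<gamma>" and p: "p \<in> frontier \<Omega>" and e: "0 < e"
  shows "\<exists>r>0. \<exists>N. norm N = 1 \<and>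
    (\<forall>x\<in>closure \<Omega> \<inter> ball p r. \<forall>z. norm z < r \<longrightarrow> z \<in> wide_cone N e \<longrightarrow> x + z \<in> \<Omega>)"
proof -
  obtain r0 \<nu> f where r0: "0 < r0" and \<nu>: "norm \<nu> = 1"
    and f: "C1_holder_on \<gamma> {y \<in> ball (p - (p \<bullet> \<nu>) *\<^sub>R \<nu>) r0. y \<bullet> \<nu> = 0} f"
    and \<Omega>: "\<Omega> \<inter> ball p r0 = {x \<in> ball p r0. f (x - (x \<bullet> \<nu>) *\<^sub>R \<nu>) < x \<bullet> \<nu>}"
    using bd p unfolding C1_holder_boundary_def by meson
  define P where "P x = x - (x \<bullet> \<nu>) *\<^sub>R \<nu>" for x
  have \<nu>\<nu>: "\<nu> \<bullet> \<nu> = 1" using \<nu> by (simp add: dot_square_norm)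
  have P\<nu>: "P x \<bullet> \<nu> = 0" for x by (simp add: P_def inner_simps \<nu>\<nu>)
  have P_diff: "P x - P y = P (x - y)" for x y by (simp add: P_def inner_simps algebra_simps)
  have P_norm: "norm (P x) \<le> norm x" for x
  proof -
    have "(norm (P x))\<^sup>2 = (norm x)\<^sup>2 - (x \<bullet> \<nu>)\<^sup>2"
      by (simp add: P_def power2_norm_eq_inner inner_simps inner_commute \<nu>\<nu>) (simp add: power2_eq_square)
    then have "(norm (P x))\<^sup>2 \<le> (norm x)\<^sup>2" by simp
    then show ?thesis by simp
  qed
  have P_cont: "continuous_on X P" for X
    unfolding P_def by (intro continuous_intros)
  define S where "S = {y \<in> ball (P p) r0. y \<bullet> \<nu> = 0}"
  have PS: "P x \<in> S" if "x \<in> ball p r0" for x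
  proof -
    have "dist (P p) (P x) \<le> dist p x" using P_norm[of "p - x"] by (simp add: dist_norm P_diff)
    then show ?thesis using that by (simp add: S_def P\<nu>)
  qed
  from f obtain g L where
    g: "\<And>x. x \<in> S \<Longrightarrow> (f has_derivative (\<lambda>h. h \<bullet> g x)) (at x within S)"
    and L: "\<And>x y. x \<in> S \<Longrightarrow> y \<in> S \<Longrightarrow> norm (g x - g y) \<le> L * dist x y powr \<gamma>"
    unfolding C1_holder_on_def S_def P_def by blast
  have f_cont: "continuous_on S f"
    using g has_derivative_continuous unfolding continuous_on_eq_continuous_within by blast
  \<comment> \<open>For points at distance less than \<open>\<delta>\<close> from the foot of \<open>p\<close> the gradient of \<open>f\<close> differs from its
    value there by at most \<open>e\<close>.\<close>
  define \<delta> where "\<delta> = min r0 ((e / (\<bar>L\<bar> + 1)) powr (1 / \<gamma>))"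
  have \<delta>: "0 < \<delta>" "\<delta> \<le> r0" using r0 e by (auto simp: \<delta>_def)
  define T where "T = {y \<in> ball (P p) \<delta>. y \<bullet> \<nu> = 0}"
  have TS: "T \<subseteq> S" using \<delta> by (auto simp: T_def S_def)
  have "convex T"
  proof -
    have "T = ball (P p) \<delta> \<inter> {y. \<nu> \<bullet> y = 0}" by (auto simp: T_def inner_commute)
    then show ?thesis by (simp add: convex_Int convex_hyperplane)
  qed
  have pS: "P p \<in> S" using PS[of p] r0 by simp
  have g_close: "norm (g x - g (P p)) \<le> e" if "x \<in> T" for x
  proof -
    have "dist x (P p) < \<delta>" using that by (simp add: T_def dist_commute)
    then have "dist x (P p) powr \<gamma> \<le> \<delta> powr \<gamma>" using \<open>0 < \<gamma>\<close> by (intro powr_mono2) auto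
    also have "\<dots> \<le> ((e / (\<bar>L\<bar> + 1)) powr (1 / \<gamma>)) powr \<gamma>"
      using \<open>0 < \<gamma>\<close> \<delta> by (intro powr_mono2) (auto simp: \<delta>_def)
    also have "\<dots> = e / (\<bar>L\<bar> + 1)" using \<open>0 < \<gamma>\<close> e by (simp add: powr_powr)
    finally have d: "dist x (P p) powr \<gamma> \<le> e / (\<bar>L\<bar> + 1)" .
    have "norm (g x - g (P p)) \<le> L * dist x (P p) powr \<gamma>" using L that TS pS by blast
    also have "\<dots> \<le> (\<bar>L\<bar> + 1) * dist x (P p) powr \<gamma>" by (intro mult_right_mono) auto
    also have "\<dots> \<le> (\<bar>L\<bar> + 1) * (e / (\<bar>L\<bar> + 1))" using d by (intro mult_left_mono) auto
    also have "\<dots> = e" by simp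
    finally show ?thesis .
  qed
  have lin: "f y \<le> f x + (y - x) \<bullet> g (P p) + e * norm (y - x)" if "x \<in> T" "y \<in> T" for x y
  proof -
    have "norm ((f y - y \<bullet> g (P p)) - (f x - x \<bullet> g (P p))) \<le> e * norm (y - x)"
    proof (rule differentiable_bound[OF \<open>convex T\<close> _ _ that(2,1)])
      fix w assume w: "w \<in> T"
      show "((\<lambda>x. f x - x \<bullet> g (P p)) has_derivative (\<lambda>h. h \<bullet> (g w - g (P p)))) (at w within T)"
        using has_derivative_subset[OF g[of w] TS] w TS
        by (auto intro!: derivative_eq_intros simp: inner_diff_right)
      show "onorm (\<lambda>h. h \<bullet> (g w - g (P p))) \<le> e"
      proof (rule onorm_le)
        fix h
        have "norm (h \<bullet> (g w - g (P p))) \<le> norm h * norm (g w - g (P p))"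
          by (simp add: Cauchy_Schwarz_ineq2)
        also have "\<dots> \<le> norm h * e" by (intro mult_left_mono g_close w) simp
        finally show "norm (h \<bullet> (g w - g (P p))) \<le> e * norm h" by (simp add: mult.commute)
      qed
    qed
    then show ?thesis by (simp add: inner_diff_left)
  qed
  have above: "f (P x) \<le> x \<bullet> \<nu>" if "x \<in> closure \<Omega>" "x \<in> ball p r0" for x
  proof (rule ccontr)
    assume neg: "\<not> f (P x) \<le> x \<bullet> \<nu>"
    define F where "F x = f (P x) - x \<bullet> \<nu>" for x
    have "continuous_on (ball p r0) F"
      unfolding F_def
      by (intro continuous_intros continuous_on_compose2[OF f_cont P_cont]) (use PS in auto)
    then have "open (ball p r0 \<inter> F -` {0<..})"
      by (intro continuous_open_preimage) auto
    moreover have "x \<in> ball p r0 \<inter> F -` {0<..}"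
      using that neg by (auto simp: F_def)
    ultimately have "(ball p r0 \<inter> F -` {0<..}) \<inter> \<Omega> \<noteq> {}"
      using that(1) open_Int_closure_eq_empty[of "ball p r0 \<inter> F -` {0<..}" \<Omega>] by blast
    then obtain w where w: "w \<in> ball p r0" "w \<in> \<Omega>" "F w > 0" by auto
    then have "w \<in> \<Omega> \<inter> ball p r0" by simp
    then have "f (P w) < w \<bullet> \<nu>" unfolding \<Omega> by (simp add: P_def)
    with w(3) show False by (simp add: F_def)
  qed
  \<comment> \<open>Only the component of the gradient tangential to the coordinate hyperplane is determined by \<open>f\<close>,
    hence the projection. As \<open>P (g (P p))\<close> is orthogonal to \<open>\<nu>\<close>, the normal \<open>M\<close> has length at least 1.\<close>
  define M where "M = \<nu> - P (g (P p))"
  have PI: "P x \<bullet> y = x \<bullet> P y" for x y by (simp add: P_def inner_simps inner_commute)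
  have "(norm M)\<^sup>2 = 1 + (norm (P (g (P p))))\<^sup>2"
    using P\<nu>[of "g (P p)"] by (simp add: M_def power2_norm_eq_inner inner_simps inner_commute \<nu>\<nu>)
  then have "1\<^sup>2 \<le> (norm M)\<^sup>2" by simp
  then have M: "1 \<le> norm M" by (simp only: power2_le_iff_abs_le norm_ge_zero)
  define N where "N = (1 / norm M) *\<^sub>R M"
  show ?thesis
  proof (intro exI[of _ "\<delta> / 2"] exI[of _ N] conjI ballI allI impI)
    show "0 < \<delta> / 2" using \<delta> by simp
    show "norm N = 1" using M by (auto simp: N_def)
    fix x z assume x: "x \<in> closure \<Omega> \<inter> ball p (\<delta> / 2)" and z: "norm z < \<delta> / 2" "z \<in> wide_cone N e"
    have "dist p (x + z) \<le> dist p x + norm z"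
      using dist_triangle[of p "x + z" x] by (simp add: dist_norm)
    then have xz: "x + z \<in> ball p \<delta>" using x z by simp
    have PT: "P y \<in> T" if "y \<in> ball p \<delta>" for y
      using P_norm[of "p - y"] that by (simp add: T_def P\<nu> dist_norm P_diff)
    have xd: "x \<in> ball p \<delta>" using x \<delta> by simp
    have "P (x + z) - P x = P z" by (simp add: P_diff)
    then have "f (P (x + z)) \<le> f (P x) + P z \<bullet> g (P p) + e * norm (P z)"
      using lin[OF PT[OF xd] PT[OF xz]] by simp
    also have "\<dots> \<le> x \<bullet> \<nu> + z \<bullet> P (g (P p)) + e * norm z"
      using above[of x] x \<delta> P_norm[of z] e by (auto simp: PI intro!: add_mono)
    also have "e * norm z < z \<bullet> M"
    proof -
      have "e * norm z * norm M < z \<bullet> N * norm M"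
        using z M by (intro mult_strict_right_mono) (auto simp: wide_cone_def)
      moreover have "z \<bullet> N * norm M = z \<bullet> M" using M by (auto simp: N_def)
      moreover have "e * norm z * 1 \<le> e * norm z * norm M"
        using M e by (intro mult_left_mono) auto
      ultimately show ?thesis by simp
    qed
    also have "x \<bullet> \<nu> + z \<bullet> P (g (P p)) + z \<bullet> M = (x + z) \<bullet> \<nu>"
      by (simp add: M_def inner_simps)
    finally have "f (P (x + z)) < (x + z) \<bullet> \<nu>" by simp
    then have "x + z \<in> \<Omega> \<inter> ball p r0" unfolding \<Omega> using xz \<delta> by (auto simp: P_def)
    then show "x + z \<in> \<Omega>" by simp
  qed
qed

text \<open>
  Compactness of the boundary. The balls of half the radius cover, so that a ball of radius \<open>r p / 2\<close>
  around a point of such a ball is still under control.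
\<close>

lemma C1_boundary_finite_cover:
  fixes \<Omega> :: "'a::euclidean_space set"
  assumes bd: "C1_holder_boundary \<gamma> \<Omega>" "0 < \<gamma>" and "bounded \<Omega>" and e: "0 < e"
  shows "\<exists>T r N. finite T \<and> T \<subseteq> frontier \<Omega> \<and> frontier \<Omega> \<subseteq> (\<Union>p\<in>T. ball p (r p / 2)) \<and>
     (\<forall>p\<in>T. 0 < r p \<and> norm (N p) = 1 \<and>
       (\<forall>x\<in>closure \<Omega> \<inter> ball p (r p). \<forall>z. norm z < r p \<longrightarrow> z \<in> wide_cone (N p) e \<longrightarrow> x + z \<in> \<Omega>))"
proof -
  have "\<forall>p\<in>frontier \<Omega>. \<exists>r. 0 < r \<and> (\<exists>N. norm N = 1 \<and>
    (\<forall>x\<in>closure \<Omega> \<inter> ball p r. \<forall>z. norm z < r \<longrightarrow> z \<in> wide_cone N e \<longrightarrow> x + z \<in> \<Omega>))"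
    using C1_boundary_local_cone[OF bd _ e] by blast
  then obtain r where r: "\<forall>p\<in>frontier \<Omega>. 0 < r p \<and> (\<exists>N. norm N = 1 \<and>
    (\<forall>x\<in>closure \<Omega> \<inter> ball p (r p). \<forall>z. norm z < r p \<longrightarrow> z \<in> wide_cone N e \<longrightarrow> x + z \<in> \<Omega>))"
    by (rule bchoice[THEN exE])
  then have "\<forall>p\<in>frontier \<Omega>. \<exists>N. norm N = 1 \<and>
    (\<forall>x\<in>closure \<Omega> \<inter> ball p (r p). \<forall>z. norm z < r p \<longrightarrow> z \<in> wide_cone N e \<longrightarrow> x + z \<in> \<Omega>)"
    by blast
  then obtain N where N: "\<forall>p\<in>frontier \<Omega>. norm (N p) = 1 \<and>
    (\<forall>x\<in>closure \<Omega> \<inter> ball p (r p). \<forall>z. norm z < r p \<longrightarrow> z \<in> wide_cone (N p) e \<longrightarrow> x + z \<in> \<Omega>)"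
    by (rule bchoice[THEN exE])
  have comp: "compact (frontier \<Omega>)" using \<open>bounded \<Omega>\<close> by (simp add: compact_frontier_bounded)
  have cov: "frontier \<Omega> \<subseteq> (\<Union>p\<in>frontier \<Omega>. ball p (r p / 2))"
  proof
    fix x assume x: "x \<in> frontier \<Omega>"
    with r have "x \<in> ball x (r x / 2)" by simp
    with x show "x \<in> (\<Union>p\<in>frontier \<Omega>. ball p (r p / 2))" by blast
  qed
  obtain T where T: "T \<subseteq> frontier \<Omega>" "finite T" "frontier \<Omega> \<subseteq> (\<Union>p\<in>T. ball p (r p / 2))"
    by (rule compactE_image[OF comp _ cov]) auto
  show ?thesis
  proof (intro exI[of _ T] exI[of _ r] exI[of _ N] conjI ballI)
    fix p assume "p \<in> T"
    with T(1) have "p \<in> frontier \<Omega>" by blast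
    with r N show "0 < r p" "norm (N p) = 1" by auto
    fix x assume "x \<in> closure \<Omega> \<inter> ball p (r p)"
    with N \<open>p \<in> frontier \<Omega>\<close>
    show "\<forall>z. norm z < r p \<longrightarrow> z \<in> wide_cone (N p) e \<longrightarrow> x + z \<in> \<Omega>" by blast
  qed (use T in auto)
qed

lemma uniform_interior_cone:
  fixes \<Omega> :: "'a::euclidean_space set"
  assumes bd: "C1_holder_boundary \<gamma> \<Omega>" "0 < \<gamma>" and "bounded \<Omega>" and e: "0 < e"
  obtains r where "0 < r" "\<And>x. x \<in> frontier \<Omega> \<Longrightarrow> \<exists>N. norm N = 1 \<and>
    (\<forall>z. norm z < r \<longrightarrow> z \<in> wide_cone N e \<longrightarrow> x + z \<in> \<Omega>)"
proof -
  obtain T r N where T: "finite T" "T \<subseteq> frontier \<Omega>" "frontier \<Omega> \<subseteq> (\<Union>p\<in>T. ball p (r p / 2))"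
    and N: "\<forall>p\<in>T. 0 < r p \<and> norm (N p) = 1 \<and>
       (\<forall>x\<in>closure \<Omega> \<inter> ball p (r p). \<forall>z. norm z < r p \<longrightarrow> z \<in> wide_cone (N p) e \<longrightarrow> x + z \<in> \<Omega>)"
    using C1_boundary_finite_cover[OF assms] by (elim exE conjE)
  define R where "R = Min (insert 1 (r ` T))"
  have R: "0 < R" "\<And>p. p \<in> T \<Longrightarrow> R \<le> r p"
    using T(1) N by (auto simp: R_def)
  show ?thesis
  proof (rule that[OF R(1)])
    fix x assume x: "x \<in> frontier \<Omega>"
    with T(3) obtain p where p: "p \<in> T" "x \<in> ball p (r p / 2)" by blast
    have "x \<in> closure \<Omega> \<inter> ball p (r p)"
      using x p N by (auto simp: frontier_def) 
    then have "\<forall>z. norm z < r p \<longrightarrow> z \<in> wide_cone (N p) e \<longrightarrow> x + z \<in> \<Omega>" using N p(1) by blast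
    then show "\<exists>N. norm N = 1 \<and> (\<forall>z. norm z < R \<longrightarrow> z \<in> wide_cone N e \<longrightarrow> x + z \<in> \<Omega>)"
      using N p(1) R(2)[OF p(1)] by (intro exI[of _ "N p"]) auto
  qed
qed

section \<open>Upper regularity of the surface measure\<close>

lemma hausdorff_premeasure_finite_cover:
  assumes "finite I" "A \<subseteq> (\<Union>i\<in>I. S i)" "0 < \<delta>" "\<And>i. i \<in> I \<Longrightarrow> bounded (S i) \<and> diameter (S i) \<le> \<delta>"
  shows "hausdorff_premeasure k \<delta> A \<le> (\<Sum>i\<in>I. hausdorff_gauge k (S i))"
proof -
  obtain h where h: "bij_betw h {0..<card I} I" using ex_bij_betw_nat_finite[OF assms(1)] by blast
  define C where "C j = (if j < card I then S (h j) else {})" for j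
  have hI: "h j \<in> I" if "j < card I" for j using h that by (auto simp: bij_betw_def)
  have "A \<subseteq> (\<Union>j. C j)"
  proof
    fix x assume "x \<in> A"
    then obtain i where "i \<in> I" "x \<in> S i" using assms(2) by blast
    then have "i \<in> h ` {0..<card I}" using h by (simp add: bij_betw_def)
    then obtain j where "j < card I" "h j = i" by auto
    with \<open>x \<in> S i\<close> have "x \<in> C j" by (simp add: C_def)
    then show "x \<in> (\<Union>j. C j)" by blast
  qed
  then have "C \<in> hausdorff_covers \<delta> A"
    using assms(3,4) hI by (auto simp: hausdorff_covers_def C_def)
  then have "hausdorff_premeasure k \<delta> A \<le> (\<Sum>j. hausdorff_gauge k (C j))"
    by (rule hausdorff_premeasure_le)
  also have "\<dots> = (\<Sum>j\<in>{0..<card I}. hausdorff_gauge k (C j))"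
    by (rule suminf_finite) (auto simp: C_def)
  also have "\<dots> = (\<Sum>j\<in>{0..<card I}. hausdorff_gauge k (S (h j)))"
    by (intro sum.cong) (auto simp: C_def)
  also have "\<dots> = (\<Sum>i\<in>I. hausdorff_gauge k (S i))"
    by (rule sum.reindex_bij_betw[OF h])
  finally show ?thesis .
qed

lemma hausdorff_gauge_le:
  fixes S :: "'a::euclidean_space set"
  assumes "\<And>x y. x \<in> S \<Longrightarrow> y \<in> S \<Longrightarrow> norm (x - y) \<le> d" "0 \<le> d"
  shows "hausdorff_gauge k S \<le> ennreal (unit_ball_vol (real k) * (d / 2) ^ k)"
proof (cases "S = {}")
  case False
  have b: "bounded S"
    using assms(1) False unfolding bounded_any_center[where a = "SOME x. x \<in> S"]
    by (metis dist_norm ex_in_conv someI_ex)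
  have "diameter S \<le> d" using assms by (intro diameter_le) auto
  then have "(diameter S / 2) ^ k \<le> (d / 2) ^ k"
    using diameter_ge_0[OF b] by (intro power_mono) auto
  then show ?thesis using False by (auto simp: hausdorff_gauge_def intro!: ennreal_leI mult_left_mono)
qed simp

text \<open>
  A set whose chords make an angle of at least 60 degrees with \<open>N\<close> is a Lipschitz graph over the hyperplane
  orthogonal to \<open>N\<close>. Pulling back a cubic grid of mesh \<open>\<rho> / m\<close> from the hyperplane covers it by at most
  \<open>(2 * m + 1) ^ (n - 1)\<close> pieces of diameter \<open>O(\<rho> / m)\<close>, whatever \<open>m\<close> is.
\<close>

lemma hausdorff_lipschitz_graph_le:
  fixes E :: "'a::euclidean_space set"
  assumes N: "norm N = 1" and flat: "\<And>x y. x \<in> E \<Longrightarrow> y \<in> E \<Longrightarrow> \<bar>(y - x) \<bullet> N\<bar> \<le> norm (y - x) / 2"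
    and E: "E \<subseteq> ball c \<rho>" and "0 < \<rho>"
  shows "hausdorff_outer_measure (DIM('a) - 1) E
     \<le> ennreal (unit_ball_vol (real (DIM('a) - 1)) * (3 * real (DIM('a) - 1)) ^ (DIM('a) - 1) * \<rho> ^ (DIM('a) - 1))"
proof -
  let ?k = "DIM('a) - 1"
  obtain b :: 'a where b: "b \<in> Basis" using nonempty_Basis by blast
  then obtain T where T: "orthogonal_transformation T" "T N = b" "\<And>x. T (T x) = x"
    using orthogonal_reflection[of N b] N by auto
  have lin: "linear T" using T(1) by (rule orthogonal_transformation_linear)
  have in_N: "T x \<bullet> b = x \<bullet> N" for x
    using T unfolding orthogonal_transformation_def by metis
  have T_norm: "norm (T x) = norm x" for x using T(1) by (rule orthogonal_transformation_norm)
  define A where "A = Basis - {b}"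
  have A: "finite A" "b \<notin> A" "Basis = insert b A" "card A = ?k" "\<And>i. i \<in> A \<Longrightarrow> i \<in> Basis"
    using b by (auto simp: A_def)
  define V where "V = unit_ball_vol (real ?k) * (3 * real ?k) ^ ?k * \<rho> ^ ?k"
  have "hausdorff_premeasure ?k \<delta> E \<le> ennreal V" if "0 < \<delta>" for \<delta>
  proof -
    \<comment> \<open>The mesh \<open>\<rho> / m\<close> is fine enough for the pieces to have diameter at most \<open>\<delta>\<close>.\<close>
    obtain m :: nat where m: "2 * real ?k * \<rho> / \<delta> < real m" using reals_Archimedean2 by blast
    have "0 \<le> 2 * real ?k * \<rho> / \<delta>" using \<open>0 < \<delta>\<close> \<open>0 < \<rho>\<close> by simp
    with m have "0 < real m" by linarith
    then have m0: "0 < m" by simp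
    define d where "d = 2 * (real ?k * (\<rho> / m))"
    have d: "0 \<le> d" "d \<le> \<delta>" using m m0 \<open>0 < \<delta>\<close> \<open>0 < \<rho>\<close> by (auto simp: d_def field_simps)
    define q where "q x i = \<lfloor>(T (x - c) \<bullet> i) * m / \<rho>\<rfloor>" for x i
    define I where "I = Pi\<^sub>E A (\<lambda>_. {- int m..int m})"
    define S where "S j = {x \<in> E. \<forall>i\<in>A. q x i = j i}" for j
    have I: "finite I" "card I = (2 * m + 1) ^ ?k"
    proof -
      have "card {- int m..int m} = 2 * m + 1" by simp
      then show "finite I" "card I = (2 * m + 1) ^ ?k"
        using A(1,4) by (simp_all add: I_def card_PiE finite_PiE del: card_atLeastAtMost_int)
    qed
    have diam: "norm (x - y) \<le> d" if "x \<in> S j" "y \<in> S j" for x y j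
    proof -
      have xy: "x \<in> E" "y \<in> E" using that by (auto simp: S_def)
      \<comment> \<open>Two points of a cell have nearly the same coordinates in the hyperplane, and flatness bounds the last
        one by half the distance.\<close>
      have coord: "\<bar>T (x - y) \<bullet> i\<bar> \<le> \<rho> / m" if "i \<in> A" for i
      proof -
        have "q x i = q y i" using \<open>x \<in> S j\<close> \<open>y \<in> S j\<close> that by (simp add: S_def)
        then have "\<bar>(T (x - c) \<bullet> i) * m / \<rho> - (T (y - c) \<bullet> i) * m / \<rho>\<bar> \<le> 1"
          unfolding q_def by linarith
        moreover have "(T (x - c) \<bullet> i) * m / \<rho> - (T (y - c) \<bullet> i) * m / \<rho> = (T (x - y) \<bullet> i) * (m / \<rho>)"
          by (simp add: linear_diff[OF lin] inner_simps algebra_simps diff_divide_distrib)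
        ultimately have "\<bar>T (x - y) \<bullet> i\<bar> * (m / \<rho>) \<le> 1" using m0 \<open>0 < \<rho>\<close> by (simp add: abs_mult)
        then show ?thesis using m0 \<open>0 < \<rho>\<close> by (simp add: field_simps)
      qed
      have "norm (x - y) = norm (T (x - y))" by (simp add: T_norm)
      also have "\<dots> \<le> (\<Sum>i\<in>Basis. \<bar>T (x - y) \<bullet> i\<bar>)" by (rule norm_le_l1)
      also have "\<dots> = \<bar>(x - y) \<bullet> N\<bar> + (\<Sum>i\<in>A. \<bar>T (x - y) \<bullet> i\<bar>)"
        unfolding A(3) using A(1,2) by (simp add: in_N)
      also have "\<dots> \<le> norm (x - y) / 2 + (\<Sum>i\<in>A. \<rho> / m)"
        by (intro add_mono flat xy sum_mono coord)
      finally show ?thesis by (simp add: A(4) d_def)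
    qed
    have bdd: "bounded (S j)" for j
      using E by (intro bounded_subset[OF bounded_ball[of c \<rho>]]) (auto simp: S_def)
    have "E \<subseteq> (\<Union>j\<in>I. S j)"
    proof
      fix x assume x: "x \<in> E"
      have "q x i \<in> {- int m..int m}" if "i \<in> A" for i
      proof -
        have "\<bar>T (x - c) \<bullet> i\<bar> \<le> norm (T (x - c))"
          using Basis_le_norm A(5)[OF that] by blast
        also have "\<dots> < \<rho>" using x E by (auto simp: T_norm dist_norm norm_minus_commute)
        finally have "\<bar>T (x - c) \<bullet> i\<bar> / \<rho> < 1" using \<open>0 < \<rho>\<close> by simp
        then have "\<bar>T (x - c) \<bullet> i\<bar> / \<rho> * real m < 1 * real m" using m0 by (intro mult_strict_right_mono) auto
        moreover define t where "t = (T (x - c) \<bullet> i) * m / \<rho>"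
        ultimately have "\<bar>t\<bar> < m" using \<open>0 < \<rho>\<close> by (simp add: abs_mult)
        then have "- real m < t" "t < real m" by linarith+
        then show ?thesis unfolding q_def t_def[symmetric] by (simp add: le_floor_iff floor_le_iff)
      qed
      then have "x \<in> S (restrict (q x) A)" "restrict (q x) A \<in> I"
        using x by (auto simp: S_def I_def)
      then show "x \<in> (\<Union>j\<in>I. S j)" by blast
    qed
    then have "hausdorff_premeasure ?k \<delta> E \<le> (\<Sum>j\<in>I. hausdorff_gauge ?k (S j))"
    proof (rule hausdorff_premeasure_finite_cover[OF I(1) _ \<open>0 < \<delta>\<close>])
      show "bounded (S j) \<and> diameter (S j) \<le> \<delta>" if "j \<in> I" for j
        using bdd diam[of _ j] d by (auto intro!: diameter_le order_trans[OF diam])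
    qed
    also have "\<dots> \<le> (\<Sum>j\<in>I. ennreal (unit_ball_vol (real ?k) * (d / 2) ^ ?k))"
      by (intro sum_mono hausdorff_gauge_le diam d)
    also have "\<dots> = ennreal ((1 + 2 * real m) ^ ?k * (unit_ball_vol (real ?k) * (d / 2) ^ ?k))"
      using d(1) by (simp add: I(2) ennreal_of_nat_eq_real_of_nat ennreal_mult[symmetric])
    also have "\<dots> \<le> ennreal ((3 * real m) ^ ?k * (unit_ball_vol (real ?k) * (d / 2) ^ ?k))"
      using m0 d(1) by (intro ennreal_leI mult_right_mono power_mono) auto
    also have "(3 * real m) ^ ?k * (unit_ball_vol (real ?k) * (d / 2) ^ ?k) = V"
    proof -
      have "3 * real m * (d / 2) = 3 * real ?k * \<rho>" using m0 by (simp add: d_def)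
      then have "(3 * real m) ^ ?k * (d / 2) ^ ?k = (3 * real ?k) ^ ?k * \<rho> ^ ?k"
        by (simp only: power_mult_distrib[symmetric])
      then show ?thesis unfolding V_def by (simp only: mult.left_commute mult.assoc)
    qed
    finally show ?thesis .
  qed
  then show ?thesis
    unfolding hausdorff_outer_measure_def V_def by (auto intro: SUP_least)
qed

text \<open>
  If the chord from \<open>u\<close> to \<open>v\<close> lay in the interior cone at \<open>u\<close>, then \<open>v\<close> would be an interior point.
  So the chords of the boundary satisfy the hypothesis of \<open>hausdorff_lipschitz_graph_le\<close>, locally.
\<close>

lemma frontier_upper_regular:
  fixes \<Omega> :: "'a::euclidean_space set"
  assumes bd: "C1_holder_boundary \<gamma> \<Omega>" "0 < \<gamma>" and "bounded \<Omega>" "open \<Omega>"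
  obtains C where "0 \<le> C" "\<And>y \<rho>. 0 < \<rho> \<Longrightarrow>
    emeasure (hausdorff_measure (DIM('a) - 1)) (frontier \<Omega> \<inter> ball y \<rho>) \<le> ennreal (C * \<rho> ^ (DIM('a) - 1))"
proof -
  let ?k = "DIM('a) - 1"
  obtain T r N where T: "finite T" "T \<subseteq> frontier \<Omega>" "frontier \<Omega> \<subseteq> (\<Union>p\<in>T. ball p (r p / 2))"
    and N: "\<forall>p\<in>T. 0 < r p \<and> norm (N p) = 1 \<and>
       (\<forall>x\<in>closure \<Omega> \<inter> ball p (r p). \<forall>z. norm z < r p \<longrightarrow> z \<in> wide_cone (N p) (1/2) \<longrightarrow> x + z \<in> \<Omega>)"
    using C1_boundary_finite_cover[OF assms(1-3) half_gt_zero[OF zero_less_one]] by (elim exE conjE)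
  define c where "c = unit_ball_vol (real ?k) * (3 * real ?k) ^ ?k"
  have c0: "0 \<le> c" by (simp add: c_def)
  show ?thesis
  proof (rule that[of "card T * c"])
    show "0 \<le> card T * c" using c0 by simp
    fix y :: 'a and \<rho> :: real assume "0 < \<rho>"
    define E where "E p = frontier \<Omega> \<inter> ball p (r p / 2) \<inter> ball y \<rho>" for p
    have Eb: "E p \<in> sets borel" for p by (simp add: E_def frontier_closed borel_closed sets.Int)
    have "emeasure (hausdorff_measure ?k) (E p) \<le> ennreal (c * \<rho> ^ ?k)" if p: "p \<in> T" for p
    proof -
      have half: "(v - u) \<bullet> N p \<le> norm (v - u) / 2" if "u \<in> E p" "v \<in> E p" for u v
      proof (rule ccontr)
        assume "\<not> ?thesis"
        then have 1: "v - u \<in> wide_cone (N p) (1/2)" by (simp add: wide_cone_def)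
        have "dist u v \<le> dist u p + dist p v" by (rule dist_triangle)
        then have 2: "norm (v - u) < r p"
          using that by (simp add: E_def dist_commute dist_norm[symmetric])
        have "u \<in> closure \<Omega> \<inter> ball p (r p)" using that N p by (auto simp: E_def frontier_def)
        then have "u + (v - u) \<in> \<Omega>" using N p 1 2 by blast
        then show False using that \<open>open \<Omega>\<close> by (auto simp: E_def frontier_def interior_open)
      qed
      have "hausdorff_outer_measure ?k (E p) \<le> ennreal (c * \<rho> ^ ?k)"
        unfolding c_def
      proof (rule hausdorff_lipschitz_graph_le[where N = "N p" and c = y])
        fix u v assume "u \<in> E p" "v \<in> E p"
        then show "\<bar>(v - u) \<bullet> N p\<bar> \<le> norm (v - u) / 2"
          by (intro abs_leI)
             (use half[of u v] half[of v u] in \<open>simp_all add: inner_diff_left norm_minus_commute\<close>)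
      qed (use N p \<open>0 < \<rho>\<close> in \<open>auto simp: E_def\<close>)
      then show ?thesis by (simp add: emeasure_hausdorff_measure Eb)
    qed
    note Ep = this
    have "emeasure (hausdorff_measure ?k) (frontier \<Omega> \<inter> ball y \<rho>) \<le> emeasure (hausdorff_measure ?k) (\<Union>p\<in>T. E p)"
    proof (rule emeasure_mono)
      show "frontier \<Omega> \<inter> ball y \<rho> \<subseteq> (\<Union>p\<in>T. E p)" using T(3) by (auto simp: E_def)
      show "(\<Union>p\<in>T. E p) \<in> sets (hausdorff_measure ?k)" using T(1) Eb by auto
    qed
    also have "\<dots> \<le> (\<Sum>p\<in>T. emeasure (hausdorff_measure ?k) (E p))"
      using T(1) Eb by (intro emeasure_subadditive_finite) auto
    also have "\<dots> \<le> (\<Sum>p\<in>T. ennreal (c * \<rho> ^ ?k))" by (intro sum_mono Ep)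
    also have "\<dots> = ennreal (card T * c * \<rho> ^ ?k)"
      using c0 \<open>0 < \<rho>\<close> by (simp add: ennreal_of_nat_eq_real_of_nat ennreal_mult[symmetric] mult.assoc)
    finally show "emeasure (hausdorff_measure ?k) (frontier \<Omega> \<inter> ball y \<rho>) \<le> ennreal (card T * c * \<rho> ^ ?k)" .
  qed
qed

section \<open>Oscillation along segments\<close>

text \<open>
  \<open>G\<close> is the gradient of \<open>u\<close>, extended continuously to the closure. Borel measurability of both functions on
  the whole space is part of the definition so that they can be used in integrals without restriction;
  every function of class \<open>C\<^sup>1\<close> up to the boundary agrees on the closure with one of this kind
  (\<open>C1_closure_pairE\<close>).
\<close>

definition C1_pair :: "'a::euclidean_space set \<Rightarrow> ('a \<Rightarrow> real) \<Rightarrow> ('a \<Rightarrow> 'a) \<Rightarrow> bool" where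
  "C1_pair \<Omega> u G \<longleftrightarrow> u \<in> borel_measurable borel \<and> G \<in> borel_measurable borel \<and>
     continuous_on (closure \<Omega>) u \<and> continuous_on (closure \<Omega>) G \<and> (\<forall>x\<in>\<Omega>. GDERIV u x :> G x)"

text \<open>
  The fundamental theorem of calculus on a segment that may start and end on the boundary.
\<close>

lemma ray_estimate:
  fixes u :: "'a::euclidean_space \<Rightarrow> real"
  assumes u: "C1_pair \<Omega> u G" and t: "0 \<le> t"
    and cl: "\<And>s. 0 \<le> s \<Longrightarrow> s \<le> t \<Longrightarrow> x + s *\<^sub>R z \<in> closure \<Omega>"
    and op: "\<And>s. 0 < s \<Longrightarrow> s < t \<Longrightarrow> x + s *\<^sub>R z \<in> \<Omega>"
  shows "ennreal \<bar>u (x + t *\<^sub>R z) - u x\<bar>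
    \<le> (\<integral>\<^sup>+s. indicator {0<..<t} s * ennreal (norm (G (x + s *\<^sub>R z)) * norm z) \<partial>lborel)"
proof -
  have cu: "continuous_on (closure \<Omega>) u" and cG: "continuous_on (closure \<Omega>) G"
    and der: "\<And>y. y \<in> \<Omega> \<Longrightarrow> (u has_derivative (\<lambda>h. h \<bullet> G y)) (at y)"
    using u by (auto simp: C1_pair_def gderiv_def)
  define ray where "ray s = x + s *\<^sub>R z" for s
  have c_ray: "continuous_on {0..t} ray" unfolding ray_def by (intro continuous_intros)
  have ray_cl: "ray ` {0..t} \<subseteq> closure \<Omega>" using cl by (auto simp: ray_def)
  have c_Gray: "continuous_on {0..t} (\<lambda>s. G (ray s))"
    by (rule continuous_on_compose2[OF cG c_ray ray_cl])
  have ftc: "((\<lambda>s. z \<bullet> G (ray s)) has_integral (u (ray t) - u (ray 0))) {0..t}"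
  proof (rule fundamental_theorem_of_calculus_interior[OF t])
    show "continuous_on {0..t} (\<lambda>s. u (ray s))"
      by (rule continuous_on_compose2[OF cu c_ray ray_cl])
    fix s assume s: "s \<in> {0<..<t}"
    have "((\<lambda>s. u (ray s)) has_derivative (\<lambda>h. (h *\<^sub>R z) \<bullet> G (ray s))) (at s)"
    proof (rule has_derivative_compose[of ray _ s UNIV u, simplified])
      show "(ray has_derivative (\<lambda>h. h *\<^sub>R z)) (at s)"
        unfolding ray_def by (auto intro!: derivative_eq_intros)
      show "(u has_derivative (\<lambda>h. h \<bullet> G (ray s))) (at (ray s))"
        using op[of s] s by (intro der) (auto simp: ray_def)
    qed
    then show "((\<lambda>s. u (ray s)) has_vector_derivative z \<bullet> G (ray s)) (at s)"
      by (simp add: has_vector_derivative_def)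
  qed
  define F where "F s = norm (G (ray s)) * norm z" for s
  have "continuous_on {0..t} F" unfolding F_def by (intro continuous_intros c_Gray)
  then have F: "(F has_integral integral {0..t} F) {0..t}"
    by (intro integrable_integral integrable_continuous_real)
  have "\<bar>u (ray t) - u (ray 0)\<bar> \<le> integral {0..t} F"
  proof -
    have "norm (integral {0..t} (\<lambda>s. z \<bullet> G (ray s))) \<le> integral {0..t} F"
    proof (rule integral_norm_bound_integral)
      show "norm (z \<bullet> G (ray s)) \<le> F s" for s
        using Cauchy_Schwarz_ineq2[of z "G (ray s)"] by (simp add: F_def mult.commute)
    qed (use ftc F in \<open>auto simp: has_integral_integrable\<close>)
    then show ?thesis using integral_unique[OF ftc] by simp
  qed
  then have "ennreal \<bar>u (ray t) - u (ray 0)\<bar> \<le> ennreal (integral {0..t} F)" by (rule ennreal_leI)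
  also have "\<dots> = (\<integral>\<^sup>+s. ennreal (F s) * indicator {0..t} s \<partial>lborel)"
    by (rule nn_integral_has_integral_lebesgue'[symmetric, OF _ F]) (simp add: F_def)
  also have "\<dots> = (\<integral>\<^sup>+s. indicator {0<..<t} s * ennreal (F s) \<partial>lborel)"
  proof (rule nn_integral_cong_AE)
    show "AE s in lborel. ennreal (F s) * indicator {0..t} s = indicator {0<..<t} s * ennreal (F s)"
      using AE_lborel_singleton[of 0] AE_lborel_singleton[of t]
      by eventually_elim (auto simp: indicator_def)
  qed
  finally show ?thesis by (simp add: ray_def F_def)
qed

abbreviation grad_mass :: "'a::euclidean_space set \<Rightarrow> ('a \<Rightarrow> 'a) \<Rightarrow> ennreal" where
  "grad_mass \<Omega> G \<equiv> (\<integral>\<^sup>+x. indicator \<Omega> x * ennreal (norm (G x)) \<partial>lborel)"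

text \<open>
  Integrate \<open>ray_estimate\<close> over the starting point and exchange the integrals: for each \<open>s\<close>, the translate
  of \<open>V\<close> by \<open>s e\<close> lies in \<open>\<Omega>\<close>.
\<close>

lemma translation_estimate:
  fixes u :: "'a::euclidean_space \<Rightarrow> real"
  assumes u: "C1_pair \<Omega> u G" and "open \<Omega>" and [measurable]: "V \<in> sets borel"
    and V: "\<And>x s. x \<in> V \<Longrightarrow> 0 \<le> s \<Longrightarrow> s \<le> 1 \<Longrightarrow> x + s *\<^sub>R e \<in> \<Omega>"
  shows "(\<integral>\<^sup>+x. indicator V x * ennreal \<bar>u (x + e) - u x\<bar> \<partial>lborel) \<le> ennreal (norm e) * grad_mass \<Omega> G"
proof -
  have [measurable]: "\<Omega> \<in> sets borel" using \<open>open \<Omega>\<close> by simp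
  have [measurable]: "u \<in> borel_measurable borel" "G \<in> borel_measurable borel"
    using u by (auto simp: C1_pair_def)
  have "(\<integral>\<^sup>+x. indicator V x * ennreal \<bar>u (x + e) - u x\<bar> \<partial>lborel)
     \<le> (\<integral>\<^sup>+x. \<integral>\<^sup>+s. ennreal (norm e) * (indicator {0<..<1} s * (indicator \<Omega> (s *\<^sub>R e + x) * ennreal (norm (G (s *\<^sub>R e + x))))) \<partial>lborel \<partial>lborel)"
  proof (rule nn_integral_mono)
    fix x
    show "indicator V x * ennreal \<bar>u (x + e) - u x\<bar>
       \<le> (\<integral>\<^sup>+s. ennreal (norm e) * (indicator {0<..<1} s * (indicator \<Omega> (s *\<^sub>R e + x) * ennreal (norm (G (s *\<^sub>R e + x))))) \<partial>lborel)"
    proof (cases "x \<in> V")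
      case True
      have "ennreal \<bar>u (x + 1 *\<^sub>R e) - u x\<bar>
          \<le> (\<integral>\<^sup>+s. indicator {0<..<1} s * ennreal (norm (G (x + s *\<^sub>R e)) * norm e) \<partial>lborel)"
        using V[OF True] closure_subset[of \<Omega>] by (intro ray_estimate[OF u]) auto
      also have "\<dots> = (\<integral>\<^sup>+s. ennreal (norm e) * (indicator {0<..<1} s * (indicator \<Omega> (s *\<^sub>R e + x) * ennreal (norm (G (s *\<^sub>R e + x))))) \<partial>lborel)"
        using V[OF True] by (intro nn_integral_cong) (auto simp: indicator_def ennreal_mult add.commute mult.commute)
      finally show ?thesis using True by simp
    qed simp
  qed
  also have "\<dots> = (\<integral>\<^sup>+s. \<integral>\<^sup>+x. ennreal (norm e) * (indicator {0<..<1} s * (indicator \<Omega> (s *\<^sub>R e + x) * ennreal (norm (G (s *\<^sub>R e + x))))) \<partial>lborel \<partial>lborel)"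
    by (rule lborel_pair.Fubini'[symmetric]) measurable
  also have "\<dots> = (\<integral>\<^sup>+s. ennreal (norm e) * (indicator {0<..<1} (s::real) * grad_mass \<Omega> G) \<partial>lborel)"
  proof (rule nn_integral_cong)
    fix s :: real
    have "(\<integral>\<^sup>+x. indicator \<Omega> (s *\<^sub>R e + x) * ennreal (norm (G (s *\<^sub>R e + x))) \<partial>lborel) = grad_mass \<Omega> G"
      by (rule nn_integral_lborel_translate) measurable
    then show "(\<integral>\<^sup>+x. ennreal (norm e) * (indicator {0<..<1} s * (indicator \<Omega> (s *\<^sub>R e + x) * ennreal (norm (G (s *\<^sub>R e + x))))) \<partial>lborel)
       = ennreal (norm e) * (indicator {0<..<1} s * grad_mass \<Omega> G)"
      by (simp add: nn_integral_cmult)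
  qed
  also have "\<dots> = ennreal (norm e) * grad_mass \<Omega> G"
    by (simp add: nn_integral_cmult nn_integral_multc)
  finally show ?thesis .
qed

section \<open>The Poincare inequality\<close>

text \<open>
  The Poincare inequality on \<open>S\<close> with a reference value \<open>c u G\<close> that does not depend on \<open>S\<close>. The functional
  \<open>c\<close> is a parameter so that the inequality can be carried from one set to another.
\<close>

definition oscillation_controlled ::
    "(('a::euclidean_space \<Rightarrow> real) \<Rightarrow> ('a \<Rightarrow> 'a) \<Rightarrow> real) \<Rightarrow> 'a set \<Rightarrow> 'a set \<Rightarrow> bool" where
  "oscillation_controlled c \<Omega> S \<longleftrightarrow> S \<in> sets borel \<and>
     (\<exists>C\<ge>0. \<forall>u G. C1_pair \<Omega> u G \<longrightarrow>
        (\<integral>\<^sup>+x. indicator S x * ennreal \<bar>u x - c u G\<bar> \<partial>lborel) \<le> ennreal C * grad_mass \<Omega> G)"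

lemma oscillation_controlled_subset:
  assumes "oscillation_controlled c \<Omega> S" "S' \<subseteq> S" "S' \<in> sets borel"
  shows "oscillation_controlled c \<Omega> S'"
proof -
  have "(\<integral>\<^sup>+x. indicator S' x * ennreal \<bar>u x - c u G\<bar> \<partial>lborel) \<le> (\<integral>\<^sup>+x. indicator S x * ennreal \<bar>u x - c u G\<bar> \<partial>lborel)" for u G
    using assms(2) by (intro nn_integral_mono) (auto simp: indicator_def)
  with assms show ?thesis
    unfolding oscillation_controlled_def by (meson order_trans)
qed

lemma oscillation_controlled_Un:
  assumes "oscillation_controlled c \<Omega> S" "oscillation_controlled c \<Omega> S'"
  shows "oscillation_controlled c \<Omega> (S \<union> S')"
proof -
  obtain C where C: "0 \<le> C" "\<And>u G. C1_pair \<Omega> u G \<Longrightarrow>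
      (\<integral>\<^sup>+x. indicator S x * ennreal \<bar>u x - c u G\<bar> \<partial>lborel) \<le> ennreal C * grad_mass \<Omega> G"
    using assms(1) unfolding oscillation_controlled_def by blast
  obtain C' where C': "0 \<le> C'" "\<And>u G. C1_pair \<Omega> u G \<Longrightarrow>
      (\<integral>\<^sup>+x. indicator S' x * ennreal \<bar>u x - c u G\<bar> \<partial>lborel) \<le> ennreal C' * grad_mass \<Omega> G"
    using assms(2) unfolding oscillation_controlled_def by blast
  have [measurable]: "S \<in> sets borel" "S' \<in> sets borel"
    using assms by (auto simp: oscillation_controlled_def)
  show ?thesis
    unfolding oscillation_controlled_def
  proof (intro conjI exI[of _ "C + C'"] allI impI)
    fix u G assume u: "C1_pair \<Omega> u G"
    then have [measurable]: "u \<in> borel_measurable borel" by (simp add: C1_pair_def)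
    have "(\<integral>\<^sup>+x. indicator (S \<union> S') x * ennreal \<bar>u x - c u G\<bar> \<partial>lborel)
       \<le> (\<integral>\<^sup>+x. indicator S x * ennreal \<bar>u x - c u G\<bar> + indicator S' x * ennreal \<bar>u x - c u G\<bar> \<partial>lborel)"
      by (intro nn_integral_mono) (auto simp: indicator_def)
    also have "\<dots> = (\<integral>\<^sup>+x. indicator S x * ennreal \<bar>u x - c u G\<bar> \<partial>lborel) + (\<integral>\<^sup>+x. indicator S' x * ennreal \<bar>u x - c u G\<bar> \<partial>lborel)"
      by (rule nn_integral_add) measurable
    also have "\<dots> \<le> ennreal C * grad_mass \<Omega> G + ennreal C' * grad_mass \<Omega> G"
      by (intro add_mono C C' u)
    also have "\<dots> = ennreal (C + C') * grad_mass \<Omega> G"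
      using C(1) C'(1) by (simp add: distrib_right)
    finally show "(\<integral>\<^sup>+x. indicator (S \<union> S') x * ennreal \<bar>u x - c u G\<bar> \<partial>lborel) \<le> ennreal (C + C') * grad_mass \<Omega> G" .
  qed (use C(1) C'(1) in auto)
qed

lemma oscillation_controlled_empty: "oscillation_controlled c \<Omega> {}"
  by (auto simp: oscillation_controlled_def)

lemma oscillation_controlled_UN:
  assumes "finite I" "\<And>i. i \<in> I \<Longrightarrow> oscillation_controlled c \<Omega> (S i)"
  shows "oscillation_controlled c \<Omega> (\<Union>i\<in>I. S i)"
  using assms by (induction rule: finite_induct)
    (simp_all add: oscillation_controlled_empty oscillation_controlled_Un)

text \<open>
  By \<open>translation_estimate\<close>, control passes from \<open>S\<close> to any set that can be moved into \<open>S\<close> by a translation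
  whose path stays in \<open>\<Omega>\<close>. This carries control along chains of balls and up to the boundary.
\<close>

lemma oscillation_controlled_translate:
  fixes e :: "'a::euclidean_space"
  assumes S: "oscillation_controlled c \<Omega> S" and "open \<Omega>" and [measurable]: "V \<in> sets borel"
    and V: "\<And>x. x \<in> V \<Longrightarrow> x + e \<in> S" "\<And>x s. x \<in> V \<Longrightarrow> 0 \<le> s \<Longrightarrow> s \<le> 1 \<Longrightarrow> x + s *\<^sub>R e \<in> \<Omega>"
  shows "oscillation_controlled c \<Omega> V"
proof -
  obtain C where C: "0 \<le> C" "\<And>u G. C1_pair \<Omega> u G \<Longrightarrow>
      (\<integral>\<^sup>+x. indicator S x * ennreal \<bar>u x - c u G\<bar> \<partial>lborel) \<le> ennreal C * grad_mass \<Omega> G"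
    using S unfolding oscillation_controlled_def by blast
  have [measurable]: "S \<in> sets borel" using S by (simp add: oscillation_controlled_def)
  show ?thesis
    unfolding oscillation_controlled_def
  proof (intro conjI exI[of _ "norm e + C"] allI impI)
    fix u G assume u: "C1_pair \<Omega> u G"
    then have [measurable]: "u \<in> borel_measurable borel" by (simp add: C1_pair_def)
    have "(\<integral>\<^sup>+x. indicator V x * ennreal \<bar>u x - c u G\<bar> \<partial>lborel)
       \<le> (\<integral>\<^sup>+x. indicator V x * ennreal \<bar>u (x + e) - u x\<bar> + indicator S (e + x) * ennreal \<bar>u (e + x) - c u G\<bar> \<partial>lborel)"
    proof (rule nn_integral_mono)
      fix x
      have "ennreal \<bar>u x - c u G\<bar> \<le> ennreal (\<bar>u (x + e) - u x\<bar> + \<bar>u (x + e) - c u G\<bar>)"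
        by (rule ennreal_leI) linarith
      then show "indicator V x * ennreal \<bar>u x - c u G\<bar>
        \<le> indicator V x * ennreal \<bar>u (x + e) - u x\<bar> + indicator S (e + x) * ennreal \<bar>u (e + x) - c u G\<bar>"
        using V(1)[of x] by (auto simp: indicator_def add.commute)
    qed
    also have "\<dots> = (\<integral>\<^sup>+x. indicator V x * ennreal \<bar>u (x + e) - u x\<bar> \<partial>lborel)
        + (\<integral>\<^sup>+x. indicator S (e + x) * ennreal \<bar>u (e + x) - c u G\<bar> \<partial>lborel)"
      by (rule nn_integral_add) measurable
    also have "(\<integral>\<^sup>+x. indicator S (e + x) * ennreal \<bar>u (e + x) - c u G\<bar> \<partial>lborel)
        = (\<integral>\<^sup>+x. indicator S x * ennreal \<bar>u x - c u G\<bar> \<partial>lborel)"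
      by (rule nn_integral_lborel_translate) measurable
    also have "(\<integral>\<^sup>+x. indicator V x * ennreal \<bar>u (x + e) - u x\<bar> \<partial>lborel) + (\<integral>\<^sup>+x. indicator S x * ennreal \<bar>u x - c u G\<bar> \<partial>lborel)
        \<le> ennreal (norm e) * grad_mass \<Omega> G + ennreal C * grad_mass \<Omega> G"
      by (intro add_mono C u translation_estimate[OF u \<open>open \<Omega>\<close>] V) auto
    also have "\<dots> = ennreal (norm e + C) * grad_mass \<Omega> G"
      using C(1) by (simp add: distrib_right)
    finally show "(\<integral>\<^sup>+x. indicator V x * ennreal \<bar>u x - c u G\<bar> \<partial>lborel) \<le> ennreal (norm e + C) * grad_mass \<Omega> G" .
  qed (use C(1) in auto)
qed

text \<open>
  Used to choose the reference value in a ball as a value of \<open>u\<close>, instead of the mean of \<open>u\<close>.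
\<close>

lemma ex_le_nn_average:
  assumes [measurable]: "B \<in> sets M" "f \<in> borel_measurable M"
    and B: "emeasure M B = ennreal m" "0 < m"
  shows "\<exists>y\<in>B. f y * ennreal m \<le> (\<integral>\<^sup>+x. indicator B x * f x \<partial>M)"
proof (rule ccontr)
  let ?I = "\<integral>\<^sup>+x. indicator B x * f x \<partial>M"
  assume neg: "\<not> (\<exists>y\<in>B. f y * ennreal m \<le> ?I)"
  have "B \<noteq> {}" using B by auto
  then obtain y where "y \<in> B" by blast
  with neg have "?I < top" by (auto simp: not_le top.not_eq_extremum intro: less_le_trans)
  then obtain i where i: "?I = ennreal i" "0 \<le> i" by (cases ?I) auto
  have im: "ennreal (i / m) * ennreal m = ennreal i" using B(2) i(2) by (simp add: ennreal_mult[symmetric])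
  have less: "ennreal (i / m) < f y" if "y \<in> B" for y
  proof (rule ccontr)
    assume "\<not> ennreal (i / m) < f y"
    then have "f y * ennreal m \<le> ennreal (i / m) * ennreal m" by (intro mult_right_mono) auto
    then show False using neg that i im by auto
  qed
  have const: "(\<integral>\<^sup>+x. indicator B x * ennreal (i / m) \<partial>M) = ennreal i"
    by (subst nn_integral_multc) (auto simp: B(1) im mult.commute[of "ennreal m"])
  have "(\<integral>\<^sup>+x. indicator B x * ennreal (i / m) \<partial>M) < ?I"
  proof (rule nn_integral_less)
    show "(\<integral>\<^sup>+x. indicator B x * ennreal (i / m) \<partial>M) \<noteq> \<infinity>"
      unfolding const by simp
    show "AE x in M. indicator B x * ennreal (i / m) \<le> indicator B x * f x"
      using less by (intro AE_I2) (simp add: indicator_def less_imp_le)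
    show "\<not> (AE x in M. indicator B x * f x \<le> indicator B x * ennreal (i / m))"
    proof
      assume "AE x in M. indicator B x * f x \<le> indicator B x * ennreal (i / m)"
      then have "AE x in M. x \<notin> B"
      proof (rule eventually_mono)
        fix x assume "indicator B x * f x \<le> indicator B x * ennreal (i / m)"
        then show "x \<notin> B" using less[of x] by (cases "x \<in> B") auto
      qed
      then have "B \<in> null_sets M" by (subst AE_iff_null_sets) auto
      then have "emeasure M B = 0" by (rule null_setsD1)
      with B show False by simp
    qed
  qed measurable
  then show False unfolding const i(1) by simp
qed

text \<open>
  The double integral of \<open>\<bar>u x - u y\<bar>\<close> over the ball is, with \<open>h = x - y\<close>, an integral over \<open>h\<close> of the
  quantities bounded in \<open>translation_estimate\<close>; the paths stay in the ball by convexity. For some \<open>y\<close> in the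
  ball the inner integral is at most its average, and \<open>u y\<close> is the reference value.
\<close>

lemma oscillation_controlled_ball:
  fixes x0 :: "'a::euclidean_space"
  assumes "open \<Omega>" and sub: "ball x0 \<sigma> \<subseteq> \<Omega>" and "0 < \<sigma>"
  shows "\<exists>c. oscillation_controlled c \<Omega> (ball x0 \<sigma>)"
proof -
  define B where "B = ball x0 \<sigma>"
  define D where "D = ball (0::'a) (2 * \<sigma>)"
  define m where "m = measure lborel B"
  define C where "C = measure lborel D * (2 * \<sigma>)"
  have [measurable]: "B \<in> sets borel" "D \<in> sets borel" "\<Omega> \<in> sets borel"
    using \<open>open \<Omega>\<close> by (auto simp: B_def D_def)
  have C0: "0 \<le> C" using \<open>0 < \<sigma>\<close> by (simp add: C_def)
  have eB: "emeasure lborel B = ennreal m"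
    unfolding m_def B_def using emeasure_lborel_ball_finite[of x0 \<sigma>] by (intro emeasure_eq_ennreal_measure) auto
  have eD: "emeasure lborel D = ennreal (measure lborel D)"
    unfolding D_def using emeasure_lborel_ball_finite[of "0::'a" "2 * \<sigma>"] by (intro emeasure_eq_ennreal_measure) auto
  have m0: "0 < m" using \<open>0 < \<sigma>\<close> by (simp add: m_def B_def content_ball)
  have "\<exists>c. (\<integral>\<^sup>+x. indicator B x * ennreal \<bar>u x - c\<bar> \<partial>lborel) \<le> ennreal (C / m) * grad_mass \<Omega> G"
    if u: "C1_pair \<Omega> u G" for u G
  proof -
    have [measurable]: "u \<in> borel_measurable borel" using u by (simp add: C1_pair_def)
    define g where "g y = (\<integral>\<^sup>+x. indicator B x * ennreal \<bar>u x - u y\<bar> \<partial>lborel)" for y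
    have [measurable]: "g \<in> borel_measurable borel" unfolding g_def by measurable
    have "(\<integral>\<^sup>+y. indicator B y * g y \<partial>lborel) = (\<integral>\<^sup>+y. \<integral>\<^sup>+x. indicator B y * (indicator B x * ennreal \<bar>u x - u y\<bar>) \<partial>lborel \<partial>lborel)"
      unfolding g_def by (intro nn_integral_cong nn_integral_cmult[symmetric]) measurable
    also have "\<dots> = (\<integral>\<^sup>+y. \<integral>\<^sup>+h. indicator B y * (indicator B (y + h) * ennreal \<bar>u (y + h) - u y\<bar>) \<partial>lborel \<partial>lborel)"
      by (intro nn_integral_cong nn_integral_lborel_translate[symmetric]) measurable
    also have "\<dots> = (\<integral>\<^sup>+h. \<integral>\<^sup>+y. indicator B y * (indicator B (y + h) * ennreal \<bar>u (y + h) - u y\<bar>) \<partial>lborel \<partial>lborel)"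
      by (rule lborel_pair.Fubini'[symmetric]) measurable
    also have "\<dots> \<le> (\<integral>\<^sup>+h. indicator D h * (ennreal (2 * \<sigma>) * grad_mass \<Omega> G) \<partial>lborel)"
    proof (rule nn_integral_mono)
      fix h :: 'a
      define V where "V = {y \<in> B. y + h \<in> B}"
      have [measurable]: "V \<in> sets borel" unfolding V_def by measurable
      have le: "(\<integral>\<^sup>+y. indicator V y * ennreal \<bar>u (y + h) - u y\<bar> \<partial>lborel) \<le> ennreal (norm h) * grad_mass \<Omega> G"
      proof (rule translation_estimate[OF u \<open>open \<Omega>\<close>])
        fix x s assume "x \<in> V" "0 \<le> s" "s \<le> (1::real)"
        then have "(1 - s) *\<^sub>R x + s *\<^sub>R (x + h) \<in> B"
          unfolding V_def B_def by (intro convexD[OF convex_ball]) auto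
        then show "x + s *\<^sub>R h \<in> \<Omega>" using sub by (auto simp: B_def algebra_simps)
      qed auto
      have eq: "(\<integral>\<^sup>+y. indicator B y * (indicator B (y + h) * ennreal \<bar>u (y + h) - u y\<bar>) \<partial>lborel)
         = (\<integral>\<^sup>+y. indicator V y * ennreal \<bar>u (y + h) - u y\<bar> \<partial>lborel)"
        by (intro nn_integral_cong) (auto simp: V_def indicator_def)
      show "(\<integral>\<^sup>+y. indicator B y * (indicator B (y + h) * ennreal \<bar>u (y + h) - u y\<bar>) \<partial>lborel)
         \<le> indicator D h * (ennreal (2 * \<sigma>) * grad_mass \<Omega> G)"
      proof (cases "h \<in> D")
        case True
        then have "ennreal (norm h) * grad_mass \<Omega> G \<le> ennreal (2 * \<sigma>) * grad_mass \<Omega> G"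
          by (intro mult_right_mono ennreal_leI) (auto simp: D_def)
        with le eq True show ?thesis by simp
      next
        case False
        have "V = {}"
        proof (rule ccontr)
          assume "V \<noteq> {}"
          then obtain y where "y \<in> B" "y + h \<in> B" by (auto simp: V_def)
          then have "dist x0 y < \<sigma>" "dist x0 (y + h) < \<sigma>" by (auto simp: B_def)
          moreover have "norm h \<le> dist x0 y + dist x0 (y + h)"
            using dist_triangle3[of y "y + h" x0] by (simp add: dist_norm)
          ultimately show False using False by (simp add: D_def)
        qed
        then show ?thesis unfolding eq by simp
      qed
    qed
    also have "\<dots> = ennreal C * grad_mass \<Omega> G"
      using \<open>0 < \<sigma>\<close> by (simp add: nn_integral_multc eD C_def ennreal_mult mult.assoc)
    finally have le: "(\<integral>\<^sup>+y. indicator B y * g y \<partial>lborel) \<le> ennreal C * grad_mass \<Omega> G" .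
    obtain y where "g y * ennreal m \<le> (\<integral>\<^sup>+y. indicator B y * g y \<partial>lborel)"
      using ex_le_nn_average[OF _ _ eB m0, of g] by auto
    then have "g y * ennreal m \<le> ennreal C * grad_mass \<Omega> G" using le by (rule order_trans)
    then have "g y * ennreal m * ennreal (1 / m) \<le> ennreal C * grad_mass \<Omega> G * ennreal (1 / m)"
      by (rule mult_right_mono) simp
    moreover have "g y * ennreal m * ennreal (1 / m) = g y"
      using m0 by (simp add: mult.assoc ennreal_mult[symmetric])
    moreover have "ennreal C * grad_mass \<Omega> G * ennreal (1 / m) = ennreal (C / m) * grad_mass \<Omega> G"
    proof -
      have "ennreal (C / m) = ennreal C * ennreal (1 / m)" using m0 C0 by (simp add: ennreal_mult[symmetric])
      then show ?thesis by (simp add: mult_ac)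
    qed
    ultimately have "g y \<le> ennreal (C / m) * grad_mass \<Omega> G" by simp
    then show ?thesis unfolding g_def by blast
  qed
  then have "\<forall>p. \<exists>c. C1_pair \<Omega> (fst p) (snd p) \<longrightarrow>
    (\<integral>\<^sup>+x. indicator B x * ennreal \<bar>fst p x - c\<bar> \<partial>lborel) \<le> ennreal (C / m) * grad_mass \<Omega> (snd p)"
    by blast
  then obtain c where c: "\<forall>p. C1_pair \<Omega> (fst p) (snd p) \<longrightarrow>
    (\<integral>\<^sup>+x. indicator B x * ennreal \<bar>fst p x - c p\<bar> \<partial>lborel) \<le> ennreal (C / m) * grad_mass \<Omega> (snd p)"
    by (rule choice[THEN exE])
  have "(\<integral>\<^sup>+x. indicator B x * ennreal \<bar>u x - c (u, G)\<bar> \<partial>lborel) \<le> ennreal (C / m) * grad_mass \<Omega> G"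
    if "C1_pair \<Omega> u G" for u G
    using c[rule_format, of "(u, G)"] that by simp
  then have "oscillation_controlled (\<lambda>u G. c (u, G)) \<Omega> B"
    unfolding oscillation_controlled_def using C0 m0
    by (intro conjI exI[of _ "C / m"]) auto
  then show ?thesis unfolding B_def by blast
qed

lemma oscillation_controlled_neighbour:
  fixes \<Omega> :: "'a::euclidean_space set"
  assumes "open \<Omega>" and sub: "ball x (3 * \<rho>) \<subseteq> \<Omega>" and y: "y \<in> ball x \<rho>" and w: "w \<in> ball x \<rho>"
    and \<sigma>: "0 < \<sigma>" "oscillation_controlled c \<Omega> (ball y \<sigma>)"
  shows "\<exists>\<sigma>>0. oscillation_controlled c \<Omega> (ball w \<sigma>)"
proof -
  have "dist x y < \<rho>" using y by simp
  then have "0 < \<rho>" using zero_le_dist[of x y] by linarith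
  show ?thesis
  proof (intro exI[of _ "min \<sigma> \<rho>"] conjI)
    show "oscillation_controlled c \<Omega> (ball w (min \<sigma> \<rho>))"
    proof (rule oscillation_controlled_translate[OF \<sigma>(2) \<open>open \<Omega>\<close>, where e = "y - w"])
      fix z assume z: "z \<in> ball w (min \<sigma> \<rho>)"
      then show "z + (y - w) \<in> ball y \<sigma>" by (simp add: dist_norm algebra_simps)
      fix s :: real assume s: "0 \<le> s" "s \<le> 1"
      have "(1 - s) *\<^sub>R w + s *\<^sub>R y \<in> ball x \<rho>"
        using s y w by (intro convexD[OF convex_ball]) auto
      moreover have "z + s *\<^sub>R (y - w) = ((1 - s) *\<^sub>R w + s *\<^sub>R y) + (z - w)" by (simp add: algebra_simps)
      moreover have "norm (z - w) < \<rho>" using z by (simp add: dist_norm norm_minus_commute)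
      ultimately have "dist x (z + s *\<^sub>R (y - w)) < \<rho> + \<rho>"
        by (smt (verit, best) dist_add_cancel2 dist_norm dist_triangle add_diff_cancel_left' dist_commute mem_ball)
      then show "z + s *\<^sub>R (y - w) \<in> \<Omega>" using sub \<open>0 < \<rho>\<close> by auto
    qed auto
  qed (use \<sigma>(1) \<open>0 < \<rho>\<close> in auto)
qed

text \<open>
  By \<open>oscillation_controlled_neighbour\<close> the set of the centres of controlled balls is open and closed in the
  connected set \<open>\<Omega>\<close>. Finitely many controlled balls cover \<open>K\<close>.
\<close>

lemma oscillation_controlled_compact:
  fixes \<Omega> :: "'a::euclidean_space set"
  assumes "open \<Omega>" "connected \<Omega>" "x0 \<in> \<Omega>" "0 < \<sigma>0" "oscillation_controlled c \<Omega> (ball x0 \<sigma>0)"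
    and K: "compact K" "K \<subseteq> \<Omega>"
  shows "oscillation_controlled c \<Omega> K"
proof -
  define Q where "Q x \<longleftrightarrow> (\<exists>\<sigma>>0. oscillation_controlled c \<Omega> (ball x \<sigma>))" for x
  have nbhd: "\<exists>\<rho>>0. ball x \<rho> \<subseteq> \<Omega> \<and> (\<forall>y\<in>ball x \<rho>. \<forall>w\<in>ball x \<rho>. Q y \<longrightarrow> Q w)" if x: "x \<in> \<Omega>" for x
  proof -
    obtain r where r: "0 < r" "ball x r \<subseteq> \<Omega>" by (rule openE[OF \<open>open \<Omega>\<close> x])
    then have "ball x (3 * (r / 3)) \<subseteq> \<Omega>" by simp
    note step = oscillation_controlled_neighbour[OF \<open>open \<Omega>\<close> this]
    have Q: "Q w" if yw: "y \<in> ball x (r / 3)" "w \<in> ball x (r / 3)" and "Q y" for y w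
    proof -
      obtain \<sigma> where "0 < \<sigma>" "oscillation_controlled c \<Omega> (ball y \<sigma>)"
        using \<open>Q y\<close> unfolding Q_def by auto
      then show ?thesis unfolding Q_def by (rule step[OF yw])
    qed
    show ?thesis
    proof (intro exI[of _ "r / 3"] conjI ballI impI)
      show "0 < r / 3" "ball x (r / 3) \<subseteq> \<Omega>" using r by auto
    qed (rule Q)
  qed
  have "open {x \<in> \<Omega>. Q x}"
    unfolding open_contains_ball
  proof
    fix x assume x: "x \<in> {x \<in> \<Omega>. Q x}"
    then obtain \<rho> where "\<rho>>0" "ball x \<rho> \<subseteq> \<Omega>" "\<forall>y\<in>ball x \<rho>. \<forall>w\<in>ball x \<rho>. Q y \<longrightarrow> Q w"
      using nbhd[of x] x by blast
    moreover from this(1) have "x \<in> ball x \<rho>" by simp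
    ultimately show "\<exists>\<rho>>0. ball x \<rho> \<subseteq> {x \<in> \<Omega>. Q x}"
      using x by blast
  qed
  moreover have "open {x \<in> \<Omega>. \<not> Q x}"
    unfolding open_contains_ball
  proof
    fix x assume x: "x \<in> {x \<in> \<Omega>. \<not> Q x}"
    then obtain \<rho> where "\<rho>>0" "ball x \<rho> \<subseteq> \<Omega>" "\<forall>y\<in>ball x \<rho>. \<forall>w\<in>ball x \<rho>. Q y \<longrightarrow> Q w"
      using nbhd[of x] x by blast
    moreover from this(1) have "x \<in> ball x \<rho>" by simp
    ultimately show "\<exists>\<rho>>0. ball x \<rho> \<subseteq> {x \<in> \<Omega>. \<not> Q x}"
      using x by blast
  qed
  moreover have "x0 \<in> {x \<in> \<Omega>. Q x}" using assms by (auto simp: Q_def)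
  ultimately have "{x \<in> \<Omega>. \<not> Q x} \<inter> \<Omega> = {}"
    using connectedD[OF \<open>connected \<Omega>\<close>, of "{x \<in> \<Omega>. Q x}" "{x \<in> \<Omega>. \<not> Q x}"] by blast
  then have "\<forall>x\<in>K. \<exists>\<sigma>>0. oscillation_controlled c \<Omega> (ball x \<sigma>)" using K(2) by (auto simp: Q_def)
  then obtain \<sigma> where \<sigma>: "\<forall>x\<in>K. 0 < \<sigma> x \<and> oscillation_controlled c \<Omega> (ball x (\<sigma> x))" by metis
  have cov: "K \<subseteq> (\<Union>x\<in>K. ball x (\<sigma> x))" using \<sigma> by force
  obtain F where F: "F \<subseteq> K" "finite F" "K \<subseteq> (\<Union>x\<in>F. ball x (\<sigma> x))"
    by (rule compactE_image[OF K(1) _ cov]) auto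
  have "oscillation_controlled c \<Omega> (\<Union>x\<in>F. ball x (\<sigma> x))"
    using F \<sigma> by (intro oscillation_controlled_UN) auto
  then show ?thesis
    using F(3) by (rule oscillation_controlled_subset) (simp add: borel_compact K(1))
qed

text \<open>
  Push a neighbourhood of each boundary point inwards, along the axis of its interior cone, into a compact
  subset of \<open>\<Omega>\<close>. Finitely many such neighbourhoods and one more compact set cover \<open>\<Omega>\<close>.
\<close>

lemma poincare_L1:
  fixes \<Omega> :: "'a::euclidean_space set"
  assumes bd: "C1_holder_boundary \<gamma> \<Omega>" "0 < \<gamma>" and "open \<Omega>" "connected \<Omega>" "bounded \<Omega>" "\<Omega> \<noteq> {}"
  shows "\<exists>c. oscillation_controlled c \<Omega> \<Omega>"
proof -
  obtain x0 where "x0 \<in> \<Omega>" using \<open>\<Omega> \<noteq> {}\<close> by blast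
  then obtain \<sigma> where \<sigma>: "0 < \<sigma>" "ball x0 \<sigma> \<subseteq> \<Omega>"
    by (rule openE[OF \<open>open \<Omega>\<close>])
  then obtain c where c: "oscillation_controlled c \<Omega> (ball x0 \<sigma>)"
    using oscillation_controlled_ball \<open>open \<Omega>\<close> by blast
  note compact = oscillation_controlled_compact[OF \<open>open \<Omega>\<close> \<open>connected \<Omega>\<close> \<open>x0 \<in> \<Omega>\<close> \<sigma>(1) c]
  obtain T r N where T: "finite T" "T \<subseteq> frontier \<Omega>" "frontier \<Omega> \<subseteq> (\<Union>p\<in>T. ball p (r p / 2))"
    and N: "\<forall>p\<in>T. 0 < r p \<and> norm (N p) = 1 \<and>
       (\<forall>x\<in>closure \<Omega> \<inter> ball p (r p). \<forall>z. norm z < r p \<longrightarrow> z \<in> wide_cone (N p) (1/2) \<longrightarrow> x + z \<in> \<Omega>)"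
    using C1_boundary_finite_cover[OF bd \<open>bounded \<Omega>\<close> half_gt_zero[OF zero_less_one]] by (elim exE conjE)
  have \<Omega>c: "closure \<Omega> = \<Omega> \<union> frontier \<Omega>" using \<open>open \<Omega>\<close> by (auto simp: frontier_def interior_open closure_subset[THEN subsetD])
  have near: "oscillation_controlled c \<Omega> (\<Omega> \<inter> ball p (r p / 2))" if p: "p \<in> T" for p
  proof -
    \<comment> \<open>a translation along the axis of the cone, short enough to stay within its range \<open>r p\<close>\<close>
    define e where "e = (r p / 2) *\<^sub>R N p"
    have rp: "0 < r p" and Np: "norm (N p) = 1" using N p by auto
    have up: "x + s *\<^sub>R e \<in> \<Omega>" if "x \<in> closure \<Omega>" "x \<in> ball p (r p)" "0 < s" "s \<le> 1" for x s
    proof -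
      have "N p \<bullet> N p = 1" using Np by (simp add: dot_square_norm)
      then have "s *\<^sub>R e \<in> wide_cone (N p) (1/2)" using rp Np \<open>0 < s\<close> by (simp add: wide_cone_def e_def)
      moreover have "norm (s *\<^sub>R e) < r p"
      proof -
        have "s * (r p / 2) \<le> 1 * (r p / 2)" using \<open>s \<le> 1\<close> rp by (intro mult_right_mono) auto
        then show ?thesis using \<open>0 < s\<close> rp Np by (simp add: e_def)
      qed
      ultimately show ?thesis using N p that by blast
    qed
    define K where "K = (\<lambda>x. e + x) ` (closure \<Omega> \<inter> cball p (r p / 2))"
    have "compact K"
      unfolding K_def using \<open>bounded \<Omega>\<close>
      by (intro compact_translation compact_Int_closed) (auto simp: compact_closure)
    moreover have "K \<subseteq> \<Omega>"
    proof
      fix k assume "k \<in> K"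
      then obtain x where "k = x + 1 *\<^sub>R e" "x \<in> closure \<Omega>" "x \<in> cball p (r p / 2)"
        by (auto simp: K_def add.commute)
      then show "k \<in> \<Omega>" using up[of x 1] rp by auto
    qed
    ultimately have "oscillation_controlled c \<Omega> K" by (rule compact)
    then show ?thesis
    proof (rule oscillation_controlled_translate[OF _ \<open>open \<Omega>\<close>, where e = e])
      show "\<Omega> \<inter> ball p (r p / 2) \<in> sets borel" using \<open>open \<Omega>\<close> by auto
      fix x assume x: "x \<in> \<Omega> \<inter> ball p (r p / 2)"
      then show "x + e \<in> K" using closure_subset[of \<Omega>] by (force simp: K_def add.commute)
      fix s :: real assume "0 \<le> s" "s \<le> 1"
      then show "x + s *\<^sub>R e \<in> \<Omega>"
        using x up[of x s] rp closure_subset[of \<Omega>] by (cases "s = 0") auto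
    qed
  qed
  define K0 where "K0 = closure \<Omega> - (\<Union>p\<in>T. ball p (r p / 2))"
  have "compact K0"
    unfolding K0_def using \<open>bounded \<Omega>\<close> by (intro compact_diff) (auto simp: compact_closure)
  moreover have "K0 \<subseteq> \<Omega>" using T(3) \<Omega>c by (auto simp: K0_def)
  ultimately have "oscillation_controlled c \<Omega> K0" by (rule compact)
  then have "oscillation_controlled c \<Omega> (K0 \<union> (\<Union>p\<in>T. \<Omega> \<inter> ball p (r p / 2)))"
    by (intro oscillation_controlled_Un oscillation_controlled_UN near T)
  then have "oscillation_controlled c \<Omega> \<Omega>"
    by (rule oscillation_controlled_subset) (use \<open>open \<Omega>\<close> closure_subset[of \<Omega>] in \<open>auto simp: K0_def\<close>)
  then show ?thesis by blast
qed

section \<open>The potential estimate at a boundary point\<close>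

text \<open>
  For \<open>z\<close> in the cone and the unit ball, \<open>\<bar>u x\<bar>\<close> is at most \<open>\<bar>u (x + R z)\<bar>\<close> plus the integral of the gradient
  along the segment from \<open>x\<close> to \<open>x + R z\<close>. The average of the latter over \<open>z\<close> is a potential by \<open>polar_cone\<close>,
  and that of the former is at most a multiple of the norm of \<open>u\<close> in \<open>L\<^sup>1\<close>. Note that \<open>n * \<kappa>\<close> is the area of
  the set of directions of the cone.
\<close>

lemma cone_average_estimate:
  fixes u :: "'a::euclidean_space \<Rightarrow> real" and R \<kappa> :: real
  assumes u: "C1_pair \<Omega> u G" and "open \<Omega>" and x: "x \<in> closure \<Omega>" and R: "0 < R"
    and cone: "\<And>z. norm z < R \<Longrightarrow> z \<in> wide_cone N e \<Longrightarrow> x + z \<in> \<Omega>"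
    and \<kappa>: "\<kappa> = measure lborel (wide_cone N e \<inter> ball 0 1)" "0 < \<kappa>"
  shows "ennreal \<bar>u x\<bar> \<le>
    ennreal (1 / (DIM('a) * \<kappa>)) * (\<integral>\<^sup>+y. indicator (wide_cone N e \<inter> ball 0 R) y *
        (ennreal (norm (G (x + y))) * ennreal (1 / norm y ^ (DIM('a) - 1))) \<partial>lborel)
    + ennreal (1 / (\<kappa> * R ^ DIM('a))) * (\<integral>\<^sup>+y. indicator \<Omega> y * ennreal \<bar>u y\<bar> \<partial>lborel)"
proof -
  let ?K = "wide_cone N e" and ?n = "DIM('a)"
  have [measurable]: "\<Omega> \<in> sets borel" "ball 0 R \<in> sets (borel :: 'a measure)" "ball 0 1 \<in> sets (borel :: 'a measure)"
    using \<open>open \<Omega>\<close> by auto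
  have [measurable]: "u \<in> borel_measurable borel" "G \<in> borel_measurable borel"
    using u by (auto simp: C1_pair_def)
  define w where "w y = indicator (ball 0 R) y * ennreal (norm (G (x + y)))" for y
  have [measurable]: "w \<in> borel_measurable borel" unfolding w_def by measurable
  define A where "A = (\<integral>\<^sup>+z. indicator (?K \<inter> ball 0 1) z *
             (\<integral>\<^sup>+s. indicator {0<..} s * (w (s *\<^sub>R z) * ennreal (norm z)) \<partial>lborel) \<partial>lborel)"
  define B where "B = (\<integral>\<^sup>+z. indicator \<Omega> (x + R *\<^sub>R z) * ennreal \<bar>u (x + R *\<^sub>R z)\<bar> \<partial>lborel)"
  have pointwise: "indicator (?K \<inter> ball 0 1) z * ennreal \<bar>u x\<bar>
     \<le> indicator (?K \<inter> ball 0 1) z * (\<integral>\<^sup>+s. indicator {0<..} s * (w (s *\<^sub>R z) * ennreal (norm z)) \<partial>lborel)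
       + indicator \<Omega> (x + R *\<^sub>R z) * ennreal \<bar>u (x + R *\<^sub>R z)\<bar>" for z
  proof (cases "z \<in> ?K \<inter> ball 0 1")
    case True
    have inR: "s * norm z < R" if "0 < s" "s \<le> R" for s
    proof -
      have "s * norm z < s * 1" using that True by (intro mult_strict_left_mono) auto
      also have "s * 1 \<le> R" using that by simp
      finally show ?thesis .
    qed
    have in\<Omega>: "x + s *\<^sub>R z \<in> \<Omega>" if "0 < s" "s \<le> R" for s
      using that True inR[OF that] by (intro cone scaleR_wide_cone) auto
    have "ennreal \<bar>u (x + R *\<^sub>R z) - u x\<bar>
       \<le> (\<integral>\<^sup>+s. indicator {0<..<R} s * ennreal (norm (G (x + s *\<^sub>R z)) * norm z) \<partial>lborel)"
    proof (rule ray_estimate[OF u])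
      fix s assume s: "0 \<le> s" "s \<le> R"
      show "x + s *\<^sub>R z \<in> closure \<Omega>"
        using x s in\<Omega>[of s] closure_subset[of \<Omega>] by (cases "s = 0") auto
    qed (use R in\<Omega> in auto)
    also have "\<dots> \<le> (\<integral>\<^sup>+s. indicator {0<..} s * (w (s *\<^sub>R z) * ennreal (norm z)) \<partial>lborel)"
      using inR by (intro nn_integral_mono) (auto simp: indicator_def w_def ennreal_mult)
    finally have "ennreal \<bar>u (x + R *\<^sub>R z) - u x\<bar>
       \<le> (\<integral>\<^sup>+s. indicator {0<..} s * (w (s *\<^sub>R z) * ennreal (norm z)) \<partial>lborel)" .
    moreover have "ennreal \<bar>u x\<bar> \<le> ennreal \<bar>u (x + R *\<^sub>R z) - u x\<bar> + ennreal \<bar>u (x + R *\<^sub>R z)\<bar>"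
    proof -
      have "ennreal \<bar>u x\<bar> \<le> ennreal (\<bar>u (x + R *\<^sub>R z) - u x\<bar> + \<bar>u (x + R *\<^sub>R z)\<bar>)"
        by (rule ennreal_leI) linarith
      then show ?thesis by simp
    qed
    ultimately show ?thesis
      using True in\<Omega>[of R] R by (simp add: add_right_mono order_trans)
  qed simp
  have "ennreal \<kappa> * ennreal \<bar>u x\<bar> = (\<integral>\<^sup>+z. indicator (?K \<inter> ball 0 1) z * ennreal \<bar>u x\<bar> \<partial>lborel)"
    unfolding \<kappa>(1) emeasure_wide_cone_ball[symmetric] by (subst nn_integral_multc) auto
  also have "\<dots> \<le> (\<integral>\<^sup>+z. indicator (?K \<inter> ball 0 1) z *
             (\<integral>\<^sup>+s. indicator {0<..} s * (w (s *\<^sub>R z) * ennreal (norm z)) \<partial>lborel)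
       + indicator \<Omega> (x + R *\<^sub>R z) * ennreal \<bar>u (x + R *\<^sub>R z)\<bar> \<partial>lborel)"
    by (intro nn_integral_mono pointwise)
  also have "\<dots> = A + B"
    unfolding A_def B_def by (rule nn_integral_add) measurable
  finally have main: "ennreal \<kappa> * ennreal \<bar>u x\<bar> \<le> A + B" .
  have A: "A = ennreal (1 / ?n) * (\<integral>\<^sup>+y. indicator ?K y * (w y * ennreal (1 / norm y ^ (?n - 1))) \<partial>lborel)"
    unfolding A_def by (rule polar_cone) (auto intro: scaleR_wide_cone)
  have B: "(\<integral>\<^sup>+y. indicator \<Omega> y * ennreal \<bar>u y\<bar> \<partial>lborel) = ennreal (R ^ ?n) * B"
    unfolding B_def using R by (subst nn_integral_lborel_affine[of _ R x]) auto
  have "ennreal \<bar>u x\<bar> = ennreal (1 / \<kappa>) * (ennreal \<kappa> * ennreal \<bar>u x\<bar>)"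
    using \<kappa>(2) by (simp add: mult.assoc[symmetric] ennreal_mult[symmetric])
  also have "\<dots> \<le> ennreal (1 / \<kappa>) * (A + B)" using main by (rule mult_left_mono) simp
  also have "\<dots> = ennreal (1 / \<kappa>) * A + ennreal (1 / \<kappa>) * B" by (simp add: distrib_left)
  also have "ennreal (1 / \<kappa>) * A = ennreal (1 / (?n * \<kappa>)) *
      (\<integral>\<^sup>+y. indicator ?K y * (w y * ennreal (1 / norm y ^ (?n - 1))) \<partial>lborel)"
    using \<kappa>(2) unfolding A by (simp add: mult.assoc[symmetric] ennreal_mult[symmetric] mult.commute)
  also have "(\<integral>\<^sup>+y. indicator ?K y * (w y * ennreal (1 / norm y ^ (?n - 1))) \<partial>lborel)
     = (\<integral>\<^sup>+y. indicator (?K \<inter> ball 0 R) y * (ennreal (norm (G (x + y))) * ennreal (1 / norm y ^ (?n - 1))) \<partial>lborel)"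
    by (intro nn_integral_cong) (auto simp: w_def indicator_def)
  also have "ennreal (1 / \<kappa>) * B = ennreal (1 / (\<kappa> * R ^ ?n)) * (ennreal (R ^ ?n) * B)"
    using \<kappa>(2) R by (simp add: mult.assoc[symmetric] ennreal_mult[symmetric])
  finally show ?thesis unfolding B .
qed

section \<open>The two parts of the potential\<close>

text \<open>
  Young's inequality for \<open>\<tau> * a\<close> and \<open>b / \<tau>\<close>, where \<open>A\<close> is the \<open>n\<close>-th power of \<open>\<tau>\<close>. The weight \<open>A\<close> is to be
  optimised, which makes this a substitute for Hoelder's inequality.
\<close>

lemma young_weighted:
  fixes a b A :: real
  assumes n: "2 \<le> (n::nat)" and "0 \<le> a" "0 \<le> b" "0 < A"
  shows "a * b \<le> A / n * a ^ n + (real n - 1) / n * A powr (- 1 / (real n - 1)) * b powr (real n / (real n - 1))"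
proof -
  define q where "q = real n / (real n - 1)"
  define \<tau> where "\<tau> = A powr (1 / n)"
  have \<tau>: "0 < \<tau>" "\<tau> powr n = A" using n \<open>0 < A\<close> by (auto simp: \<tau>_def powr_powr)
  have q: "1 < q" "1 / real n + 1 / q = 1" using n by (auto simp: q_def field_simps)
  have "a * b = (\<tau> * a) * (b / \<tau>)" using \<tau> by simp
  also have "\<dots> \<le> (\<tau> * a) powr n / n + (b / \<tau>) powr q / q"
    using n q assms \<tau> by (intro Youngs_inequality) auto
  also have "(\<tau> * a) powr n = A * a ^ n"
    using \<tau> n \<open>0 \<le> a\<close> by (simp add: powr_mult powr_realpow' )
  also have "(b / \<tau>) powr q = A powr (- 1 / (real n - 1)) * b powr q"
  proof -
    have "\<tau> powr q = A powr (1 / (real n - 1))" using n by (simp add: \<tau>_def powr_powr q_def)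
    then show ?thesis using \<open>0 \<le> b\<close> \<tau> by (simp add: powr_divide powr_minus_divide)
  qed
  also have "A powr (- 1 / (real n - 1)) * b powr q / q = (real n - 1) / n * A powr (- 1 / (real n - 1)) * b powr q"
    using n by (simp add: q_def)
  finally show ?thesis by (simp add: q_def)
qed

lemma nn_integral_inverse_Icc:
  assumes "0 < a" "a \<le> b"
  shows "(\<integral>\<^sup>+s. indicator {a..b} s * ennreal (1 / s) \<partial>lborel) = ennreal (ln (b / a))"
proof -
  have "(\<integral>\<^sup>+s. ennreal (1 / s) * indicator {a..b} s \<partial>lborel) = ennreal (ln b - ln a)"
    using assms by (intro nn_integral_FTC_Icc) (auto intro!: derivative_eq_intros)
  then show ?thesis using assms by (simp add: ln_div mult.commute)
qed

text \<open>
  In polar coordinates this is the integral of \<open>1 / s\<close> over \<open>r \<le> s < R\<close>, times the area of the set of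
  directions.
\<close>

lemma cone_shell_integral_le:
  fixes N :: "'a::euclidean_space"
  assumes r: "0 < r" "r \<le> R"
  shows "(\<integral>\<^sup>+y. indicator (wide_cone N e \<inter> (ball 0 R - ball 0 r)) y * ennreal (1 / norm y ^ DIM('a)) \<partial>lborel)
    \<le> ennreal (DIM('a) * measure lborel (wide_cone N e \<inter> ball 0 1) * ln (R / r))"
proof -
  let ?K = "wide_cone N e" and ?n = "DIM('a)"
  define \<kappa> where "\<kappa> = measure lborel (?K \<inter> ball 0 1)"
  have [measurable]: "ball 0 t \<in> sets (borel :: 'a measure)" for t by simp
  define w where "w y = indicator (ball 0 R - ball 0 r) y * ennreal (1 / norm y)" for y :: 'a
  have [measurable]: "w \<in> borel_measurable borel" unfolding w_def by measurable
  let ?I = "\<integral>\<^sup>+y. indicator ?K y * (w y * ennreal (1 / norm y ^ (?n - 1))) \<partial>lborel"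
  have "ennreal (1 / ?n) * ?I = (\<integral>\<^sup>+z. indicator (?K \<inter> ball 0 1) z *
             (\<integral>\<^sup>+s. indicator {0<..} s * (w (s *\<^sub>R z) * ennreal (norm z)) \<partial>lborel) \<partial>lborel)"
    by (rule polar_cone[symmetric]) (auto intro: scaleR_wide_cone)
  also have "\<dots> \<le> (\<integral>\<^sup>+z. indicator (?K \<inter> ball 0 1) z * ennreal (ln (R / r)) \<partial>lborel)"
  proof (rule nn_integral_mono)
    fix z :: 'a
    show "indicator (?K \<inter> ball 0 1) z * (\<integral>\<^sup>+s. indicator {0<..} s * (w (s *\<^sub>R z) * ennreal (norm z)) \<partial>lborel)
        \<le> indicator (?K \<inter> ball 0 1) z * ennreal (ln (R / r))"
    proof (cases "z \<in> ?K \<inter> ball 0 1")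
      case True
      then have z: "0 < norm z" by auto
      have "(\<integral>\<^sup>+s. indicator {0<..} s * (w (s *\<^sub>R z) * ennreal (norm z)) \<partial>lborel)
         \<le> (\<integral>\<^sup>+s. indicator {r / norm z..R / norm z} s * ennreal (1 / s) \<partial>lborel)"
      proof (rule nn_integral_mono)
        fix s :: real
        show "indicator {0<..} s * (w (s *\<^sub>R z) * ennreal (norm z)) \<le> indicator {r / norm z..R / norm z} s * ennreal (1 / s)"
          using z by (auto simp: indicator_def w_def ennreal_mult[symmetric] field_simps)
      qed
      also have "\<dots> = ennreal (ln ((R / norm z) / (r / norm z)))"
        using z r by (intro nn_integral_inverse_Icc) (auto simp: divide_right_mono)
      also have "(R / norm z) / (r / norm z) = R / r" using z by simp
      finally show ?thesis using True by simp
    qed simp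
  qed
  also have "\<dots> = ennreal \<kappa> * ennreal (ln (R / r))"
    unfolding \<kappa>_def emeasure_wide_cone_ball[symmetric] by (subst nn_integral_multc) auto
  finally have le: "ennreal (1 / ?n) * ?I \<le> ennreal \<kappa> * ennreal (ln (R / r))" .
  have "(\<integral>\<^sup>+y. indicator (?K \<inter> (ball 0 R - ball 0 r)) y * ennreal (1 / norm y ^ ?n) \<partial>lborel) = ?I"
  proof (rule nn_integral_cong)
    fix y :: 'a
    have "norm y ^ ?n = norm y * norm y ^ (?n - 1)"
      by (metis DIM_positive Suc_diff_1 power_Suc)
    then have "ennreal (1 / norm y) * ennreal (1 / norm y ^ (?n - 1)) = ennreal (1 / norm y ^ ?n)"
      by (simp add: ennreal_mult[symmetric])
    then show "indicator (?K \<inter> (ball 0 R - ball 0 r)) y * ennreal (1 / norm y ^ ?n)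
       = indicator ?K y * (w y * ennreal (1 / norm y ^ (?n - 1)))"
      by (auto simp: w_def indicator_def)
  qed
  also have "?I = ennreal ?n * (ennreal (1 / ?n) * ?I)"
    by (simp add: mult.assoc[symmetric] ennreal_mult[symmetric] ennreal_of_nat_eq_real_of_nat)
  also have "\<dots> \<le> ennreal ?n * (ennreal \<kappa> * ennreal (ln (R / r)))"
    using le by (rule mult_left_mono) simp
  also have "\<dots> = ennreal (?n * \<kappa> * ln (R / r))"
    using r by (simp add: \<kappa>_def ennreal_mult[symmetric] mult.assoc)
  finally show ?thesis by (simp add: \<kappa>_def)
qed

text \<open>
  Hoelder's inequality with exponents \<open>n\<close> and \<open>n / (n - 1)\<close>. The kernel to the power \<open>n / (n - 1)\<close> is
  \<open>1 / \<bar>y\<bar> ^ n\<close>, whose integral over the shell is at most \<open>S * ln (R / r)\<close>. This is the one estimate in which the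
  constant must be sharp.
\<close>

lemma far_potential_le:
  fixes N :: "'a::euclidean_space" and g :: "'a \<Rightarrow> real"
  assumes n: "2 \<le> DIM('a)" and [measurable]: "g \<in> borel_measurable borel" and g0: "\<And>y. 0 \<le> g y"
    and g1: "(\<integral>\<^sup>+y. ennreal (g y ^ DIM('a)) \<partial>lborel) \<le> 1"
    and r: "0 < r" "r < R"
    and S: "S = DIM('a) * measure lborel (wide_cone N e \<inter> ball 0 1)" "0 < S"
  shows "(\<integral>\<^sup>+y. indicator (wide_cone N e \<inter> (ball 0 R - ball 0 r)) y *
           (ennreal (g y) * ennreal (1 / norm y ^ (DIM('a) - 1))) \<partial>lborel)
    \<le> ennreal ((S * ln (R / r)) powr ((real DIM('a) - 1) / DIM('a)))"
proof -
  let ?K = "wide_cone N e" and ?n = "DIM('a)"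
  let ?D = "?K \<inter> (ball 0 R - ball 0 r)"
  define L where "L = S * ln (R / r)"
  have L: "0 < L" using r S by (auto simp: L_def)
  \<comment> \<open>the weight that minimises the bound given by Young's inequality\<close>
  define A where "A = L powr ((real ?n - 1) / ?n)"
  have A: "0 < A" using L by (simp add: A_def)
  have [measurable]: "?D \<in> sets borel" by simp
  define c where "c = (real ?n - 1) / ?n * A powr (- 1 / (real ?n - 1))"
  have c: "0 \<le> c" using n by (simp add: c_def)
  have "(\<integral>\<^sup>+y. indicator ?D y * (ennreal (g y) * ennreal (1 / norm y ^ (?n - 1))) \<partial>lborel)
     \<le> (\<integral>\<^sup>+y. ennreal (A / ?n) * ennreal (g y ^ ?n) + ennreal c * (indicator ?D y * ennreal (1 / norm y ^ ?n)) \<partial>lborel)"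
  proof (rule nn_integral_mono)
    fix y :: 'a
    show "indicator ?D y * (ennreal (g y) * ennreal (1 / norm y ^ (?n - 1)))
      \<le> ennreal (A / ?n) * ennreal (g y ^ ?n) + ennreal c * (indicator ?D y * ennreal (1 / norm y ^ ?n))"
    proof (cases "y \<in> ?D")
      case True
      then have y: "0 < norm y" by auto
      have "g y * (1 / norm y ^ (?n - 1)) \<le> A / ?n * g y ^ ?n + c * (1 / norm y ^ (?n - 1)) powr (real ?n / (real ?n - 1))"
        unfolding c_def by (rule young_weighted[OF n g0 _ A]) simp
      also have "(1 / norm y ^ (?n - 1)) powr (real ?n / (real ?n - 1)) = 1 / norm y ^ ?n"
      proof -
        have "1 / norm y ^ (?n - 1) = norm y powr (- (real ?n - 1))"
          using y n by (subst powr_minus_divide) (simp add: powr_realpow[symmetric] of_nat_diff)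
        moreover have "- (real ?n - 1) * (real ?n / (real ?n - 1)) = - real ?n"
          using n nonzero_mult_div_cancel_left[of "real ?n - 1" "real ?n"] by (simp only: mult_minus_left times_divide_eq_right) simp
        ultimately have "(1 / norm y ^ (?n - 1)) powr (real ?n / (real ?n - 1)) = norm y powr (- real ?n)"
          by (simp only: powr_powr)
        then show ?thesis using y by (simp add: powr_minus_divide powr_realpow)
      qed
      finally have "ennreal (g y * (1 / norm y ^ (?n - 1))) \<le> ennreal (A / ?n * g y ^ ?n + c * (1 / norm y ^ ?n))"
        by (rule ennreal_leI)
      moreover have "ennreal (g y * (1 / norm y ^ (?n - 1))) = ennreal (g y) * ennreal (1 / norm y ^ (?n - 1))"
        by (rule ennreal_mult) (simp_all add: g0)
      moreover have "ennreal (A / ?n * g y ^ ?n + c * (1 / norm y ^ ?n))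
          = ennreal (A / ?n) * ennreal (g y ^ ?n) + ennreal c * ennreal (1 / norm y ^ ?n)"
        using g0[of y] A c by (subst ennreal_plus) (auto simp: ennreal_mult[symmetric])
      ultimately show ?thesis using True by simp
    qed simp
  qed
  also have "\<dots> = ennreal (A / ?n) * (\<integral>\<^sup>+y. ennreal (g y ^ ?n) \<partial>lborel)
      + ennreal c * (\<integral>\<^sup>+y. indicator ?D y * ennreal (1 / norm y ^ ?n) \<partial>lborel)"
    by (simp add: nn_integral_add nn_integral_cmult)
  also have "\<dots> \<le> ennreal (A / ?n) * 1 + ennreal c * ennreal L"
    using cone_shell_integral_le[of r R N e] r S(1)
    by (intro add_mono mult_left_mono g1) (auto simp: L_def mult.assoc)
  also have "\<dots> = ennreal (A / ?n + c * L)"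
    using A c L by (simp add: ennreal_mult[symmetric])
  also have "A / ?n + c * L = A"
  proof -
    have "A powr (- 1 / (real ?n - 1)) * L = L powr (- 1 / ?n) * L powr 1"
      using L n by (simp add: A_def powr_powr)
    also have "\<dots> = L powr (- 1 / ?n + 1)" by (simp only: powr_add)
    also have "- 1 / ?n + 1 = (real ?n - 1) / ?n" using n by (simp add: field_simps)
    finally have "A powr (- 1 / (real ?n - 1)) * L = A" by (simp add: A_def)
    then have "c * L = (real ?n - 1) / ?n * A" by (simp add: c_def)
    then show ?thesis using n by (simp add: field_simps)
  qed
  finally show ?thesis by (simp add: A_def L_def)
qed

text \<open>
  Young's inequality after splitting the kernel as
  \<open>\<bar>y\<bar> powr (- (n - 1) / (2 * n)) * \<bar>y\<bar> powr (- (n - 1) * (1 - 1 / (2 * n)))\<close>. The first factor goes with \<open>g\<close>, its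
  \<open>n\<close>-th power being the kernel on the right-hand side, which is integrable against surface measure. The second
  one, to the power \<open>n / (n - 1)\<close>, is \<open>\<bar>y\<bar> powr - (n - 1/2)\<close>, which is integrable near 0.
\<close>

lemma near_potential_le:
  fixes g :: "'a::euclidean_space \<Rightarrow> real"
  assumes n: "2 \<le> DIM('a)" and [measurable]: "g \<in> borel_measurable borel" and g0: "\<And>y. 0 \<le> g y"
    and r: "0 < r" and A: "0 < A"
    and H: "H = unit_ball_vol (DIM('a)) * 2 powr (real DIM('a) - 1/2) / (1 - 2 powr (- 1/2))"
  shows "(\<integral>\<^sup>+y. indicator (ball 0 r) y * (ennreal (g y) * ennreal (1 / norm y ^ (DIM('a) - 1))) \<partial>lborel)
    \<le> ennreal A * (\<integral>\<^sup>+y. indicator (ball 0 r) y * (ennreal (g y ^ DIM('a)) * ennreal (norm y powr (- ((real DIM('a) - 1) / 2)))) \<partial>lborel)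
      + ennreal (A powr (- 1 / (real DIM('a) - 1)) * H * r powr (1/2))"
proof -
  let ?n = "DIM('a)"
  have [measurable]: "ball 0 r \<in> sets (borel :: 'a measure)" by simp
  let ?a = "real ?n - 1/2"
  define c where "c = (real ?n - 1) / ?n * A powr (- 1 / (real ?n - 1))"
  have c: "0 \<le> c" using n by (simp add: c_def)
  have cA: "c \<le> A powr (- 1 / (real ?n - 1))"
    unfolding c_def by (rule mult_left_le_one_le) (use n in \<open>auto simp: field_simps\<close>)
  have H0: "0 \<le> H" unfolding H using powr_less_one[of 2 "- 1 / 2"] by (intro divide_nonneg_nonneg mult_nonneg_nonneg) auto
  have "(\<integral>\<^sup>+y. indicator (ball 0 r) y * (ennreal (g y) * ennreal (1 / norm y ^ (?n - 1))) \<partial>lborel)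
     \<le> (\<integral>\<^sup>+y. ennreal A * (indicator (ball 0 r) y * (ennreal (g y ^ ?n) * ennreal (norm y powr (- ((real ?n - 1) / 2)))))
          + ennreal c * (indicator (ball (0::'a) r) y * ennreal (dist y 0 powr - ?a)) \<partial>lborel)"
  proof (rule nn_integral_mono)
    fix y :: 'a
    show "indicator (ball 0 r) y * (ennreal (g y) * ennreal (1 / norm y ^ (?n - 1)))
      \<le> ennreal A * (indicator (ball 0 r) y * (ennreal (g y ^ ?n) * ennreal (norm y powr (- ((real ?n - 1) / 2)))))
          + ennreal c * (indicator (ball (0::'a) r) y * ennreal (dist y 0 powr - ?a))"
    proof (cases "y \<in> ball 0 r \<and> y \<noteq> 0")
      case True
      then have y: "0 < norm y" by auto
      define d where "d = norm y"
      let ?p = "- (real ?n - 1) / (2 * ?n)" and ?q = "- (real ?n - 1) + (real ?n - 1) / (2 * ?n)"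
      have split: "1 / d ^ (?n - 1) = d powr ?p * d powr ?q"
      proof -
        have "- a / b + (- a + a / b) = - a" for a b :: real by (simp add: divide_inverse)
        then have "d powr ?p * d powr ?q = d powr (- (real ?n - 1))" by (simp only: powr_add[symmetric])
        also have "\<dots> = 1 / d ^ (?n - 1)"
          using y n by (subst powr_minus_divide) (simp add: powr_realpow[symmetric] of_nat_diff d_def)
        finally show ?thesis by simp
      qed
      have pn: "(d powr ?p) ^ ?n = d powr (- ((real ?n - 1) / 2))"
      proof -
        have "(d powr ?p) ^ ?n = (d powr ?p) powr real ?n" using y by (simp add: powr_realpow d_def)
        also have "\<dots> = d powr (?p * real ?n)" by (rule powr_powr)
        also have "?p * real ?n = - ((real ?n - 1) / 2)"
        proof -
          have gen: "- a / (2 * b) * b = - (a / 2)" if "b \<noteq> 0" for a b :: real using that by simp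
          show ?thesis unfolding of_nat_mult of_nat_numeral by (rule gen) (use n in simp)
        qed
        finally show ?thesis .
      qed
      have qn: "(d powr ?q) powr (real ?n / (real ?n - 1)) = d powr - ?a"
      proof -
        have "?q * (real ?n / (real ?n - 1)) = - ?a"
        proof -
          have "?q = (real ?n - 1) * (1 / (2 * real ?n) - 1)" by (simp add: algebra_simps)
          then have "?q * (real ?n / (real ?n - 1)) = (1 / (2 * real ?n) - 1) * real ?n" using n by simp
          also have "\<dots> = - ?a" using n by (simp add: algebra_simps)
          finally show ?thesis .
        qed
        then show ?thesis by (simp only: powr_powr)
      qed
      have "g y * (1 / d ^ (?n - 1)) = (g y * d powr ?p) * d powr ?q" by (simp only: split mult.assoc)
      also have "\<dots> \<le> A / ?n * (g y * d powr ?p) ^ ?n + c * (d powr ?q) powr (real ?n / (real ?n - 1))"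
        unfolding c_def by (rule young_weighted[OF n _ _ A]) (simp_all add: g0)
      also have "\<dots> = A / ?n * (g y ^ ?n * d powr (- ((real ?n - 1) / 2))) + c * d powr - ?a"
        by (simp only: power_mult_distrib pn qn)
      also have "\<dots> \<le> A * (g y ^ ?n * d powr (- ((real ?n - 1) / 2))) + c * d powr - ?a"
        using A n g0[of y] by (intro add_right_mono mult_right_mono) (auto simp: field_simps)
      finally have "ennreal (g y * (1 / d ^ (?n - 1))) \<le> ennreal (A * (g y ^ ?n * d powr (- ((real ?n - 1) / 2))) + c * d powr - ?a)"
        by (rule ennreal_leI)
      moreover have "ennreal (g y * (1 / d ^ (?n - 1))) = ennreal (g y) * ennreal (1 / norm y ^ (?n - 1))"
        unfolding d_def by (rule ennreal_mult) (simp_all add: g0)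
      moreover have "ennreal (A * (g y ^ ?n * d powr (- ((real ?n - 1) / 2))) + c * d powr - ?a)
          = ennreal A * (ennreal (g y ^ ?n) * ennreal (norm y powr (- ((real ?n - 1) / 2)))) + ennreal c * ennreal (dist y 0 powr - ?a)"
        using g0[of y] A c
        by (subst ennreal_plus) (auto simp: d_def ennreal_mult[symmetric])
      ultimately show ?thesis using True by simp
    qed (use n in auto)
  qed
  also have "\<dots> = ennreal A * (\<integral>\<^sup>+y. indicator (ball 0 r) y * (ennreal (g y ^ ?n) * ennreal (norm y powr (- ((real ?n - 1) / 2)))) \<partial>lborel)
      + ennreal c * (\<integral>\<^sup>+y. indicator (ball (0::'a) r) y * ennreal (dist y 0 powr - ?a) \<partial>lborel)"
    by (simp add: nn_integral_add nn_integral_cmult)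
  also have "\<dots> \<le> ennreal A * (\<integral>\<^sup>+y. indicator (ball 0 r) y * (ennreal (g y ^ ?n) * ennreal (norm y powr (- ((real ?n - 1) / 2)))) \<partial>lborel)
      + ennreal (A powr (- 1 / (real ?n - 1))) * ennreal (H * r powr (1/2))"
  proof (intro add_left_mono mult_mono ennreal_leI cA)
    have "(\<integral>\<^sup>+y. indicator (ball (0::'a) r) y * ennreal (dist y 0 powr - ?a) \<partial>lborel)
       \<le> ennreal (unit_ball_vol ?n * 2 powr ?a / (1 - 2 powr (?a - real ?n)) * r powr (real ?n - ?a))"
      by (rule nn_integral_singular_kernel_le) (use n r in \<open>auto simp: emeasure_ball powr_realpow\<close>)
    then show "(\<integral>\<^sup>+y. indicator (ball (0::'a) r) y * ennreal (dist y 0 powr - ?a) \<partial>lborel) \<le> ennreal (H * r powr (1/2))"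
      by (simp add: H)
  qed auto
  also have "ennreal (A powr (- 1 / (real ?n - 1))) * ennreal (H * r powr (1/2)) = ennreal (A powr (- 1 / (real ?n - 1)) * H * r powr (1/2))"
    using H0 by (simp add: ennreal_mult[symmetric] mult.assoc)
  finally show ?thesis .
qed

text \<open>
  Exchange the integrals. The singularity has order \<open>(n - 1) / 2\<close>, less than the dimension \<open>n - 1\<close> of \<open>\<mu>\<close>.
\<close>

lemma trace_kernel_integral_le:
  fixes \<mu> :: "'a::euclidean_space measure" and g :: "'a \<Rightarrow> real"
  assumes n: "2 \<le> DIM('a)" and fin: "finite_measure \<mu>" and sets[measurable_cong]: "sets \<mu> = sets borel"
    and reg: "\<And>y \<rho>. 0 < \<rho> \<Longrightarrow> emeasure \<mu> (ball y \<rho>) \<le> ennreal (C * \<rho> ^ (DIM('a) - 1))" and C: "0 \<le> C"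
    and [measurable]: "g \<in> borel_measurable borel" and g0: "\<And>y. 0 \<le> g y"
    and g1: "(\<integral>\<^sup>+y. ennreal (g y ^ DIM('a)) \<partial>lborel) \<le> 1" and r: "0 < r"
    and H: "H = C * 2 powr ((real DIM('a) - 1) / 2) / (1 - 2 powr (- ((real DIM('a) - 1) / 2)))"
  shows "(\<integral>\<^sup>+x. \<integral>\<^sup>+y. indicator (ball 0 r) y * (ennreal (g (x + y) ^ DIM('a)) * ennreal (norm y powr (- ((real DIM('a) - 1) / 2)))) \<partial>lborel \<partial>\<mu>)
     \<le> ennreal (H * r powr ((real DIM('a) - 1) / 2))"
proof -
  let ?n = "DIM('a)"
  let ?a = "(real ?n - 1) / 2"
  interpret finite_measure \<mu> by fact
  interpret pair_sigma_finite \<mu> lborel ..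
  define k where "k x y = (if norm (y - x) < r then ennreal (norm (y - x) powr - ?a) else 0)" for x y :: 'a
  have [measurable]: "(\<lambda>p. k (fst p) (snd p)) \<in> borel_measurable (borel \<Otimes>\<^sub>M borel)"
    unfolding k_def by measurable
  have "(\<integral>\<^sup>+x. \<integral>\<^sup>+y. indicator (ball 0 r) y * (ennreal (g (x + y) ^ ?n) * ennreal (norm y powr (- ((real ?n - 1) / 2)))) \<partial>lborel \<partial>\<mu>)
     = (\<integral>\<^sup>+x. \<integral>\<^sup>+y. ennreal (g (x + y) ^ ?n) * k x (x + y) \<partial>lborel \<partial>\<mu>)"
    by (intro nn_integral_cong) (simp add: k_def indicator_def mult_ac)
  also have "\<dots> = (\<integral>\<^sup>+x. \<integral>\<^sup>+y. ennreal (g y ^ ?n) * k x y \<partial>lborel \<partial>\<mu>)"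
    unfolding k_def by (intro nn_integral_cong nn_integral_lborel_translate) measurable
  also have "\<dots> = (\<integral>\<^sup>+y. \<integral>\<^sup>+x. ennreal (g y ^ ?n) * k x y \<partial>\<mu> \<partial>lborel)"
    unfolding k_def by (rule Fubini'[symmetric]) measurable
  also have "\<dots> = (\<integral>\<^sup>+y. ennreal (g y ^ ?n) * (\<integral>\<^sup>+x. k x y \<partial>\<mu>) \<partial>lborel)"
    unfolding k_def by (intro nn_integral_cong nn_integral_cmult) measurable
  also have "\<dots> \<le> (\<integral>\<^sup>+y. ennreal (g y ^ ?n) * ennreal (H * r powr ?a) \<partial>lborel)"
  proof (intro nn_integral_mono mult_left_mono)
    fix y :: 'a
    have "(\<integral>\<^sup>+x. k x y \<partial>\<mu>) = (\<integral>\<^sup>+x. indicator (ball y r) x * ennreal (dist x y powr - ?a) \<partial>\<mu>)"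
      by (intro nn_integral_cong) (simp add: k_def indicator_def dist_norm norm_minus_commute)
    also have "\<dots> \<le> ennreal (C * 2 powr ?a / (1 - 2 powr (?a - (real ?n - 1))) * r powr ((real ?n - 1) - ?a))"
    proof (rule nn_integral_singular_kernel_le[OF sets _ C])
      show "emeasure \<mu> (ball y \<rho>) \<le> ennreal (C * \<rho> powr (real ?n - 1))" if "0 < \<rho>" for \<rho>
        using reg[OF that, of y] that n by (simp add: powr_realpow[symmetric] of_nat_diff)
    qed (use n r in auto)
    also have "?a - (real ?n - 1) = - ?a"
    proof -
      have "m / 2 - m = - (m / 2)" for m :: real by simp
      then show ?thesis .
    qed
    also have "(real ?n - 1) - ?a = ?a"
    proof -
      have "m - m / 2 = m / 2" for m :: real by simp
      then show ?thesis .
    qed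
    finally show "(\<integral>\<^sup>+x. k x y \<partial>\<mu>) \<le> ennreal (H * r powr ?a)" by (simp add: H)
  qed simp
  also have "\<dots> = (\<integral>\<^sup>+y. ennreal (g y ^ ?n) \<partial>lborel) * ennreal (H * r powr ?a)"
    by (rule nn_integral_multc) measurable
  also have "\<dots> \<le> 1 * ennreal (H * r powr ?a)" by (intro mult_right_mono g1) simp
  finally show ?thesis by simp
qed

section \<open>Level sets of the trace\<close>

text \<open>
  Sum over the sets where \<open>k \<le> g x < k + 1\<close>. For \<open>k < k0\<close> the total mass is used instead of the tail bound.
\<close>

lemma exp_integral_le_of_tail:
  fixes g :: "'a \<Rightarrow> real" and \<alpha> \<beta> D :: real
  assumes fin: "finite_measure \<mu>" and [measurable]: "g \<in> borel_measurable \<mu>" and g0: "\<And>x. 0 \<le> g x"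
    and tail: "\<And>k::nat. k0 \<le> k \<Longrightarrow> emeasure \<mu> {x \<in> space \<mu>. real k \<le> g x} \<le> ennreal (D * exp (- \<beta> * k))"
    and D: "0 \<le> D" and \<alpha>: "0 < \<alpha>" "\<alpha> < \<beta>"
  shows "(\<integral>\<^sup>+x. ennreal (exp (\<alpha> * g x)) \<partial>\<mu>)
    \<le> ennreal ((D + measure \<mu> (space \<mu>) * exp (\<beta> * k0)) * exp \<alpha> / (1 - exp (\<alpha> - \<beta>)))"
proof -
  interpret finite_measure \<mu> by fact
  define D' where "D' = D + measure \<mu> (space \<mu>) * exp (\<beta> * k0)"
  have D': "0 \<le> D'" using D by (simp add: D'_def)
  define E where "E k = {x \<in> space \<mu>. real k \<le> g x}" for k :: nat
  have [measurable]: "E k \<in> sets \<mu>" for k unfolding E_def by measurable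
  have all: "emeasure \<mu> (E k) \<le> ennreal (D' * exp (- \<beta> * k))" for k
  proof (cases "k0 \<le> k")
    case True
    have "D * exp (- \<beta> * k) \<le> D' * exp (- \<beta> * k)"
      by (intro mult_right_mono) (auto simp: D'_def)
    then show ?thesis using tail[OF True] unfolding E_def by (meson ennreal_leI order_trans)
  next
    case False
    have "emeasure \<mu> (E k) \<le> ennreal (measure \<mu> (space \<mu>))"
      unfolding emeasure_eq_measure by (intro ennreal_leI bounded_measure)
    also have "ennreal (measure \<mu> (space \<mu>)) \<le> ennreal (D' * exp (- \<beta> * k))"
    proof (rule ennreal_leI)
      have "measure \<mu> (space \<mu>) * 1 \<le> measure \<mu> (space \<mu>) * exp (\<beta> * k0 - \<beta> * k)"
        using False \<alpha> by (intro mult_left_mono) auto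
      also have "\<dots> = measure \<mu> (space \<mu>) * exp (\<beta> * k0) * exp (- \<beta> * k)"
        by (simp add: mult.assoc exp_add[symmetric])
      also have "\<dots> \<le> D' * exp (- \<beta> * k)"
        using D by (intro mult_right_mono) (auto simp: D'_def)
      finally show "measure \<mu> (space \<mu>) \<le> D' * exp (- \<beta> * k)" by simp
    qed
    finally show ?thesis .
  qed
  define q where "q = exp (\<alpha> - \<beta>)"
  have q: "0 < q" "q < 1" using \<alpha> by (auto simp: q_def)
  have "(\<integral>\<^sup>+x. ennreal (exp (\<alpha> * g x)) \<partial>\<mu>) \<le> (\<integral>\<^sup>+x. (\<Sum>k. ennreal (exp (\<alpha> * (real k + 1))) * indicator (E k) x) \<partial>\<mu>)"
  proof (rule nn_integral_mono)
    fix x assume x: "x \<in> space \<mu>"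
    define k where "k = nat \<lfloor>g x\<rfloor>"
    have k: "real k \<le> g x" "g x \<le> real k + 1" using g0[of x] by (auto simp: k_def)
    have "ennreal (exp (\<alpha> * g x)) \<le> ennreal (exp (\<alpha> * (real k + 1)))"
      using k \<alpha> by (intro ennreal_leI) simp
    also have "\<dots> = ennreal (exp (\<alpha> * (real k + 1))) * indicator (E k) x"
      using x k by (simp add: E_def)
    also have "\<dots> \<le> (\<Sum>k. ennreal (exp (\<alpha> * (real k + 1))) * indicator (E k) x)"
    proof -
      define t where "t k = ennreal (exp (\<alpha> * (real k + 1))) * indicator (E k) x" for k
      have "sum t {k} \<le> (\<Sum>k. t k)" by (rule sum_le_suminf) auto
      then have "t k \<le> (\<Sum>k. t k)" by simp
      then show ?thesis unfolding t_def .
    qed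
    finally show "ennreal (exp (\<alpha> * g x)) \<le> (\<Sum>k. ennreal (exp (\<alpha> * (real k + 1))) * indicator (E k) x)" .
  qed
  also have "\<dots> = (\<Sum>k. \<integral>\<^sup>+x. ennreal (exp (\<alpha> * (real k + 1))) * indicator (E k) x \<partial>\<mu>)"
    by (rule nn_integral_suminf) measurable
  also have "\<dots> \<le> (\<Sum>k. ennreal (D' * exp \<alpha> * q ^ k))"
  proof (rule suminf_le)
    fix k
    have "(\<integral>\<^sup>+x. ennreal (exp (\<alpha> * (real k + 1))) * indicator (E k) x \<partial>\<mu>) = ennreal (exp (\<alpha> * (real k + 1))) * emeasure \<mu> (E k)"
      by (simp add: nn_integral_cmult_indicator)
    also have "\<dots> \<le> ennreal (exp (\<alpha> * (real k + 1))) * ennreal (D' * exp (- \<beta> * k))"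
      by (intro mult_left_mono all) simp
    also have "\<dots> = ennreal (exp (\<alpha> * (real k + 1)) * (D' * exp (- \<beta> * k)))"
      using D' by (intro ennreal_mult[symmetric]) auto
    also have "exp (\<alpha> * (real k + 1)) * (D' * exp (- \<beta> * k)) = D' * exp \<alpha> * q ^ k"
    proof -
      have "q ^ k = exp (real k * (\<alpha> - \<beta>))" by (simp add: q_def exp_of_nat_mult)
      then have "D' * exp \<alpha> * q ^ k = D' * exp (\<alpha> + real k * (\<alpha> - \<beta>))" by (simp add: exp_add)
      moreover have "exp (\<alpha> * (real k + 1)) * (D' * exp (- \<beta> * k)) = D' * exp (\<alpha> * (real k + 1) + - \<beta> * k)"
        by (simp only: exp_add mult.left_commute)
      moreover have "\<alpha> * (real k + 1) + - \<beta> * k = \<alpha> + real k * (\<alpha> - \<beta>)" by (simp add: algebra_simps)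
      ultimately show ?thesis by (simp only:)
    qed
    finally show "(\<integral>\<^sup>+x. ennreal (exp (\<alpha> * (real k + 1))) * indicator (E k) x \<partial>\<mu>) \<le> ennreal (D' * exp \<alpha> * q ^ k)" .
  qed auto
  also have "\<dots> = ennreal (D' * exp \<alpha> * (1 / (1 - q)))"
    using q D' by (intro suminf_ennreal_eq sums_mult geometric_sums) auto
  finally show ?thesis by (simp add: D'_def q_def)
qed

text \<open>
  Let \<open>T\<close> be the level with \<open>T powr (n / (n - 1)) = k\<close> and choose \<open>r\<close> such that the bound for the far part of the
  potential, divided by \<open>S = n * \<kappa>\<close>, is the fraction \<open>\<theta>p = \<theta> powr ((n - 1) / n)\<close> of \<open>T\<close>. If \<open>k\<close> is large, half of the
  remaining \<open>(1 - \<theta>p) * T\<close> is at least the constant contributed by the \<open>L\<^sup>1\<close> norm, so the near part divided by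
  \<open>S\<close> is at least \<open>(1 - \<theta>p) / 2\<close> wherever \<open>\<bar>u\<bar> \<ge> T\<close>. Markov's inequality bounds the measure of this set by
  a multiple of \<open>r ^ (n - 1)\<close>, which is the stated exponential.
\<close>

lemma trace_tail_estimate:
  fixes \<Omega> :: "'a::euclidean_space set" and \<mu> :: "'a measure" and C R e \<kappa> A \<theta> :: real
  assumes n: "2 \<le> DIM('a)" and "open \<Omega>"
    and fin: "finite_measure \<mu>" and sets[measurable_cong]: "sets \<mu> = sets borel"
    and reg: "\<And>y \<rho>. 0 < \<rho> \<Longrightarrow> emeasure \<mu> (ball y \<rho>) \<le> ennreal (C * \<rho> ^ (DIM('a) - 1))" and C: "0 \<le> C"
    and R: "0 < R" and cone: "\<And>x. x \<in> frontier \<Omega> \<Longrightarrow> \<exists>N. norm N = 1 \<and>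
          (\<forall>z. norm z < R \<longrightarrow> z \<in> wide_cone N e \<longrightarrow> x + z \<in> \<Omega>)"
    and \<kappa>: "\<And>N :: 'a. norm N = 1 \<Longrightarrow> measure lborel (wide_cone N e \<inter> ball 0 1) = \<kappa>" "0 < \<kappa>"
    and A: "0 \<le> A" and \<theta>: "0 < \<theta>" "\<theta> < 1"
  shows "\<exists>D\<ge>0. \<exists>k0. \<forall>u G. C1_pair \<Omega> u G \<longrightarrow>
      (\<integral>\<^sup>+y. indicator \<Omega> y * ennreal \<bar>u y\<bar> \<partial>lborel) \<le> ennreal A \<longrightarrow>
      (\<integral>\<^sup>+y. indicator \<Omega> y * ennreal (norm (G y) ^ DIM('a)) \<partial>lborel) \<le> 1 \<longrightarrow>
      (\<forall>k\<ge>k0. emeasure \<mu> {x \<in> frontier \<Omega>. real k \<le> \<bar>u x\<bar> powr (DIM('a) / (real DIM('a) - 1))}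
         \<le> ennreal (D * exp (- ((real DIM('a) - 1) * \<theta> * (DIM('a) * \<kappa>) powr (1 / (real DIM('a) - 1))) * real k)))"
proof -
  let ?n = "DIM('a)"
  define m where "m = real ?n - 1"
  have m: "0 < m" "real ?n = m + 1" "real (?n - 1) = m" using n by (auto simp: m_def of_nat_diff)
  define S where "S = ?n * \<kappa>"
  have S: "0 < S" using n \<kappa> by (simp add: S_def)
  define M where "M = A / (\<kappa> * R ^ ?n)"
  have M: "0 \<le> M" using A \<kappa> R by (simp add: M_def)
  define p where "p = m / (m + 1)"
  have p: "0 < p" "p < 1" "1 / p = ?n / (real ?n - 1)" using m by (auto simp: p_def)
  define \<theta>p where "\<theta>p = \<theta> powr p"
  have \<theta>p: "0 < \<theta>p" "\<theta>p < 1" using \<theta> p powr_less_mono2[of p \<theta> 1] by (auto simp: \<theta>p_def)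
  define \<eta> where "\<eta> = S * (1 - \<theta>p) / 2"
  have \<eta>: "0 < \<eta>" using S \<theta>p by (simp add: \<eta>_def)
  define H1 where "H1 = unit_ball_vol ?n * 2 powr (real ?n - 1/2) / (1 - 2 powr (- 1/2))"
  have H1: "0 < H1"
    unfolding H1_def using powr_less_one[of 2 "- 1 / 2"] by (intro divide_pos_pos mult_pos_pos) auto
  define H2 where "H2 = C * 2 powr ((real ?n - 1) / 2) / (1 - 2 powr (- ((real ?n - 1) / 2)))"
  have H2: "0 \<le> H2"
    unfolding H2_def using C n powr_less_one[of 2 "- ((real ?n - 1) / 2)"]
    by (intro divide_nonneg_nonneg mult_nonneg_nonneg) auto
  define D where "D = 2 / \<eta> * (2 * H1 / \<eta>) powr m * H2 * R powr m"
  have D: "0 \<le> D" using \<eta> H1 H2 by (simp add: D_def)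
  obtain k0 :: nat where k0: "(max 1 (2 * M / (1 - \<theta>p))) powr (1 / p) \<le> real k0"
    using real_arch_simple by blast
  show ?thesis
  proof (intro exI[of _ D] conjI exI[of _ k0] allI impI)
    fix u G k
    assume u: "C1_pair \<Omega> u G"
      and uA: "(\<integral>\<^sup>+y. indicator \<Omega> y * ennreal \<bar>u y\<bar> \<partial>lborel) \<le> ennreal A"
      and G1: "(\<integral>\<^sup>+y. indicator \<Omega> y * ennreal (norm (G y) ^ ?n) \<partial>lborel) \<le> 1"
      and k: "k0 \<le> k"
    have [measurable]: "\<Omega> \<in> sets borel" using \<open>open \<Omega>\<close> by simp
    have [measurable]: "u \<in> borel_measurable borel" "G \<in> borel_measurable borel"
      using u by (auto simp: C1_pair_def)
    have [measurable]: "ball 0 t \<in> sets (borel :: 'a measure)" for t by simp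
    define T where "T = real k powr p"
    have T: "1 \<le> T" "M \<le> (1 - \<theta>p) / 2 * T"
    proof -
      let ?b = "max 1 (2 * M / (1 - \<theta>p))"
      have "?b = (?b powr (1 / p)) powr p" using p(1) by (simp add: powr_powr)
      also have "\<dots> \<le> T"
        unfolding T_def using k0 k p by (intro powr_mono2) auto
      finally have "1 \<le> T" "2 * M / (1 - \<theta>p) \<le> T" by auto
      then show "1 \<le> T" "M \<le> (1 - \<theta>p) / 2 * T" using \<theta>p by (auto simp: field_simps)
    qed
    then have kpos: "0 < real k" using p by (cases "k = 0") (auto simp: T_def)
    define L where "L = \<theta> * k * S powr (1 / m)"
    have L: "0 < L" using \<theta> kpos S by (simp add: L_def)
    \<comment> \<open>This \<open>L = ln (R / r)\<close> makes the bound for the far part equal to \<open>\<theta>p * T * S\<close>, see \<open>far_eq\<close> below.\<close>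
    define r where "r = R * exp (- L)"
    have r: "0 < r" "r < R" using R L by (auto simp: r_def)
    have lnr: "ln (R / r) = L"
    proof -
      have "R / r = exp L" using R by (simp add: r_def exp_minus field_simps)
      then show ?thesis by simp
    qed
    have far_eq: "(S * L) powr p = \<theta>p * T * S"
    proof -
      have "S * L = (\<theta> * k) * (S powr 1 * S powr (1 / m))" using S by (simp add: L_def)
      also have "S powr 1 * S powr (1 / m) = S powr (1 + 1 / m)" by (simp only: powr_add)
      also have "1 + 1 / m = 1 / p" using m by (simp add: p_def field_simps)
      finally show ?thesis using \<theta> kpos S p(1) by (simp add: powr_mult powr_powr \<theta>p_def T_def)
    qed
    define g where "g y = indicator \<Omega> y * norm (G y)" for y
    have [measurable]: "g \<in> borel_measurable borel" unfolding g_def by measurable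
    have g0: "0 \<le> g y" for y by (simp add: g_def)
    have g1: "(\<integral>\<^sup>+y. ennreal (g y ^ ?n) \<partial>lborel) \<le> 1"
    proof -
      have "(\<integral>\<^sup>+y. ennreal (g y ^ ?n) \<partial>lborel) = (\<integral>\<^sup>+y. indicator \<Omega> y * ennreal (norm (G y) ^ ?n) \<partial>lborel)"
        using n by (intro nn_integral_cong) (auto simp: g_def indicator_def)
      with G1 show ?thesis by simp
    qed
    \<comment> \<open>With this weight the last term of \<open>near_potential_le\<close> is half of the lower bound \<open>\<eta>\<close> for the near part.\<close>
    define B where "B = (2 * H1 * r powr (1/2) / \<eta>) powr m"
    have B: "0 < B" using H1 r \<eta> by (simp add: B_def)
    have B_eq: "B powr (- 1 / (real ?n - 1)) * H1 * r powr (1/2) = \<eta> / 2"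
    proof -
      define b where "b = 2 * H1 * r powr (1/2) / \<eta>"
      have b: "0 < b" using H1 r \<eta> by (simp add: b_def)
      have "B powr (- 1 / (real ?n - 1)) = b powr (- 1)" using m by (simp add: B_def b_def[symmetric] powr_powr)
      also have "\<dots> = 1 / b" using b by (simp add: powr_minus_divide)
      finally show ?thesis using H1 r \<eta> by (simp add: b_def)
    qed
    define Q where "Q x = (\<integral>\<^sup>+y. indicator (ball 0 r) y * (ennreal (g (x + y) ^ ?n) * ennreal (norm y powr (- ((real ?n - 1) / 2)))) \<partial>lborel)" for x
    have [measurable]: "Q \<in> borel_measurable borel" unfolding Q_def by measurable
    define E where "E = {x \<in> frontier \<Omega>. real k \<le> \<bar>u x\<bar> powr (?n / (real ?n - 1))}"
    have EQ: "1 \<le> ennreal (2 * B / \<eta>) * Q x" if "x \<in> E" for x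
    proof -
      have x: "x \<in> frontier \<Omega>" "real k \<le> \<bar>u x\<bar> powr (1 / p)" using that by (auto simp: E_def p(3))
      have "T \<le> (\<bar>u x\<bar> powr (1 / p)) powr p" unfolding T_def using x(2) p by (intro powr_mono2) auto
      then have Tu: "T \<le> \<bar>u x\<bar>" using p(1) by (simp add: powr_powr)
      obtain N where N: "norm N = 1" "\<And>z. norm z < R \<Longrightarrow> z \<in> wide_cone N e \<Longrightarrow> x + z \<in> \<Omega>"
        using cone[OF x(1)] by blast
      let ?K = "wide_cone N e"
      have K: "S = ?n * measure lborel (?K \<inter> ball 0 1)" using \<kappa>(1)[OF N(1)] by (simp add: S_def)
      let ?h = "\<lambda>y. ennreal (g (x + y)) * ennreal (1 / norm y ^ (?n - 1))"
      define near where "near = (\<integral>\<^sup>+y. indicator (ball 0 r) y * ?h y \<partial>lborel)"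
      define far where "far = (\<integral>\<^sup>+y. indicator (?K \<inter> (ball 0 R - ball 0 r)) y * ?h y \<partial>lborel)"
      have gx1: "(\<integral>\<^sup>+y. ennreal (g (x + y) ^ ?n) \<partial>lborel) \<le> 1"
        using nn_integral_lborel_translate[of "\<lambda>y. ennreal (g y ^ ?n)" x] g1 by simp
      have far_le: "far \<le> ennreal (\<theta>p * T * S)"
        using far_potential_le[OF n _ _ gx1 r K S] g0 by (simp add: far_def lnr far_eq[unfolded p_def] m(2))
      have near_le: "near \<le> ennreal B * Q x + ennreal (\<eta> / 2)"
        unfolding near_def Q_def B_eq[symmetric]
        by (rule near_potential_le[OF n _ _ r(1) B H1_def, where g = "\<lambda>y. g (x + y)"]) (measurable, rule g0)
      have split: "(\<integral>\<^sup>+y. indicator (?K \<inter> ball 0 R) y *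
        (ennreal (norm (G (x + y))) * ennreal (1 / norm y ^ (?n - 1))) \<partial>lborel) \<le> near + far"
      proof -
        have "(\<integral>\<^sup>+y. indicator (?K \<inter> ball 0 R) y *
        (ennreal (norm (G (x + y))) * ennreal (1 / norm y ^ (?n - 1))) \<partial>lborel)
          \<le> (\<integral>\<^sup>+y. indicator (ball 0 r) y * ?h y + indicator (?K \<inter> (ball 0 R - ball 0 r)) y * ?h y \<partial>lborel)"
          using N(2) by (intro nn_integral_mono) (auto simp: indicator_def g_def)
        also have "\<dots> = near + far"
          unfolding near_def far_def by (rule nn_integral_add) measurable
        finally show ?thesis .
      qed
      have xc: "x \<in> closure \<Omega>" using x(1) by (simp add: frontier_def)
      have "ennreal \<bar>u x\<bar> \<le> ennreal (1 / S) * (near + far) + ennreal M"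
      proof -
        have "ennreal \<bar>u x\<bar> \<le>
          ennreal (1 / (?n * \<kappa>)) * (\<integral>\<^sup>+y. indicator (?K \<inter> ball 0 R) y *
              (ennreal (norm (G (x + y))) * ennreal (1 / norm y ^ (?n - 1))) \<partial>lborel)
          + ennreal (1 / (\<kappa> * R ^ ?n)) * (\<integral>\<^sup>+y. indicator \<Omega> y * ennreal \<bar>u y\<bar> \<partial>lborel)"
          by (rule cone_average_estimate[OF u \<open>open \<Omega>\<close> xc R N(2) \<kappa>(1)[OF N(1), symmetric] \<kappa>(2)])
        also have "\<dots> \<le> ennreal (1 / S) * (near + far) + ennreal (1 / (\<kappa> * R ^ ?n)) * ennreal A"
          unfolding S_def by (intro add_mono mult_left_mono split uA) auto
        also have "ennreal (1 / (\<kappa> * R ^ ?n)) * ennreal A = ennreal M"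
          using \<kappa>(2) R A by (simp add: ennreal_mult[symmetric] M_def)
        finally show ?thesis .
      qed
      also have "\<dots> \<le> ennreal (1 / S) * (near + ennreal (\<theta>p * T * S)) + ennreal M"
        by (intro add_mono mult_left_mono far_le) auto
      finally have ux: "ennreal \<bar>u x\<bar> \<le> ennreal (1 / S) * (near + ennreal (\<theta>p * T * S)) + ennreal M" .
      have "ennreal \<eta> \<le> near"
      proof (rule ccontr)
        assume "\<not> ennreal \<eta> \<le> near"
        then have "near < ennreal \<eta>" by simp
        then obtain \<nu> where \<nu>: "near = ennreal \<nu>" "0 \<le> \<nu>" "\<nu> < \<eta>"
          by (cases near) (auto simp: ennreal_less_iff)
        have "ennreal (1 / S) * (near + ennreal (\<theta>p * T * S)) + ennreal M = ennreal (1 / S * (\<nu> + \<theta>p * T * S) + M)"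
          using \<nu> S \<theta>p T M by (simp add: ennreal_mult[symmetric] ennreal_plus[symmetric] del: ennreal_plus)
        with ux have "ennreal \<bar>u x\<bar> \<le> ennreal (1 / S * (\<nu> + \<theta>p * T * S) + M)" by (simp only:)
        moreover have "0 \<le> 1 / S * (\<nu> + \<theta>p * T * S) + M"
          using S \<nu> \<theta>p T M by (intro add_nonneg_nonneg mult_nonneg_nonneg) auto
        ultimately have "\<bar>u x\<bar> \<le> 1 / S * (\<nu> + \<theta>p * T * S) + M"
          by (simp only: ennreal_le_iff)
        also have "\<dots> = \<nu> / S + \<theta>p * T + M" using S by (simp add: field_simps)
        also have "\<nu> / S < \<eta> / S" using \<nu> S by (simp add: divide_strict_right_mono)
        also have "\<eta> / S = (1 - \<theta>p) / 2 * 1" using S by (simp add: \<eta>_def)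
        also have "\<dots> \<le> (1 - \<theta>p) / 2 * T" using T \<theta>p by (intro mult_left_mono) auto
        finally have "\<bar>u x\<bar> < (1 - \<theta>p) / 2 * T + \<theta>p * T + M" by simp
        also have "\<dots> \<le> (1 - \<theta>p) / 2 * T + \<theta>p * T + (1 - \<theta>p) / 2 * T"
          using T(2) by (rule add_left_mono)
        also have "\<dots> = T" by (simp add: field_simps)
        finally show False using Tu by simp
      qed
      with near_le have \<eta>Q: "ennreal \<eta> \<le> ennreal B * Q x + ennreal (\<eta> / 2)" by (rule order_trans[rotated])
      have "ennreal (\<eta> / 2) \<le> ennreal B * Q x"
      proof (rule ccontr)
        assume "\<not> ennreal (\<eta> / 2) \<le> ennreal B * Q x"
        then obtain \<nu> where \<nu>: "ennreal B * Q x = ennreal \<nu>" "0 \<le> \<nu>" "\<nu> < \<eta> / 2"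
          by (cases "ennreal B * Q x") (auto simp: not_le ennreal_less_iff)
        have "ennreal \<eta> \<le> ennreal (\<nu> + \<eta> / 2)" using \<eta>Q \<nu> \<eta> by simp
        then show False using \<nu> \<eta> by (simp add: ennreal_le_iff del: ennreal_plus)
      qed
      then have "ennreal (2 / \<eta>) * ennreal (\<eta> / 2) \<le> ennreal (2 / \<eta>) * (ennreal B * Q x)"
        by (rule mult_left_mono) simp
      moreover have "ennreal (2 / \<eta>) * ennreal (\<eta> / 2) = 1" using \<eta> by (simp add: ennreal_mult[symmetric])
      moreover have "ennreal (2 / \<eta>) * (ennreal B * Q x) = ennreal (2 * B / \<eta>) * Q x"
        using \<eta> B by (simp add: ennreal_mult[symmetric] mult.assoc[symmetric])
      ultimately show ?thesis by simp
    qed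
    have "emeasure \<mu> E \<le> emeasure \<mu> {x \<in> UNIV. 1 \<le> ennreal (2 * B / \<eta>) * Q x}"
      using EQ by (intro emeasure_mono) auto
    also have "\<dots> \<le> ennreal (2 * B / \<eta>) * (\<integral>\<^sup>+x. Q x * indicator UNIV x \<partial>\<mu>)"
      by (rule nn_integral_Markov_inequality) auto
    also have "\<dots> \<le> ennreal (2 * B / \<eta>) * ennreal (H2 * r powr ((real ?n - 1) / 2))"
    proof (rule mult_left_mono)
      have "(\<integral>\<^sup>+x. Q x \<partial>\<mu>) \<le> ennreal (H2 * r powr ((real ?n - 1) / 2))"
        unfolding Q_def by (rule trace_kernel_integral_le[OF n fin sets reg C _ g0 g1 r(1)]) (simp_all add: H2_def)
      then show "(\<integral>\<^sup>+x. Q x * indicator UNIV x \<partial>\<mu>) \<le> ennreal (H2 * r powr ((real ?n - 1) / 2))" by simp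
    qed simp
    also have "\<dots> = ennreal (2 * B / \<eta> * (H2 * r powr (m / 2)))"
      using B \<eta> H2 by (simp add: ennreal_mult[symmetric] m_def)
    also have "2 * B / \<eta> * (H2 * r powr (m / 2)) = D * exp (- (m * \<theta> * S powr (1 / m)) * real k)"
    proof -
      have "B = (2 * H1 / \<eta>) powr m * r powr (m / 2)"
      proof -
        have "B = ((2 * H1 / \<eta>) * r powr (1/2)) powr m" by (simp add: B_def)
        also have "\<dots> = (2 * H1 / \<eta>) powr m * (r powr (1/2)) powr m"
          by (rule powr_mult)
        finally show ?thesis by (simp add: powr_powr)
      qed
      moreover have "r powr (m / 2) * r powr (m / 2) = R powr m * exp (- (m * \<theta> * S powr (1 / m)) * real k)"
      proof -
        have "r powr (m / 2) * r powr (m / 2) = r powr m" by (simp add: powr_add[symmetric])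
        also have "\<dots> = R powr m * exp (- L) powr m" unfolding r_def by (rule powr_mult)
        also have "exp (- L) powr m = exp (- L * m)" by (simp add: powr_def)
        also have "- L * m = - (m * \<theta> * S powr (1 / m)) * real k" by (simp add: L_def)
        finally show ?thesis .
      qed
      ultimately have "2 * B / \<eta> * (H2 * r powr (m / 2))
        = 2 / \<eta> * (2 * H1 / \<eta>) powr m * H2 * (r powr (m / 2) * r powr (m / 2))" by (simp add: mult_ac)
      also have "\<dots> = 2 / \<eta> * (2 * H1 / \<eta>) powr m * H2 * (R powr m * exp (- (m * \<theta> * S powr (1 / m)) * real k))"
        by (simp only: \<open>r powr (m / 2) * r powr (m / 2) = _\<close>)
      finally show ?thesis by (simp only: D_def mult.assoc)
    qed
    finally show "emeasure \<mu> {x \<in> frontier \<Omega>. real k \<le> \<bar>u x\<bar> powr (?n / (real ?n - 1))}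
         \<le> ennreal (D * exp (- ((real ?n - 1) * \<theta> * (?n * \<kappa>) powr (1 / (real ?n - 1))) * real k))"
      by (simp only: E_def m_def S_def)
  qed (use D in auto)
qed

section \<open>The trace inequality\<close>

lemma set_integrable_continuous_closure:
  fixes f :: "'a::euclidean_space \<Rightarrow> real"
  assumes "open \<Omega>" "bounded \<Omega>" "continuous_on (closure \<Omega>) f"
  shows "set_integrable lborel \<Omega> f"
proof (rule set_integrable_subset)
  show "set_integrable lborel (closure \<Omega>) f"
    unfolding set_integrable_def using assms by (intro borel_integrable_compact) (auto simp: compact_closure)
qed (use assms closure_subset[of \<Omega>] in auto)

text \<open>
  The mean of \<open>u\<close> differs from the reference value \<open>c u G\<close> of the Poincare inequality by a controlled amount,
  so that for mean zero the reference value itself is controlled.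
\<close>

lemma mean_zero_L1_bound:
  fixes \<Omega> :: "'a::euclidean_space set"
  assumes bd: "C1_holder_boundary \<gamma> \<Omega>" "0 < \<gamma>" and \<Omega>: "open \<Omega>" "connected \<Omega>" "bounded \<Omega>" "\<Omega> \<noteq> {}"
    and p: "0 < (p::nat)"
  shows "\<exists>A\<ge>0. \<forall>u G. C1_pair \<Omega> u G \<longrightarrow> (LINT x:\<Omega>|lborel. u x) = 0 \<longrightarrow>
      (\<integral>\<^sup>+y. indicator \<Omega> y * ennreal (norm (G y) ^ p) \<partial>lborel) \<le> 1 \<longrightarrow>
      (\<integral>\<^sup>+y. indicator \<Omega> y * ennreal \<bar>u y\<bar> \<partial>lborel) \<le> ennreal A"
proof -
  obtain c where "oscillation_controlled c \<Omega> \<Omega>" using poincare_L1[OF bd \<Omega>] by blast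
  then obtain C where C: "0 \<le> C" "\<And>u G. C1_pair \<Omega> u G \<Longrightarrow>
        (\<integral>\<^sup>+x. indicator \<Omega> x * ennreal \<bar>u x - c u G\<bar> \<partial>lborel) \<le> ennreal C * grad_mass \<Omega> G"
    unfolding oscillation_controlled_def by blast
  have [measurable]: "\<Omega> \<in> sets borel" using \<open>open \<Omega>\<close> by simp
  define W where "W = measure lborel \<Omega>"
  have W: "emeasure lborel \<Omega> = ennreal W"
    unfolding W_def using emeasure_bounded_finite[OF \<open>bounded \<Omega>\<close>]
    by (intro emeasure_eq_ennreal_measure) auto
  have W0: "0 \<le> W" by (simp add: W_def)
  define D where "D = C * (W + 1)"
  have D: "0 \<le> D" using C W0 by (simp add: D_def)
  show ?thesis
  proof (intro exI[of _ "2 * D"] conjI allI impI)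
    fix u G
    assume u: "C1_pair \<Omega> u G" and mean: "(LINT x:\<Omega>|lborel. u x) = 0"
      and G: "(\<integral>\<^sup>+y. indicator \<Omega> y * ennreal (norm (G y) ^ p) \<partial>lborel) \<le> 1"
    have [measurable]: "u \<in> borel_measurable borel" "G \<in> borel_measurable borel"
      using u by (auto simp: C1_pair_def)
    have "grad_mass \<Omega> G \<le> (\<integral>\<^sup>+y. indicator \<Omega> y + indicator \<Omega> y * ennreal (norm (G y) ^ p) \<partial>lborel)"
    proof (rule nn_integral_mono)
      fix y
      have "norm (G y) \<le> 1 + norm (G y) ^ p"
      proof (cases "norm (G y) \<le> 1")
        case False
        then have "norm (G y) ^ 1 \<le> norm (G y) ^ p" using p by (intro power_increasing) auto
        then show ?thesis by simp
      qed (simp add: add_increasing2)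
      then have "ennreal (norm (G y)) \<le> ennreal (1 + norm (G y) ^ p)" by (rule ennreal_leI)
      then show "indicator \<Omega> y * ennreal (norm (G y)) \<le> indicator \<Omega> y + indicator \<Omega> y * ennreal (norm (G y) ^ p)"
        by (simp add: indicator_def)
    qed
    also have "\<dots> = emeasure lborel \<Omega> + (\<integral>\<^sup>+y. indicator \<Omega> y * ennreal (norm (G y) ^ p) \<partial>lborel)"
      by (subst nn_integral_add) auto
    also have "\<dots> \<le> ennreal W + 1" unfolding W by (intro add_left_mono G)
    also have "\<dots> = ennreal (W + 1)" using W0 by simp
    finally have gm: "grad_mass \<Omega> G \<le> ennreal (W + 1)" .
    let ?c = "c u G"
    have "(\<integral>\<^sup>+x. indicator \<Omega> x * ennreal \<bar>u x - ?c\<bar> \<partial>lborel) \<le> ennreal C * grad_mass \<Omega> G"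
      by (rule C(2)[OF u])
    also have "\<dots> \<le> ennreal C * ennreal (W + 1)" by (intro mult_left_mono gm) simp
    also have "\<dots> = ennreal D" using C(1) W0 by (simp add: D_def ennreal_mult)
    finally have osc: "(\<integral>\<^sup>+x. indicator \<Omega> x * ennreal \<bar>u x - ?c\<bar> \<partial>lborel) \<le> ennreal D" .
    have "\<bar>?c\<bar> * W \<le> D"
    proof -
      have iu: "set_integrable lborel \<Omega> u"
        using u \<Omega> by (intro set_integrable_continuous_closure) (auto simp: C1_pair_def)
      have ic: "set_integrable lborel \<Omega> (\<lambda>_. ?c)"
        using \<Omega> by (intro set_integrable_continuous_closure) auto
      define h where "h x = indicator \<Omega> x *\<^sub>R (u x - ?c)" for x
      have ih: "integrable lborel h"
        unfolding h_def using set_integral_diff(1)[OF iu ic] by (simp add: set_integrable_def)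
      have "(LINT x|lborel. h x) = (LINT x:\<Omega>|lborel. u x) - (LINT x:\<Omega>|lborel. ?c)"
        unfolding h_def using set_integral_diff(2)[OF iu ic] by (simp add: set_lebesgue_integral_def)
      also have "(LINT x:\<Omega>|lborel. ?c) = W * ?c"
        by (simp add: set_lebesgue_integral_def W_def)
      finally have "\<bar>?c\<bar> * W = norm (LINT x|lborel. h x)" using mean W0 by (simp add: abs_mult)
      also have "\<dots> \<le> (LINT x|lborel. norm (h x))" by (rule integral_norm_bound)
      finally have "ennreal (\<bar>?c\<bar> * W) \<le> ennreal (LINT x|lborel. norm (h x))" by (rule ennreal_leI)
      also have "\<dots> = (\<integral>\<^sup>+x. ennreal (norm (h x)) \<partial>lborel)"
        using ih by (intro nn_integral_eq_integral[symmetric]) auto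
      also have "\<dots> = (\<integral>\<^sup>+x. indicator \<Omega> x * ennreal \<bar>u x - ?c\<bar> \<partial>lborel)"
        by (intro nn_integral_cong) (simp add: h_def indicator_def)
      also have "\<dots> \<le> ennreal D" by (rule osc)
      finally show ?thesis using D by (simp add: ennreal_le_iff)
    qed
    have "(\<integral>\<^sup>+y. indicator \<Omega> y * ennreal \<bar>u y\<bar> \<partial>lborel)
        \<le> (\<integral>\<^sup>+y. indicator \<Omega> y * ennreal \<bar>u y - ?c\<bar> + ennreal \<bar>?c\<bar> * indicator \<Omega> y \<partial>lborel)"
    proof (rule nn_integral_mono)
      fix y
      have "ennreal \<bar>u y\<bar> \<le> ennreal (\<bar>u y - ?c\<bar> + \<bar>?c\<bar>)" by (rule ennreal_leI) linarith
      then show "indicator \<Omega> y * ennreal \<bar>u y\<bar> \<le> indicator \<Omega> y * ennreal \<bar>u y - ?c\<bar> + ennreal \<bar>?c\<bar> * indicator \<Omega> y"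
        by (simp add: indicator_def)
    qed
    also have "\<dots> = (\<integral>\<^sup>+y. indicator \<Omega> y * ennreal \<bar>u y - ?c\<bar> \<partial>lborel) + ennreal \<bar>?c\<bar> * emeasure lborel \<Omega>"
      by (subst nn_integral_add) (auto simp: nn_integral_cmult_indicator)
    also have "\<dots> \<le> ennreal D + ennreal (\<bar>?c\<bar> * W)"
      using osc by (simp add: W ennreal_mult' add_right_mono)
    also have "\<dots> \<le> ennreal D + ennreal D" using \<open>\<bar>?c\<bar> * W \<le> D\<close> by (intro add_left_mono ennreal_leI)
    also have "\<dots> = ennreal (2 * D)" using D by (simp add: ennreal_plus[symmetric] del: ennreal_plus)
    finally show "(\<integral>\<^sup>+y. indicator \<Omega> y * ennreal \<bar>u y\<bar> \<partial>lborel) \<le> ennreal (2 * D)" .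
  qed (use D in auto)
qed

text \<open>
  As \<open>e\<close> tends to 0, \<open>n * \<kappa>\<close> tends to \<open>n * \<bar>B\<bar> / 2\<close>, \<open>B\<close> being the unit ball, and this is at least \<open>\<omega> / 2\<close>.
\<close>

lemma subcritical_wide_cone:
  fixes \<alpha> \<omega> :: real
  assumes n: "2 \<le> DIM('a::euclidean_space)" and "0 < \<alpha>"
    and \<omega>: "0 \<le> \<omega>" "\<omega> \<le> DIM('a) * unit_ball_vol (DIM('a))"
    and \<alpha>: "\<alpha> < (real DIM('a) - 1) * (\<omega> / 2) powr (1 / (real DIM('a) - 1))"
  shows "\<exists>e \<kappa>::real. 0 < e \<and> 0 < \<kappa> \<and>
    (\<forall>N :: 'a. norm N = 1 \<longrightarrow> measure lborel (wide_cone N e \<inter> ball 0 1) = \<kappa>) \<and>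
    \<alpha> < (real DIM('a) - 1) * (DIM('a) * \<kappa>) powr (1 / (real DIM('a) - 1))"
proof -
  let ?n = "DIM('a)"
  define b where "b = real ?n - 1"
  have b: "0 < b" using n by (simp add: b_def)
  define \<kappa>0 where "\<kappa>0 = (\<alpha> / b) powr b / ?n"
  have "0 < ?n" by simp
  then have \<kappa>0: "0 < \<kappa>0" using b \<open>0 < \<alpha>\<close> by (simp add: \<kappa>0_def)
  have "\<alpha> / b < (\<omega> / 2) powr (1 / b)" using \<alpha> b by (simp add: b_def field_simps)
  then have "(\<alpha> / b) powr b < ((\<omega> / 2) powr (1 / b)) powr b"
    using b \<open>0 < \<alpha>\<close> by (intro powr_less_mono2) auto
  also have "\<dots> = \<omega> / 2" using b \<omega>(1) by (simp add: powr_powr)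
  also have "\<dots> \<le> ?n * unit_ball_vol ?n / 2" using \<omega>(2) by simp
  finally have \<kappa>0_small: "2 * \<kappa>0 < unit_ball_vol ?n" using n by (simp add: \<kappa>0_def field_simps)
  obtain e where e: "0 < e" "\<And>N :: 'a. norm N = 1 \<Longrightarrow> \<kappa>0 < measure lborel (wide_cone N e \<inter> ball 0 1)"
    using wide_cone_almost_half[where 'a = 'a, OF \<kappa>0_small] by auto
  obtain N0 :: 'a where N0: "N0 \<in> Basis" using nonempty_Basis by blast
  define \<kappa> where "\<kappa> = measure lborel (wide_cone N0 e \<inter> ball 0 1)"
  have \<kappa>: "\<kappa>0 < \<kappa>" unfolding \<kappa>_def using N0 by (intro e) simp
  have "measure lborel (wide_cone N e \<inter> ball 0 1) = \<kappa>" if "norm N = 1" for N :: 'a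
    unfolding \<kappa>_def measure_def using emeasure_wide_cone_cong[of N N0 e] that N0 by simp
  moreover have "\<alpha> < b * (?n * \<kappa>) powr (1 / b)"
  proof -
    have "\<alpha> / b = (?n * \<kappa>0) powr (1 / b)" using b \<open>0 < \<alpha>\<close> by (simp add: \<kappa>0_def powr_powr)
    also have "\<dots> < (?n * \<kappa>) powr (1 / b)"
      using \<kappa> \<kappa>0 b \<open>0 < ?n\<close> by (intro powr_less_mono2 mult_strict_left_mono) auto
    finally show ?thesis using b by (simp add: field_simps)
  qed
  ultimately show ?thesis using e(1) \<kappa> \<kappa>0 unfolding b_def by (intro exI[of _ e] exI[of _ \<kappa>]) auto
qed

lemma emeasure_density_indicator:
  assumes "F \<in> sets M" "A \<in> sets M"
  shows "emeasure (density M (indicator F)) A = emeasure M (F \<inter> A)"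
  using assms by (simp add: emeasure_density indicator_inter_arith[symmetric])

lemma C1_closure_pairE:
  assumes "open \<Omega>" "C1_closure \<Omega> u"
  obtains U G where "C1_pair \<Omega> U G" "\<And>x. x \<in> closure \<Omega> \<Longrightarrow> U x = u x" "\<And>x. x \<in> \<Omega> \<Longrightarrow> grad u x = G x"
proof -
  obtain G where cu: "continuous_on (closure \<Omega>) u" and cG: "continuous_on (closure \<Omega>) G"
    and G: "\<And>x. x \<in> \<Omega> \<Longrightarrow> GDERIV u x :> G x"
    using assms(2) unfolding C1_closure_def by blast
  define U where "U x = indicator (closure \<Omega>) x *\<^sub>R u x" for x
  define G' where "G' x = indicator (closure \<Omega>) x *\<^sub>R G x" for x
  have sub: "\<Omega> \<subseteq> closure \<Omega>" by (rule closure_subset)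
  have eq: "U x = u x" "G' x = G x" if "x \<in> closure \<Omega>" for x
    using that by (auto simp: U_def G'_def)
  show ?thesis
  proof (rule that[of U G'])
    show "C1_pair \<Omega> U G'"
      unfolding C1_pair_def
    proof (intro conjI ballI)
      show "U \<in> borel_measurable borel" "G' \<in> borel_measurable borel"
        unfolding U_def G'_def
        by (intro borel_measurable_continuous_on_indicator cu cG borel_closed closed_closure)+
      show "continuous_on (closure \<Omega>) U" "continuous_on (closure \<Omega>) G'"
        using cu cG eq by (simp_all cong: continuous_on_cong)
      fix x assume x: "x \<in> \<Omega>"
      have "(u has_derivative (\<lambda>h. h \<bullet> G x)) (at x)" using G[OF x] by (simp add: gderiv_def)
      then have "(U has_derivative (\<lambda>h. h \<bullet> G x)) (at x)"
        by (rule has_derivative_transform_within_open[OF _ \<open>open \<Omega>\<close> x]) (use eq sub in auto)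
      then have "GDERIV U x :> G x" by (simp add: gderiv_def)
      then show "GDERIV U x :> G' x" using eq sub x by auto
    qed
    show "grad u x = G' x" if "x \<in> \<Omega>" for x
      using grad_eq[OF G[OF that]] eq(2) sub that by auto
  qed (use eq in auto)
qed

lemma gradient_mass_le_1:
  assumes \<Omega>: "open \<Omega>" "bounded \<Omega>" and U: "C1_pair \<Omega> U G" and n: "0 < (n::nat)"
    and G: "\<And>x. x \<in> \<Omega> \<Longrightarrow> grad u x = G x"
    and le: "(LINT x:\<Omega>|lborel. norm (grad u x) ^ n) powr (1 / real n) \<le> 1"
  shows "(\<integral>\<^sup>+y. indicator \<Omega> y * ennreal (norm (G y) ^ n) \<partial>lborel) \<le> 1"
proof -
  have "(LINT x:\<Omega>|lborel. norm (grad u x) ^ n) = (LINT x:\<Omega>|lborel. norm (G x) ^ n)"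
    using \<Omega> G by (intro set_lebesgue_integral_cong) auto
  moreover define I where "I = (LINT x:\<Omega>|lborel. norm (G x) ^ n)"
  ultimately have I: "I powr (1 / real n) \<le> 1" using le by simp
  have "I \<le> 1"
  proof (rule ccontr)
    assume "\<not> I \<le> 1"
    then have "1 < I powr (1 / real n)" using n by (intro gr_one_powr) auto
    with I show False by simp
  qed
  have int: "set_integrable lborel \<Omega> (\<lambda>x. norm (G x) ^ n)"
    using U \<Omega> by (intro set_integrable_continuous_closure continuous_intros) (auto simp: C1_pair_def)
  have "(\<integral>\<^sup>+y. indicator \<Omega> y * ennreal (norm (G y) ^ n) \<partial>lborel)
      = (\<integral>\<^sup>+y. ennreal (indicator \<Omega> y *\<^sub>R norm (G y) ^ n) \<partial>lborel)"
    by (intro nn_integral_cong) (auto simp: indicator_def)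
  also have "\<dots> = ennreal I"
    using int unfolding I_def set_lebesgue_integral_def set_integrable_def
    by (intro nn_integral_eq_integral) auto
  finally show ?thesis using \<open>I \<le> 1\<close> by simp
qed

text \<open>
  For \<open>\<alpha> \<le> 0\<close> the integrand is at most 1. For \<open>\<alpha> > 0\<close> choose a cone that is wide enough for \<open>\<alpha>\<close>, and \<open>\<theta>\<close> such that
  the rate of decay of the level sets lies halfway between \<open>\<alpha>\<close> and the rate belonging to the cone.
\<close>

theorem moser_trudinger_trace_inequality:
  fixes \<Omega> :: "'a::euclidean_space set" and \<gamma> \<omega> \<alpha> :: real
  assumes n: "2 \<le> DIM('a)"
    and \<Omega>: "open \<Omega>" "connected \<Omega>" "bounded \<Omega>"
    and bd: "0 < \<gamma>" "C1_holder_boundary \<gamma> \<Omega>"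
    and \<omega>: "\<omega> = measure (hausdorff_measure (DIM('a) - 1)) (sphere (0 :: 'a) 1)"
    and \<alpha>: "\<alpha> < (real DIM('a) - 1) * (\<omega> / 2) powr (1 / (real DIM('a) - 1))"
  shows "\<exists>C::real. \<forall>u. C1_closure \<Omega> u \<longrightarrow>
     (LINT x:\<Omega>|lborel. u x) = 0 \<longrightarrow>
     (LINT x:\<Omega>|lborel. norm (grad u x) ^ DIM('a)) powr (1 / real DIM('a)) \<le> 1 \<longrightarrow>
     (\<integral>\<^sup>+x\<in>frontier \<Omega>. ennreal (exp (\<alpha> * \<bar>u x\<bar> powr (real DIM('a) / (real DIM('a) - 1))))
        \<partial>hausdorff_measure (DIM('a) - 1)) \<le> ennreal C"
proof (cases "\<Omega> = {}")
  case True
  then show ?thesis by (intro exI[of _ 0]) simp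
next
  case False
  let ?n = "DIM('a)"
  let ?H = "hausdorff_measure (?n - 1) :: 'a measure"
  let ?q = "real ?n / (real ?n - 1)"
  define F where "F = frontier \<Omega>"
  have F[measurable]: "F \<in> sets borel" by (simp add: F_def frontier_closed borel_closed)
  define \<mu> where "\<mu> = density ?H (indicator F)"
  have sets_\<mu>[measurable_cong]: "sets \<mu> = sets borel" and space_\<mu>: "space \<mu> = UNIV" by (simp_all add: \<mu>_def)
  have e\<mu>: "emeasure \<mu> A = emeasure ?H (F \<inter> A)" if "A \<in> sets borel" for A
    unfolding \<mu>_def using that F by (intro emeasure_density_indicator) auto
  obtain C where C: "0 \<le> C" "\<And>y \<rho>. 0 < \<rho> \<Longrightarrow> emeasure ?H (F \<inter> ball y \<rho>) \<le> ennreal (C * \<rho> ^ (?n - 1))"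
    unfolding F_def using frontier_upper_regular[OF bd(2,1) \<Omega>(3,1)] by metis
  have reg: "emeasure \<mu> (ball y \<rho>) \<le> ennreal (C * \<rho> ^ (?n - 1))" if "0 < \<rho>" for y \<rho>
    using C(2)[OF that] by (simp add: e\<mu>)
  have fin: "finite_measure \<mu>"
  proof (rule finite_measureI)
    have "bounded F" using \<Omega>(3) by (simp add: F_def compact_frontier_bounded compact_imp_bounded)
    then obtain \<rho> where \<rho>: "0 < \<rho>" "F \<subseteq> ball 0 \<rho>" using bounded_subset_ballD by blast
    then have "F \<inter> UNIV = F \<inter> ball 0 \<rho>" by auto
    then have "emeasure \<mu> (space \<mu>) = emeasure ?H (F \<inter> ball 0 \<rho>)" by (simp add: e\<mu> space_\<mu>)
    also have "\<dots> \<le> ennreal (C * \<rho> ^ (?n - 1))" using C(2) \<rho> by blast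
    finally show "emeasure \<mu> (space \<mu>) \<noteq> \<infinity>" by (auto simp: top_unique)
  qed
  have to_\<mu>: "(\<integral>\<^sup>+x\<in>frontier \<Omega>. ennreal (exp (\<alpha> * \<bar>u x\<bar> powr ?q)) \<partial>?H) = (\<integral>\<^sup>+x. ennreal (exp (\<alpha> * \<bar>U x\<bar> powr ?q)) \<partial>\<mu>)"
    if "U \<in> borel_measurable borel" "\<And>x. x \<in> closure \<Omega> \<Longrightarrow> U x = u x" for u U
  proof -
    have [measurable]: "U \<in> borel_measurable ?H" using that(1) by (simp cong: measurable_cong_sets)
    have "(\<integral>\<^sup>+x\<in>frontier \<Omega>. ennreal (exp (\<alpha> * \<bar>u x\<bar> powr ?q)) \<partial>?H)
       = (\<integral>\<^sup>+x. indicator F x * ennreal (exp (\<alpha> * \<bar>U x\<bar> powr ?q)) \<partial>?H)"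
      using that(2) by (intro nn_integral_cong) (auto simp: F_def indicator_def frontier_def)
    also have "\<dots> = (\<integral>\<^sup>+x. ennreal (exp (\<alpha> * \<bar>U x\<bar> powr ?q)) \<partial>\<mu>)"
      unfolding \<mu>_def by (rule nn_integral_density[symmetric]) measurable
    finally show ?thesis .
  qed
  show ?thesis
  proof (cases "0 < \<alpha>")
    case False
    have "(\<integral>\<^sup>+x. ennreal (exp (\<alpha> * \<bar>U x\<bar> powr ?q)) \<partial>\<mu>) \<le> ennreal (measure \<mu> (space \<mu>))" for U
    proof -
      have "(\<integral>\<^sup>+x. ennreal (exp (\<alpha> * \<bar>U x\<bar> powr ?q)) \<partial>\<mu>) \<le> (\<integral>\<^sup>+x. 1 \<partial>\<mu>)"
        using False by (intro nn_integral_mono) (auto simp: mult_nonpos_nonneg)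
      then show ?thesis using finite_measure.emeasure_eq_measure[OF fin] by simp
    qed
    note le = this
    show ?thesis
    proof (intro exI allI impI)
      fix u assume "C1_closure \<Omega> u"
      then obtain U G where U: "C1_pair \<Omega> U G" "\<And>x. x \<in> closure \<Omega> \<Longrightarrow> U x = u x"
        using C1_closure_pairE[OF \<Omega>(1)] by metis
      then have "U \<in> borel_measurable borel" by (simp add: C1_pair_def)
      from to_\<mu>[OF this U(2)] le[of U]
      show "(\<integral>\<^sup>+x\<in>frontier \<Omega>. ennreal (exp (\<alpha> * \<bar>u x\<bar> powr ?q)) \<partial>?H) \<le> ennreal (measure \<mu> (space \<mu>))"
        by simp
    qed
  next
    case True
    have "hausdorff_outer_measure (?n - 1) (sphere (0::'a) 1) \<le> ennreal (?n * unit_ball_vol ?n)"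
      by (rule hausdorff_outer_measure_sphere_le)
    then have \<omega>2: "0 \<le> \<omega>" "\<omega> \<le> ?n * unit_ball_vol ?n"
      by (auto simp: \<omega> measure_def emeasure_hausdorff_measure borel_closed intro!: enn2real_leI)
    obtain e \<kappa> :: real where e: "0 < e" "0 < \<kappa>"
      and \<kappa>: "\<And>N :: 'a. norm N = 1 \<Longrightarrow> measure lborel (wide_cone N e \<inter> ball 0 1) = \<kappa>"
      and \<alpha>\<kappa>: "\<alpha> < (real ?n - 1) * (?n * \<kappa>) powr (1 / (real ?n - 1))"
      using subcritical_wide_cone[OF n True \<omega>2 \<alpha>] by auto
    define \<beta> where "\<beta> = (real ?n - 1) * (?n * \<kappa>) powr (1 / (real ?n - 1))"
    define \<theta> where "\<theta> = (\<alpha> / \<beta> + 1) / 2"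
    have \<beta>: "0 < \<beta>" "\<alpha> < \<beta>" using True \<alpha>\<kappa> by (auto simp: \<beta>_def)
    have \<theta>: "0 < \<theta>" "\<theta> < 1" "\<alpha> < \<theta> * \<beta>" using \<beta> True by (auto simp: \<theta>_def field_simps)
    obtain R where R: "0 < R" "\<And>x. x \<in> frontier \<Omega> \<Longrightarrow> \<exists>N. norm N = 1 \<and>
        (\<forall>z. norm z < R \<longrightarrow> z \<in> wide_cone N e \<longrightarrow> x + z \<in> \<Omega>)"
      using uniform_interior_cone[OF bd(2,1) \<Omega>(3) e(1)] by metis
    obtain A where A: "0 \<le> A" "\<And>u G. C1_pair \<Omega> u G \<Longrightarrow> (LINT x:\<Omega>|lborel. u x) = 0 \<Longrightarrow>
      (\<integral>\<^sup>+y. indicator \<Omega> y * ennreal (norm (G y) ^ ?n) \<partial>lborel) \<le> 1 \<Longrightarrow>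
      (\<integral>\<^sup>+y. indicator \<Omega> y * ennreal \<bar>u y\<bar> \<partial>lborel) \<le> ennreal A"
      using mean_zero_L1_bound[OF bd(2,1) \<Omega> False, of ?n] by auto
    obtain D k0 where D: "0 \<le> D" and tail: "\<And>u G k. C1_pair \<Omega> u G \<Longrightarrow>
      (\<integral>\<^sup>+y. indicator \<Omega> y * ennreal \<bar>u y\<bar> \<partial>lborel) \<le> ennreal A \<Longrightarrow>
      (\<integral>\<^sup>+y. indicator \<Omega> y * ennreal (norm (G y) ^ ?n) \<partial>lborel) \<le> 1 \<Longrightarrow> k0 \<le> k \<Longrightarrow>
      emeasure \<mu> {x \<in> F. real k \<le> \<bar>u x\<bar> powr ?q}
         \<le> ennreal (D * exp (- ((real ?n - 1) * \<theta> * (?n * \<kappa>) powr (1 / (real ?n - 1))) * real k))"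
      using trace_tail_estimate[OF n \<Omega>(1) fin sets_\<mu> reg C(1) R \<kappa> e(2) A(1) \<theta>(1,2)]
      unfolding F_def by blast
    show ?thesis
    proof (intro exI allI impI)
      fix u
      assume u: "C1_closure \<Omega> u" and mean: "(LINT x:\<Omega>|lborel. u x) = 0"
        and le: "(LINT x:\<Omega>|lborel. norm (grad u x) ^ ?n) powr (1 / real ?n) \<le> 1"
      obtain U G where U: "C1_pair \<Omega> U G" "\<And>x. x \<in> closure \<Omega> \<Longrightarrow> U x = u x" "\<And>x. x \<in> \<Omega> \<Longrightarrow> grad u x = G x"
        using C1_closure_pairE[OF \<Omega>(1) u] by metis
      have [measurable]: "U \<in> borel_measurable borel" using U(1) by (simp add: C1_pair_def)
      have "(LINT x:\<Omega>|lborel. U x) = (LINT x:\<Omega>|lborel. u x)"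
        using U(2) \<Omega>(1) closure_subset[of \<Omega>] by (intro set_lebesgue_integral_cong) auto
      then have meanU: "(LINT x:\<Omega>|lborel. U x) = 0" using mean by simp
      have G1: "(\<integral>\<^sup>+y. indicator \<Omega> y * ennreal (norm (G y) ^ ?n) \<partial>lborel) \<le> 1"
        by (rule gradient_mass_le_1[OF \<Omega>(1,3) U(1) _ U(3) le]) simp_all
      note UA = A(2)[OF U(1) meanU G1]
      have "(\<integral>\<^sup>+x. ennreal (exp (\<alpha> * \<bar>U x\<bar> powr ?q)) \<partial>\<mu>)
        \<le> ennreal ((D + measure \<mu> (space \<mu>) * exp ((\<theta> * \<beta>) * k0)) * exp \<alpha> / (1 - exp (\<alpha> - \<theta> * \<beta>)))"
      proof (rule exp_integral_le_of_tail[OF fin _ _ _ D True \<theta>(3)])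
        show "(\<lambda>x. \<bar>U x\<bar> powr ?q) \<in> borel_measurable \<mu>" by measurable
        fix k assume k: "k0 \<le> k"
        have "emeasure \<mu> {x \<in> space \<mu>. real k \<le> \<bar>U x\<bar> powr ?q} = emeasure \<mu> {x \<in> F. real k \<le> \<bar>U x\<bar> powr ?q}"
        proof -
          have "F \<inter> {x \<in> F. real k \<le> \<bar>U x\<bar> powr ?q} = F \<inter> {x. real k \<le> \<bar>U x\<bar> powr ?q}" by auto
          moreover have "{x \<in> F. real k \<le> \<bar>U x\<bar> powr ?q} \<in> sets borel" "{x. real k \<le> \<bar>U x\<bar> powr ?q} \<in> sets borel"
            by measurable
          ultimately show ?thesis by (simp add: e\<mu> space_\<mu>)
        qed
        also have "\<dots> \<le> ennreal (D * exp (- ((real ?n - 1) * \<theta> * (?n * \<kappa>) powr (1 / (real ?n - 1))) * real k))"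
          by (rule tail[OF U(1) UA G1 k])
        also have "(real ?n - 1) * \<theta> * (?n * \<kappa>) powr (1 / (real ?n - 1)) = \<theta> * \<beta>"
          by (simp add: \<beta>_def)
        finally show "emeasure \<mu> {x \<in> space \<mu>. real k \<le> \<bar>U x\<bar> powr ?q} \<le> ennreal (D * exp (- (\<theta> * \<beta>) * k))" .
      qed simp
      then show "(\<integral>\<^sup>+x\<in>frontier \<Omega>. ennreal (exp (\<alpha> * \<bar>u x\<bar> powr ?q)) \<partial>?H)
        \<le> ennreal ((D + measure \<mu> (space \<mu>) * exp ((\<theta> * \<beta>) * k0)) * exp \<alpha> / (1 - exp (\<alpha> - \<theta> * \<beta>)))"
        by (subst to_\<mu>[OF _ U(2)]) auto
    qed
  qed
qed

theorem theorem2p1: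
  fixes \<Omega> :: "(real ^ 'n) set" and n :: nat and \<gamma> \<omega> \<beta> :: real
  assumes n: "n = CARD('n)" "n \<ge> 2"
    and \<Omega>: "open \<Omega>" "connected \<Omega>" "bounded \<Omega>"
    and boundary: "0 < \<gamma>" "\<gamma> < 1" "C1_holder_boundary \<gamma> \<Omega>"
    and \<omega>: "\<omega> = measure (hausdorff_measure (n - 1)) (sphere (0 :: real ^ 'n) 1)"
    and \<beta>: "\<beta> = (real n - 1) * (\<omega> / 2) powr (1 / (real n - 1))"
  shows "\<forall>\<alpha><\<beta>. \<exists>C::real. \<forall>u :: real ^ 'n \<Rightarrow> real.
           C1_closure \<Omega> u \<longrightarrow>
           continuous_on (frontier \<Omega>) u \<longrightarrow>
           (LINT x:\<Omega>|lborel. u x) = 0 \<longrightarrow>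
           (LINT x:\<Omega>|lborel. norm (grad u x) ^ n) powr (1 / real n) \<le> 1 \<longrightarrow>
           (\<integral>\<^sup>+x\<in>frontier \<Omega>. ennreal (exp (\<alpha> * \<bar>u x\<bar> powr (real n / (real n - 1))))
              \<partial>hausdorff_measure (n - 1)) \<le> ennreal C"
proof (intro allI impI)
  fix \<alpha> :: real assume "\<alpha> < \<beta>"
  have dim: "DIM(real ^ 'n) = n" using n(1) by simp
  have "\<alpha> < (real DIM(real ^ 'n) - 1) * (\<omega> / 2) powr (1 / (real DIM(real ^ 'n) - 1))"
    unfolding dim using \<open>\<alpha> < \<beta>\<close> \<beta> by simp
  from moser_trudinger_trace_inequality[OF _ \<Omega> boundary(1,3) _ this, unfolded dim, OF n(2) \<omega>]
  show "\<exists>C::real. \<forall>u :: real ^ 'n \<Rightarrow> real.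
           C1_closure \<Omega> u \<longrightarrow>
           continuous_on (frontier \<Omega>) u \<longrightarrow>
           (LINT x:\<Omega>|lborel. u x) = 0 \<longrightarrow>
           (LINT x:\<Omega>|lborel. norm (grad u x) ^ n) powr (1 / real n) \<le> 1 \<longrightarrow>
           (\<integral>\<^sup>+x\<in>frontier \<Omega>. ennreal (exp (\<alpha> * \<bar>u x\<bar> powr (real n / (real n - 1))))
              \<partial>hausdorff_measure (n - 1)) \<le> ennreal C"
    by blast
qed

end
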